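(* There is a constant $R_{\epsilon,\delta,\beta}$, depending on $\epsilon,\delta,\beta$, such that for every $\eta_0\in H^2_{\mathrm{od}}(\mathbb{T}^2)$ the solution $\eta$ of the initial value problem $$\eta_t+\eta\eta_x+(\beta-1)\eta_{xx}-\eta_{yy}-\delta\Lambda^3\eta+\epsilon\Delta^2\eta=0,\quad (x,y)\in\mathbb{T}^2,\ t>0,\qquad \eta(x,y,0)=\eta_0(x,y),$$ satisfies $$\limsup_{t\to\infty}\|\eta(t)\|_{L^2(\mathbb{T}^2)}\le R_{\epsilon,\delta,\beta}.$$
   Context: $\mathbb{T}^2=[0,2\pi]^2$ with periodic boundary conditions; functions are real-valued. The nonlocal operator $\Lambda$ is defined on Fourier coefficients by $\widehat{\Lambda u}(\xi)=|\xi|\widehat{u}(\xi)$, $\xi\in\mathbb{Z}^2$, $|\xi|=(\xi_1^2+\xi_2^2)^{1/2}$. The parameters are $\beta>0$, $\delta=\gamma\lambda$ and $\epsilon=\lambda^2$, where $0\le\gamma\le 2$ and $\lambda=2\pi/L$ with $L>0$. The space of data that are odd in $x$ is $$H^2_{\mathrm{od}}(\mathbb{T}^2)=\{\eta\in H^2(\mathbb{T}^2): -\eta(-x,y)=\eta(x,y)\ \forall (x,y)\in\mathbb{T}^2\}.$$ "The solution" is the unique global solution, belonging to $C([0,T];H^2(\mathbb{T}^2))\cap L^2(0,T;H^4(\mathbb{T}^2))$ for every $0<T<\infty$. *)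

theory Defs
  imports "HOL-Analysis.Analysis"
begin

text \<open>
  Functions on the torus are functions on the plane that are \<open>2\<pi>\<close>-periodic in both
  variables. Elements of the Lebesgue and Sobolev spaces are represented by concrete functions,
  so that equality of elements is equality almost everywhere.
\<close>

type_synonym tfun = "real \<times> real \<Rightarrow> real"

definition cell :: "(real \<times> real) set" where
  "cell = {0..2*pi} \<times> {0..2*pi}"

definition L2_torus :: "tfun set" where
  "L2_torus = {u. (\<forall>x y. u (x + 2*pi, y) = u (x, y) \<and> u (x, y + 2*pi) = u (x, y)) \<and>
      u \<in> borel_measurable (lebesgue_on cell) \<and>
      integrable (lebesgue_on cell) (\<lambda>p. (u p)\<^sup>2)}"

definition L2_inner :: "tfun \<Rightarrow> tfun \<Rightarrow> real" where
  "L2_inner u v = (LINT p|lebesgue_on cell. u p * v p)"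

definition L2_norm :: "tfun \<Rightarrow> real" where
  "L2_norm u = sqrt (LINT p|lebesgue_on cell. (u p)\<^sup>2)"

definition fourier_coeff :: "tfun \<Rightarrow> int \<times> int \<Rightarrow> complex" where
  "fourier_coeff u = (\<lambda>(k, l). (LINT p|lebesgue_on cell.
      complex_of_real (u p) * exp (- \<i> * complex_of_real (k * fst p + l * snd p)))
        / complex_of_real ((2*pi)\<^sup>2))"

definition sobolev_weight :: "nat \<Rightarrow> tfun \<Rightarrow> int \<times> int \<Rightarrow> real" where
  "sobolev_weight s u = (\<lambda>(k, l).
      (1 + (real_of_int k)\<^sup>2 + (real_of_int l)\<^sup>2) ^ s * (cmod (fourier_coeff u (k, l)))\<^sup>2)"

definition H_torus :: "nat \<Rightarrow> tfun set" where
  "H_torus s = {u \<in> L2_torus. sobolev_weight s u summable_on UNIV}"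

definition H_norm :: "nat \<Rightarrow> tfun \<Rightarrow> real" where
  "H_norm s u = sqrt (\<Sum>\<^sub>\<infinity>\<xi>. sobolev_weight s u \<xi>)"

text \<open>
  Oddness is required at every point, as it holds for the continuous representative
  of an odd element of \<open>H\<^sup>2\<close>.
\<close>

definition H2_odd :: "tfun set" where
  "H2_odd = {u \<in> H_torus 2. \<forall>x y. - u (-x, y) = u (x, y)}"

text \<open>
  \<open>fourier_mult m u v\<close> says that the operator with symbol \<open>m\<close> maps \<open>u\<close> to the
  square integrable function \<open>v\<close>; it determines \<open>v\<close> almost everywhere. Spatial
  derivatives in the sense of periodic distributions are the operators with symbols
  \<open>sym_dx\<close>, \<open>sym_dy\<close> and products of these.
\<close>

definition fourier_mult :: "(int \<times> int \<Rightarrow> complex) \<Rightarrow> tfun \<Rightarrow> tfun \<Rightarrow> bool" where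
  "fourier_mult m u v \<longleftrightarrow>
     v \<in> L2_torus \<and> (\<forall>\<xi>. fourier_coeff v \<xi> = m \<xi> * fourier_coeff u \<xi>)"

definition sym_dx :: "int \<times> int \<Rightarrow> complex" where
  "sym_dx \<xi> = \<i> * of_int (fst \<xi>)"

definition sym_dy :: "int \<times> int \<Rightarrow> complex" where
  "sym_dy \<xi> = \<i> * of_int (snd \<xi>)"

definition sym_Lambda :: "int \<times> int \<Rightarrow> complex" where
  "sym_Lambda \<xi> =
     complex_of_real (sqrt ((real_of_int (fst \<xi>))\<^sup>2 + (real_of_int (snd \<xi>))\<^sup>2))"

text \<open>
  The spaces \<open>C([0,T];X)\<close> and \<open>L\<^sup>2(0,T;X)\<close> for a space \<open>X\<close> of functions on the
  torus with norm \<open>N\<close>. The second one is the Bochner space: the middle conjunct is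
  strong measurability, i.e. almost everywhere approximation in norm by simple functions.
\<close>

definition C_time :: "tfun set \<Rightarrow> (tfun \<Rightarrow> real) \<Rightarrow> real \<Rightarrow> (real \<Rightarrow> tfun) \<Rightarrow> bool" where
  "C_time X N T u \<longleftrightarrow> (\<forall>t\<in>{0..T}. u t \<in> X) \<and>
     (\<forall>s\<in>{0..T}. ((\<lambda>t. N (\<lambda>p. u t p - u s p)) \<longlongrightarrow> 0) (at s within {0..T}))"

definition L2_time :: "tfun set \<Rightarrow> (tfun \<Rightarrow> real) \<Rightarrow> real \<Rightarrow> (real \<Rightarrow> tfun) \<Rightarrow> bool" where
  "L2_time X N T u \<longleftrightarrow>
     (AE t in lebesgue_on {0..T}. u t \<in> X) \<and>
     (\<exists>f :: nat \<Rightarrow> real \<Rightarrow> tfun.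
        (\<forall>n. finite (range (f n)) \<and> range (f n) \<subseteq> X \<and>
             (\<forall>v. f n -` {v} \<in> sets lebesgue)) \<and>
        (AE t in lebesgue_on {0..T}. (\<lambda>n. N (\<lambda>p. f n t p - u t p)) \<longlonglongrightarrow> 0)) \<and>
     integrable (lebesgue_on {0..T}) (\<lambda>t. (N (u t))\<^sup>2)"

text \<open>
  \<open>w\<close> is the time derivative of \<open>u\<close>: \<open>u(t) - u(s)\<close> is the integral of \<open>w\<close> over
  \<open>[s,t]\<close> in \<open>L\<^sup>2\<close>. The identity between elements of \<open>L\<^sup>2\<close> is expressed by pairing
  with arbitrary elements of \<open>L\<^sup>2\<close>, which commutes with the Bochner integral.
\<close>

definition has_time_derivative :: "(real \<Rightarrow> tfun) \<Rightarrow> (real \<Rightarrow> tfun) \<Rightarrow> bool" where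
  "has_time_derivative u w \<longleftrightarrow>
     (\<forall>T>0. L2_time L2_torus L2_norm T w) \<and>
     (\<forall>s t. 0 \<le> s \<and> s \<le> t \<longrightarrow> (\<forall>\<psi>\<in>L2_torus.
        L2_inner (u t) \<psi> - L2_inner (u s) \<psi> =
          (LINT r|lebesgue_on {s..t}. L2_inner (w r) \<psi>)))"

text \<open>
  For \<open>\<eta>\<close> in the class below every term of the equation lies in \<open>L\<^sup>2(0,T;L\<^sup>2)\<close>,
  so the equation is required to hold almost everywhere.
\<close>

definition global_solution ::
    "real \<Rightarrow> real \<Rightarrow> real \<Rightarrow> tfun \<Rightarrow> (real \<Rightarrow> tfun) \<Rightarrow> bool" where
  "global_solution \<beta> \<delta> \<epsilon> \<eta>\<^sub>0 \<eta> \<longleftrightarrow>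
     (\<forall>T>0. C_time (H_torus 2) (H_norm 2) T \<eta> \<and> L2_time (H_torus 4) (H_norm 4) T \<eta>) \<and>
     (\<exists>\<eta>t. has_time_derivative \<eta> \<eta>t \<and>
        (AE t in lebesgue_on {0..}. \<exists>\<eta>x \<eta>xx \<eta>yy \<Lambda>3\<eta> \<Delta>2\<eta>.
           fourier_mult sym_dx (\<eta> t) \<eta>x \<and>
           fourier_mult (\<lambda>\<xi>. sym_dx \<xi> ^ 2) (\<eta> t) \<eta>xx \<and>
           fourier_mult (\<lambda>\<xi>. sym_dy \<xi> ^ 2) (\<eta> t) \<eta>yy \<and>
           fourier_mult (\<lambda>\<xi>. sym_Lambda \<xi> ^ 3) (\<eta> t) \<Lambda>3\<eta> \<and>
           fourier_mult (\<lambda>\<xi>. (sym_dx \<xi> ^ 2 + sym_dy \<xi> ^ 2) ^ 2) (\<eta> t) \<Delta>2\<eta> \<and>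
           (AE p in lebesgue.
              \<eta>t t p + \<eta> t p * \<eta>x p + (\<beta> - 1) * \<eta>xx p - \<eta>yy p
                - \<delta> * \<Lambda>3\<eta> p + \<epsilon> * \<Delta>2\<eta> p = 0))) \<and>
     (AE p in lebesgue. \<eta> 0 p = \<eta>\<^sub>0 p)"

end

theory Submission
  imports Defs
begin

text \<open>
  Fix a smooth profile \<open>\<Phi>(x)\<close> with \<open>\<Phi>' = q (1 - F)\<close>, where \<open>F \<ge> 0\<close> is a Fejer kernel of mean 1, and
  test the equation with \<open>\<eta> - \<Phi>\<close>. The cubic term vanishes and the transport term leaves
  \<open>- q/2 \<parallel>\<eta>\<parallel>\<^sup>2 + q/2 \<integral> F \<eta>\<^sup>2\<close>. As \<open>\<eta>\<close> is odd in \<open>x\<close> it vanishes at \<open>x = 0\<close>, where \<open>F\<close> concentrates, so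
  \<open>\<integral> F \<eta>\<^sup>2 \<le> m \<parallel>\<eta>\<^sub>x\<parallel>\<^sup>2\<close> with \<open>m\<close> as small as desired. The linear part dominates \<open>\<parallel>\<eta>\<^sub>x\<parallel>\<^sup>2 - C \<parallel>\<eta>\<parallel>\<^sup>2\<close>, hence
  \<open>q = 2 (C + 1)\<close> makes \<open>\<parallel>\<eta> - \<Phi>\<parallel>\<^sup>2\<close> decay outside a ball whose radius does not depend on the data.
\<close>

section \<open>The space L2 of the torus and reflection in x\<close>

text \<open>Testing with \<eta> alone is not enough: the linear part can be unstable at low
  frequencies. Three obstacles shape the rest. Neither uniqueness nor oddness for t > 0 is part of
  \<open>global_solution\<close>, so oddness is derived from the equation: the even part of a
  solution starts at zero and obeys a linear inequality with an integrable coefficient. Vanishing at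
  x = 0 is meaningless for an almost everywhere class, so for almost every time a continuous
  representative with continuous x-derivative is built from the absolutely convergent Fourier series
  of an H^4 function. Finally, the time derivative is known only through pairings with fixed
  elements of L2, so the energy inequality comes from increments over short intervals instead of a
  product rule. The mean of F is 1 so that \<Phi>, a primitive of q (1 - F), is periodic; F being a
  trigonometric polynomial, \<Phi> is a finite sine sum, onto which the linear operator moves by
  comparing finitely many Fourier coefficients.\<close>

lemma cell_cbox: "cell = cbox (0, 0) (2*pi, 2*pi)"
  by (auto simp: cell_def cbox_Pair_eq)

lemma cell_lebesgue [measurable, simp]: "cell \<in> sets lebesgue"
  by (simp add: cell_cbox)

lemma compact_cell: "compact cell"
  by (simp add: cell_cbox)

lemma finite_measure_cell: "finite_measure (lebesgue_on cell)"
  by (rule finite_measure_lebesgue_on) (simp add: cell_cbox)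

lemma L2_torusD:
  assumes "u \<in> L2_torus"
  shows "u \<in> borel_measurable (lebesgue_on cell)" "integrable (lebesgue_on cell) (\<lambda>p. (u p)\<^sup>2)"
    "u (x + 2*pi, y) = u (x, y)" "u (x, y + 2*pi) = u (x, y)"
  using assms by (auto simp: L2_torus_def)

lemma L2_product_integrable:
  fixes u v :: "'a \<Rightarrow> real"
  assumes "u \<in> borel_measurable M" "v \<in> borel_measurable M"
    "integrable M (\<lambda>p. (u p)\<^sup>2)" "integrable M (\<lambda>p. (v p)\<^sup>2)"
  shows "integrable M (\<lambda>p. u p * v p)"
proof (rule Bochner_Integration.integrable_bound)
  show "integrable M (\<lambda>p. (u p)\<^sup>2 + (v p)\<^sup>2)" using assms by simp
  show "(\<lambda>p. u p * v p) \<in> borel_measurable M" using assms by simp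
  have "\<bar>a * b\<bar> \<le> a\<^sup>2 + b\<^sup>2" for a b :: real
    using sum_squares_bound[of a b] sum_squares_bound[of a "- b"] zero_le_power2[of a] zero_le_power2[of b]
    unfolding abs_le_iff by (auto simp: algebra_simps)
  then show "AE p in M. norm (u p * v p) \<le> norm ((u p)\<^sup>2 + (v p)\<^sup>2)" by simp
qed

lemma L2_torus_prod:
  "\<lbrakk>u \<in> L2_torus; v \<in> L2_torus\<rbrakk> \<Longrightarrow> integrable (lebesgue_on cell) (\<lambda>p. u p * v p)"
  by (intro L2_product_integrable L2_torusD)

lemma L2_torus_scale: "u \<in> L2_torus \<Longrightarrow> (\<lambda>p. c * u p) \<in> L2_torus"
  by (auto simp: L2_torus_def power_mult_distrib)

lemma L2_torus_add:
  assumes "u \<in> L2_torus" "v \<in> L2_torus"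
  shows "(\<lambda>p. u p + v p) \<in> L2_torus"
  using assms L2_torus_prod[OF assms] by (auto simp: L2_torus_def power2_sum mult.assoc)

lemma L2_torus_diff:
  assumes "u \<in> L2_torus" "v \<in> L2_torus"
  shows "(\<lambda>p. u p - v p) \<in> L2_torus"
  using L2_torus_add[OF assms(1) L2_torus_scale[OF assms(2), of "-1"]] by simp

lemma L2_torus_zero: "(\<lambda>p. 0) \<in> L2_torus"
  by (simp add: L2_torus_def)

lemma L2_torus_sum:
  "(\<And>i. i \<in> I \<Longrightarrow> f i \<in> L2_torus) \<Longrightarrow> (\<lambda>p. \<Sum>i\<in>I. f i p) \<in> L2_torus"
  by (induction I rule: infinite_finite_induct) (auto intro: L2_torus_zero L2_torus_add)

lemma L2_inner_commute: "L2_inner u v = L2_inner v u"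
  by (simp add: L2_inner_def mult.commute)

lemma L2_inner_scale: "L2_inner (\<lambda>p. c * u p) v = c * L2_inner u v"
  by (simp add: L2_inner_def mult.assoc)

lemma L2_inner_scale_right: "L2_inner v (\<lambda>p. c * u p) = c * L2_inner v u"
  using L2_inner_scale[of c u v] by (simp add: L2_inner_commute)

lemma L2_inner_add:
  "\<lbrakk>u \<in> L2_torus; v \<in> L2_torus; w \<in> L2_torus\<rbrakk> \<Longrightarrow>
     L2_inner (\<lambda>p. u p + v p) w = L2_inner u w + L2_inner v w"
  by (simp add: L2_inner_def distrib_right L2_torus_prod)

lemma L2_inner_add_right:
  "\<lbrakk>u \<in> L2_torus; v \<in> L2_torus; w \<in> L2_torus\<rbrakk> \<Longrightarrow>
     L2_inner w (\<lambda>p. u p + v p) = L2_inner w u + L2_inner w v"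
  using L2_inner_add[of u v w] by (simp add: L2_inner_commute)

lemma L2_inner_diff:
  "\<lbrakk>u \<in> L2_torus; v \<in> L2_torus; w \<in> L2_torus\<rbrakk> \<Longrightarrow>
     L2_inner (\<lambda>p. u p - v p) w = L2_inner u w - L2_inner v w"
  by (simp add: L2_inner_def left_diff_distrib L2_torus_prod)

lemma L2_inner_diff_right:
  "\<lbrakk>u \<in> L2_torus; v \<in> L2_torus; w \<in> L2_torus\<rbrakk> \<Longrightarrow>
     L2_inner w (\<lambda>p. u p - v p) = L2_inner w u - L2_inner w v"
  using L2_inner_diff[of u v w] by (simp add: L2_inner_commute)

lemma L2_inner_sum_right:
  "\<lbrakk>\<And>i. i \<in> I \<Longrightarrow> f i \<in> L2_torus; w \<in> L2_torus\<rbrakk> \<Longrightarrow>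
     L2_inner w (\<lambda>p. \<Sum>i\<in>I. f i p) = (\<Sum>i\<in>I. L2_inner w (f i))"
  by (simp add: L2_inner_def sum_distrib_left L2_torus_prod)

lemma L2_inner_self_ge: "0 \<le> L2_inner u u"
  by (simp add: L2_inner_def)

lemma L2_norm_power2: "(L2_norm u)\<^sup>2 = L2_inner u u"
  by (simp add: L2_norm_def L2_inner_def power2_eq_square)

lemma L2_norm_ge: "0 \<le> L2_norm u"
  by (simp add: L2_norm_def)

lemma L2_norm_sqrt: "L2_norm u = sqrt (L2_inner u u)"
  by (simp add: L2_norm_def L2_inner_def power2_eq_square)

text \<open>The discriminant argument. Elements are functions, so \<open>L2_inner\<close> is only
  positive semidefinite and a \<open>v\<close> of norm zero is treated apart.\<close>

lemma L2_Cauchy_Schwarz: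
  assumes "u \<in> L2_torus" "v \<in> L2_torus"
  shows "\<bar>L2_inner u v\<bar> \<le> L2_norm u * L2_norm v"
proof -
  let ?A = "L2_inner u u" and ?B = "L2_inner u v" and ?C = "L2_inner v v"
  have q: "0 \<le> ?A - 2 * t * ?B + t\<^sup>2 * ?C" for t
  proof -
    have "0 \<le> L2_inner (\<lambda>p. u p - t * v p) (\<lambda>p. u p - t * v p)" by (rule L2_inner_self_ge)
    also have "\<dots> = ?A - 2 * t * ?B + t\<^sup>2 * ?C"
      using assms by (simp add: L2_inner_diff L2_inner_diff_right L2_inner_scale L2_torus_diff
          L2_inner_scale_right L2_torus_scale L2_inner_commute[of v u] power2_eq_square algebra_simps)
    finally show ?thesis .
  qed
  have "?B\<^sup>2 \<le> ?A * ?C"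
  proof (cases "?C = 0")
    case True
    have "?B = 0"
    proof (rule ccontr)
      assume "?B \<noteq> 0"
      \<comment> \<open>With \<open>?C = 0\<close> the quadratic is affine in t; at this t it equals
        -1.\<close>
      with q[of "(?A + 1) / (2 * ?B)"] True show False by simp
    qed
    then show ?thesis using True by simp
  next
    case False
    with L2_inner_self_ge[of v] have "?C > 0" by simp
    then show ?thesis using q[of "?B / ?C"] by (simp add: field_simps power2_eq_square)
  qed
  then have "\<bar>?B\<bar> \<le> sqrt (?A * ?C)" by (simp add: real_le_rsqrt)
  then show ?thesis by (simp add: L2_norm_sqrt real_sqrt_mult)
qed

lemma L2_norm_triangle:
  assumes "u \<in> L2_torus" "v \<in> L2_torus"
  shows "L2_norm (\<lambda>p. u p + v p) \<le> L2_norm u + L2_norm v"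
proof (rule power2_le_imp_le)
  have "(L2_norm (\<lambda>p. u p + v p))\<^sup>2 = L2_inner u u + 2 * L2_inner u v + L2_inner v v"
    using assms by (simp add: L2_norm_power2 L2_inner_add L2_inner_add_right L2_torus_add
        L2_inner_commute[of v u])
  also have "\<dots> \<le> (L2_norm u + L2_norm v)\<^sup>2"
    using L2_Cauchy_Schwarz[OF assms] by (simp add: power2_sum L2_norm_power2)
  finally show "(L2_norm (\<lambda>p. u p + v p))\<^sup>2 \<le> (L2_norm u + L2_norm v)\<^sup>2" .
qed (simp add: L2_norm_ge)

lemma continuous_integrable_cell:
  fixes f :: "real \<times> real \<Rightarrow> 'b::euclidean_space"
  shows "continuous_on UNIV f \<Longrightarrow> integrable (lebesgue_on cell) f"
  unfolding cell_cbox by (metis continuous_imp_integrable continuous_on_subset subset_UNIV)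

lemma continuous_L2_torus:
  fixes f :: tfun
  assumes "continuous_on UNIV f" "\<And>x y. f (x + 2*pi, y) = f (x, y)" "\<And>x y. f (x, y + 2*pi) = f (x, y)"
  shows "f \<in> L2_torus"
  unfolding L2_torus_def using assms
  by (auto intro!: borel_measurable_integrable continuous_integrable_cell continuous_intros)

definition xrefl :: "tfun \<Rightarrow> tfun" where
  "xrefl u = (\<lambda>(x, y). u (- x, y))"

lemma xrefl_refl [simp]: "xrefl (xrefl u) = u"
  by (auto simp: xrefl_def)

lemma xrefl_apply [simp]: "xrefl u (x, y) = u (- x, y)"
  by (simp add: xrefl_def)

text \<open>The cell is not invariant under x -> -x, so reflection is realised as x -> 2 pi - x,
  which maps the cell onto itself and agrees with \<open>xrefl\<close> on periodic
  functions.\<close>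

lemma lebesgue_flip:
  defines "T \<equiv> (\<lambda>p :: real \<times> real. (2*pi - fst p, snd p))"
  shows "T \<in> lebesgue \<rightarrow>\<^sub>M lebesgue" "distr lebesgue lebesgue T = lebesgue"
proof -
  define c :: "real \<times> real \<Rightarrow> real" where "c = (\<lambda>j. if j = (1, 0) then -1 else 1)"
  have T: "T = (\<lambda>x. (2*pi, 0) + (\<Sum>j\<in>Basis. (c j * (x \<bullet> j)) *\<^sub>R j))"
    by (auto simp: T_def c_def Basis_prod_def fun_eq_iff sum.union_disjoint)
  show "T \<in> lebesgue \<rightarrow>\<^sub>M lebesgue"
    unfolding T by (rule lebesgue_affine_measurable) (simp add: c_def)
  have "lebesgue = density (distr lebesgue lebesgue T) (\<lambda>_. (\<Prod>j\<in>Basis. \<bar>c j\<bar>))"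
    unfolding T by (rule lebesgue_affine_euclidean) (simp add: c_def)
  also have "(\<Prod>j\<in>Basis. \<bar>c j\<bar>) = 1" by (rule prod.neutral) (simp add: c_def)
  finally show "distr lebesgue lebesgue T = lebesgue" by (simp add: density_1)
qed

lemma flip_cell: "(2*pi - fst p, snd p) \<in> cell \<longleftrightarrow> p \<in> cell"
  by (cases p) (auto simp: cell_def)

lemma measurable_flip_cell:
  fixes f :: "real \<times> real \<Rightarrow> 'b::euclidean_space"
  assumes "f \<in> borel_measurable (lebesgue_on cell)"
  shows "(\<lambda>p. f (2*pi - fst p, snd p)) \<in> borel_measurable (lebesgue_on cell)"
proof -
  have "(\<lambda>p. if p \<in> cell then f p else 0) \<in> borel_measurable lebesgue"
    using assms by (simp add: borel_measurable_if)
  from measurable_compose[OF lebesgue_flip(1) this]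
  show ?thesis by (simp add: flip_cell borel_measurable_if)
qed

lemma integral_flip_cell:
  fixes f :: "real \<times> real \<Rightarrow> 'b::euclidean_space"
  assumes "f \<in> borel_measurable (lebesgue_on cell)"
  shows "(LINT p|lebesgue_on cell. f (2*pi - fst p, snd p)) = (LINT p|lebesgue_on cell. f p)"
    and "integrable (lebesgue_on cell) f \<Longrightarrow>
      integrable (lebesgue_on cell) (\<lambda>p. f (2*pi - fst p, snd p))"
proof -
  let ?g = "\<lambda>p. indicator cell p *\<^sub>R f p"
  have m: "?g \<in> borel_measurable lebesgue"
    using assms by (simp add: borel_measurable_restrict_space_iff)
  have ind: "indicator cell (2*pi - fst p, snd p) = (indicator cell p :: real)" for p
    by (simp add: indicator_def flip_cell)
  have "(LINT p|lebesgue. ?g p) = (LINT p|distr lebesgue lebesgue (\<lambda>p. (2*pi - fst p, snd p)). ?g p)"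
    by (simp add: lebesgue_flip(2))
  also have "\<dots> = (LINT p|lebesgue. ?g (2*pi - fst p, snd p))"
    by (rule integral_distr) (use m lebesgue_flip(1) in auto)
  finally show "(LINT p|lebesgue_on cell. f (2*pi - fst p, snd p)) = (LINT p|lebesgue_on cell. f p)"
    by (simp add: integral_restrict_space ind)
  assume "integrable (lebesgue_on cell) f"
  then have "integrable lebesgue ?g" by (simp add: integrable_restrict_space)
  then have "integrable (distr lebesgue lebesgue (\<lambda>p. (2*pi - fst p, snd p))) ?g"
    by (simp add: lebesgue_flip(2))
  then have "integrable lebesgue (\<lambda>p. ?g (2*pi - fst p, snd p))"
    using integrable_distr_eq[OF lebesgue_flip(1) m] by simp
  then show "integrable (lebesgue_on cell) (\<lambda>p. f (2*pi - fst p, snd p))"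
    by (simp add: integrable_restrict_space ind)
qed

lemma xrefl_flip:
  assumes "u \<in> L2_torus"
  shows "xrefl u p = u (2*pi - fst p, snd p)"
  using L2_torusD(3)[OF assms, of "- fst p" "snd p"] by (simp add: xrefl_def split_beta add.commute)

lemma L2_torus_xrefl:
  assumes "u \<in> L2_torus"
  shows "xrefl u \<in> L2_torus"
proof -
  have eq: "xrefl u = (\<lambda>p. u (2*pi - fst p, snd p))" by (rule ext) (rule xrefl_flip[OF assms])
  have "u (- x - 2*pi, y) = u (- x, y)" for x y
    using L2_torusD(3)[OF assms, of "- x - 2*pi" y] by simp
  then have per: "xrefl u (x + 2*pi, y) = xrefl u (x, y)" "xrefl u (x, y + 2*pi) = xrefl u (x, y)" for x y
    using L2_torusD(4)[OF assms] by (auto simp: xrefl_def)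
  have "integrable (lebesgue_on cell) (\<lambda>p. (xrefl u p)\<^sup>2)"
    unfolding eq by (rule integral_flip_cell(2)) (use L2_torusD[OF assms] in auto)
  moreover have "xrefl u \<in> borel_measurable (lebesgue_on cell)"
    unfolding eq by (rule measurable_flip_cell) (use L2_torusD[OF assms] in auto)
  ultimately show ?thesis using per unfolding L2_torus_def by blast
qed

text \<open>Reflection is a measure preserving involution, hence symmetric. This later moves it from
  the solution onto the test function.\<close>

lemma L2_inner_xrefl:
  assumes "u \<in> L2_torus" "v \<in> L2_torus"
  shows "L2_inner (xrefl u) v = L2_inner u (xrefl v)"
proof -
  have "L2_inner (xrefl u) v = (LINT p|lebesgue_on cell. u (2*pi - fst p, snd p) * v p)"
    by (simp add: L2_inner_def xrefl_flip assms)
  also have "\<dots> = L2_inner u (xrefl v)"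
    using integral_flip_cell(1)[of "\<lambda>p. u p * xrefl v p"] L2_torusD(1)[OF assms(1)]
      L2_torusD(1)[OF L2_torus_xrefl[OF assms(2)]] xrefl_flip[OF L2_torus_xrefl[OF assms(2)]]
    by (simp add: L2_inner_def)
  finally show ?thesis .
qed

lemma fourier_coeff_xrefl:
  assumes "u \<in> L2_torus"
  shows "fourier_coeff (xrefl u) (k, l) = fourier_coeff u (- k, l)"
proof -
  let ?f = "\<lambda>p :: real \<times> real. complex_of_real (u p) * exp (- \<i> * complex_of_real (- of_int k * fst p + of_int l * snd p))"
  have "?f \<in> borel_measurable (lebesgue_on cell)"
    by (rule borel_measurable_times[OF measurable_compose[OF L2_torusD(1)[OF assms] borel_measurable_of_real]
        borel_measurable_integrable[OF continuous_integrable_cell]]) (auto intro!: continuous_intros)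
  from integral_flip_cell(1)[OF this]
  have "(LINT p|lebesgue_on cell. ?f (2*pi - fst p, snd p)) = (LINT p|lebesgue_on cell. ?f p)" .
  moreover have "?f (2*pi - fst p, snd p)
      = complex_of_real (xrefl u p) * exp (- \<i> * complex_of_real (of_int k * fst p + of_int l * snd p))" for p
  proof -
    have "exp (- \<i> * complex_of_real (- of_int k * (2*pi - fst p) + of_int l * snd p))
        = exp (- \<i> * complex_of_real (of_int k * fst p + of_int l * snd p) + of_int (2 * k) * of_real pi * \<i>)"
      by (rule arg_cong[of _ _ exp]) (simp add: algebra_simps)
    also have "\<dots> = exp (- \<i> * complex_of_real (of_int k * fst p + of_int l * snd p))"
      using exp_plus_2pin[of "- \<i> * complex_of_real (of_int k * fst p + of_int l * snd p)" k]
      by (simp add: algebra_simps)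
    finally show ?thesis by (simp add: xrefl_flip[OF assms])
  qed
  ultimately show ?thesis by (simp add: fourier_coeff_def)
qed

section \<open>Characters and trigonometric polynomials\<close>

definition ch :: "int \<times> int \<Rightarrow> real \<times> real \<Rightarrow> complex" where
  "ch \<xi> p = cis (of_int (fst \<xi>) * fst p + of_int (snd \<xi>) * snd p)"

lemma ch_add: "ch (\<xi> + \<eta>) p = ch \<xi> p * ch \<eta> p"
  by (simp add: ch_def cis_mult algebra_simps)

lemma ch_0 [simp]: "ch 0 p = 1" "ch (0, 0) p = 1"
  by (simp_all add: ch_def)

lemma cnj_ch: "cnj (ch \<xi> p) = ch (- \<xi>) p"
  by (simp add: ch_def cis_cnj algebra_simps)

lemma norm_ch [simp]: "cmod (ch \<xi> p) = 1"
  by (simp add: ch_def)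

lemma continuous_ch [continuous_intros]: "continuous_on A (ch \<xi>)"
proof -
  have "ch \<xi> = (\<lambda>p. exp (\<i> * complex_of_real (of_int (fst \<xi>) * fst p + of_int (snd \<xi>) * snd p)))"
    by (simp add: ch_def cis_conv_exp fun_eq_iff)
  then show ?thesis by (auto intro!: continuous_intros)
qed

lemma fourier_coeff_ch:
  "fourier_coeff u \<xi> = (LINT p|lebesgue_on cell. complex_of_real (u p) * ch (- \<xi>) p) / of_real ((2*pi)\<^sup>2)"
  by (simp add: fourier_coeff_def ch_def cis_conv_exp case_prod_beta algebra_simps)

lemma integral_cis:
  "integral {0..2*pi} (\<lambda>x. cis (of_int k * x)) = (if k = 0 then 2*pi else 0)"
proof (cases "k = 0")
  case False
  have "((\<lambda>x. cis (of_int k * x)) has_integral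
     cis (of_int k * (2*pi)) / (\<i> * of_int k) - cis (of_int k * 0) / (\<i> * of_int k)) {0..2*pi}"
  proof (rule fundamental_theorem_of_calculus)
    show "((\<lambda>x. cis (of_int k * x) / (\<i> * of_int k)) has_vector_derivative cis (of_int k * x))
        (at x within {0..2*pi})" for x
    proof -
      have "((\<lambda>z. exp (\<i> * (of_int k * z)) / (\<i> * of_int k)) has_field_derivative
          exp (\<i> * (of_int k * z))) (at z within S)" for z :: complex and S
        using False by (auto intro!: derivative_eq_intros simp: mult.commute[of _ "\<i>"])
      from has_vector_derivative_real_field[OF this, of "of_real x"]
      show ?thesis by (simp add: cis_conv_exp)
    qed
  qed simp
  moreover have "cis (of_int k * (2*pi)) = 1"
    by (metis cis_2pi cis_power_int mult.commute power_int_1_left)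
  ultimately show ?thesis using False by (simp add: integral_unique)
qed (simp add: scaleR_conv_of_real)

text \<open>Both orders are kept: the second has x innermost, so one-dimensional facts in x at fixed
  y can be integrated over y.\<close>

lemma integral_cell_continuous:
  fixes f :: "real \<times> real \<Rightarrow> 'b::euclidean_space"
  assumes "continuous_on UNIV f"
  shows "(LINT p|lebesgue_on cell. f p) = integral {0..2*pi} (\<lambda>x. integral {0..2*pi} (\<lambda>y. f (x, y)))"
    and "(LINT p|lebesgue_on cell. f p) = integral {0..2*pi} (\<lambda>y. integral {0..2*pi} (\<lambda>x. f (x, y)))"
proof -
  have "(LINT p|lebesgue_on cell. f p) = integral cell f"
    by (rule lebesgue_integral_eq_integral[OF continuous_integrable_cell[OF assms]]) simp
  also have "\<dots> = integral {0..2*pi} (\<lambda>x. integral {0..2*pi} (\<lambda>y. f (x, y)))"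
    unfolding cell_cbox using integral_prod_continuous[of 0 0 "2*pi" "2*pi" f]
    by (simp add: continuous_on_subset[OF assms] cbox_interval)
  finally show "(LINT p|lebesgue_on cell. f p) = integral {0..2*pi} (\<lambda>x. integral {0..2*pi} (\<lambda>y. f (x, y)))" .
  also have "\<dots> = integral {0..2*pi} (\<lambda>y. integral {0..2*pi} (\<lambda>x. f (x, y)))"
    using integral_swap_continuous[of 0 0 "2*pi" "2*pi" "\<lambda>x y. f (x, y)"]
    by (simp add: continuous_on_subset[OF assms] cbox_interval)
  finally show "(LINT p|lebesgue_on cell. f p) = integral {0..2*pi} (\<lambda>y. integral {0..2*pi} (\<lambda>x. f (x, y)))" .
qed

lemma integral_ch:
  "(LINT p|lebesgue_on cell. ch \<xi> p) = (if \<xi> = 0 then of_real ((2*pi)\<^sup>2) else 0)"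
proof -
  have "(LINT p|lebesgue_on cell. ch \<xi> p) = integral {0..2*pi} (\<lambda>x. integral {0..2*pi} (\<lambda>y. ch \<xi> (x, y)))"
    by (rule integral_cell_continuous) (rule continuous_ch)
  also have "\<dots> = integral {0..2*pi} (\<lambda>x. cis (of_int (fst \<xi>) * x)) * integral {0..2*pi} (\<lambda>y. cis (of_int (snd \<xi>) * y))"
    by (simp add: ch_def flip: cis_mult)
  also have "\<dots> = (if \<xi> = 0 then of_real ((2*pi)\<^sup>2) else 0)"
    by (auto simp: integral_cis prod_eq_iff power2_eq_square)
  finally show ?thesis .
qed

inductive trig_poly :: "(real \<times> real \<Rightarrow> complex) \<Rightarrow> bool" where
  monom: "trig_poly (\<lambda>p. c * ch \<xi> p)"
| add: "trig_poly f \<Longrightarrow> trig_poly g \<Longrightarrow> trig_poly (\<lambda>p. f p + g p)"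

lemma trig_poly_monom_mult: "trig_poly g \<Longrightarrow> trig_poly (\<lambda>p. c * ch \<xi> p * g p)"
proof (induction rule: trig_poly.induct)
  case (monom d \<eta>)
  show ?case using trig_poly.monom[of "c * d" "\<xi> + \<eta>"] by (simp add: ch_add algebra_simps)
next
  case (add f g)
  then show ?case using trig_poly.add[OF add.IH] by (simp add: distrib_left)
qed

lemma trig_poly_mult: "trig_poly f \<Longrightarrow> trig_poly g \<Longrightarrow> trig_poly (\<lambda>p. f p * g p)"
proof (induction rule: trig_poly.induct)
  case (monom c \<xi>)
  then show ?case by (rule trig_poly_monom_mult)
next
  case (add f f')
  then show ?case using trig_poly.add[OF add.IH(1)[OF add.prems] add.IH(2)[OF add.prems]] by (simp add: distrib_right)
qed

lemma trig_poly_const: "trig_poly (\<lambda>p. c)"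
  using trig_poly.monom[of c 0] by simp

lemma trig_poly_scale: "trig_poly f \<Longrightarrow> trig_poly (\<lambda>p. c * f p)"
  using trig_poly_mult[OF trig_poly_const] by simp

text \<open>Equal frequencies are merged by extending both coefficient families by zero to the union
  of the supports. \<open>trig_distance\<close> needs each frequency at most once.\<close>

lemma trig_poly_sum_form:
  "trig_poly f \<Longrightarrow> \<exists>F c. finite F \<and> f = (\<lambda>p. \<Sum>\<xi>\<in>F. c \<xi> * ch \<xi> p)"
proof (induction rule: trig_poly.induct)
  case (monom c \<xi>)
  show ?case by (rule exI[of _ "{\<xi>}"], rule exI[of _ "\<lambda>_. c"]) simp
next
  case (add f g)
  then obtain F c G d where *: "finite F" "f = (\<lambda>p. \<Sum>\<xi>\<in>F. c \<xi> * ch \<xi> p)"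
      "finite G" "g = (\<lambda>p. \<Sum>\<xi>\<in>G. d \<xi> * ch \<xi> p)" by blast
  have "(\<Sum>\<xi>\<in>F. c \<xi> * ch \<xi> p) = (\<Sum>\<xi>\<in>F \<union> G. (if \<xi> \<in> F then c \<xi> else 0) * ch \<xi> p)" for p
    using * by (intro sum.mono_neutral_cong_left) auto
  moreover have "(\<Sum>\<xi>\<in>G. d \<xi> * ch \<xi> p) = (\<Sum>\<xi>\<in>F \<union> G. (if \<xi> \<in> G then d \<xi> else 0) * ch \<xi> p)" for p
    using * by (intro sum.mono_neutral_cong_left) auto
  ultimately have "(\<lambda>p. f p + g p) = (\<lambda>p. \<Sum>\<xi>\<in>F \<union> G.
      ((if \<xi> \<in> F then c \<xi> else 0) + (if \<xi> \<in> G then d \<xi> else 0)) * ch \<xi> p)"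
    by (simp add: * sum.distrib distrib_right)
  moreover have "finite (F \<union> G)" using * by simp
  ultimately show ?case by (intro exI conjI)
qed

lemma continuous_trig_poly: "trig_poly f \<Longrightarrow> continuous_on UNIV f"
  by (induction rule: trig_poly.induct) (auto intro!: continuous_intros)

lemma trig_poly_cos_sin:
  "trig_poly (\<lambda>p. of_real (cos (fst p)))" "trig_poly (\<lambda>p. of_real (sin (fst p)))"
  "trig_poly (\<lambda>p. of_real (cos (snd p)))" "trig_poly (\<lambda>p. of_real (sin (snd p)))"
proof -
  have *: "trig_poly (\<lambda>p. c * ch \<xi> p + d * ch (- \<xi>) p)" for c d \<xi>
    by (intro trig_poly.intros)
  have c: "complex_of_real (cos x) = 1/2 * cis x + 1/2 * cis (- x)"
    and s: "complex_of_real (sin x) = - \<i>/2 * cis x + \<i>/2 * cis (- x)" for x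
    by (simp_all add: complex_eq_iff)
  show "trig_poly (\<lambda>p. of_real (cos (fst p)))" "trig_poly (\<lambda>p. of_real (cos (snd p)))"
    using *[of "1/2" "(1, 0)" "1/2"] *[of "1/2" "(0, 1)" "1/2"] unfolding c by (simp_all add: ch_def)
  show "trig_poly (\<lambda>p. of_real (sin (fst p)))" "trig_poly (\<lambda>p. of_real (sin (snd p)))"
    using *[of "- \<i>/2" "(1, 0)" "\<i>/2"] *[of "- \<i>/2" "(0, 1)" "\<i>/2"] unfolding s by (simp_all add: ch_def)
qed

text \<open>The link to Stone-Weierstrass: the four real coordinates of the embedded torus are sines
  and cosines, so a real polynomial in them is a trigonometric polynomial.\<close>

lemma trig_poly_of_polynomial:
  assumes "real_polynomial_function g"
  shows "trig_poly (\<lambda>p. of_real (g (cis (fst p), cis (snd p))))"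
  using assms
proof (induction rule: real_polynomial_function.induct)
  case (linear f)
  interpret bounded_linear f by fact
  have "f (cis x, cis y) = cos x * f (1, 0) + sin x * f (\<i>, 0) + cos y * f (0, 1) + sin y * f (0, \<i>)" for x y
  proof -
    have "(cis x, cis y) = cos x *\<^sub>R (1, 0) + sin x *\<^sub>R (\<i>, 0) + cos y *\<^sub>R (0, 1) + sin y *\<^sub>R (0, \<i>)"
      by (simp add: complex_eq_iff)
    then show ?thesis by (simp only: add scaleR real_scaleR_def)
  qed
  then show ?case
    by (auto intro!: trig_poly.add trig_poly_mult trig_poly_const trig_poly_cos_sin)
next
  case (const c)
  show ?case by (rule trig_poly_const)
next
  case (add f g)
  then show ?case using trig_poly.add[OF add.IH] by simp
next
  case (mult f g)
  then show ?case using trig_poly_mult[OF mult.IH] by simp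
qed

section \<open>Density of trigonometric polynomials in L2 of the cell\<close>

lemma cis_eq_period:
  assumes "cis x = cis y" "x \<in> {0..2*pi}" "y \<in> {0..2*pi}"
  shows "x = y \<or> (x \<in> {0, 2*pi} \<and> y \<in> {0, 2*pi})"
proof -
  have "sin x = sin y \<and> cos x = cos y" using assms(1) by (simp add: complex_eq_iff)
  then obtain n :: int where n: "x = y + 2 * pi * n" using sin_cos_eq_iff[of x y] by (auto simp: mult_ac)
  have "\<bar>2 * pi * n\<bar> \<le> 2 * pi" using n assms(2,3) by auto
  then have "\<bar>n\<bar> \<le> 1" by (simp add: abs_mult)
  then have "n = 0 \<or> n = 1 \<or> n = -1" by linarith
  then show ?thesis using n assms(2,3) by auto
qed

text \<open>The embedding \<open>?t\<close> of the torus into pairs of complex numbers identifies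
  only boundary points of the cell, where \<open>f\<close> is zero. Hence \<open>f\<close> factors
  through the compact image, on which polynomials are dense.\<close>

lemma trig_poly_approx_continuous:
  fixes f :: tfun
  assumes f: "continuous_on cell f" and f0: "\<And>p. p \<notin> {0<..<2*pi} \<times> {0<..<2*pi} \<Longrightarrow> f p = 0" and "e > 0"
  shows "\<exists>T. trig_poly T \<and> (\<forall>p\<in>cell. cmod (of_real (f p) - T p) < e)"
proof -
  let ?t = "\<lambda>p :: real \<times> real. (cis (fst p), cis (snd p))"
  have t: "continuous_on cell ?t"
    by (auto simp: cis_conv_exp intro!: continuous_intros)
  have inj: "f p = f q" if "?t p = ?t q" "p \<in> cell" "q \<in> cell" for p q
  proof -
    obtain x y x' y' where [simp]: "p = (x, y)" "q = (x', y')" by (cases p, cases q) auto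
    have "x = x' \<or> (x \<in> {0, 2*pi} \<and> x' \<in> {0, 2*pi})" "y = y' \<or> (y \<in> {0, 2*pi} \<and> y' \<in> {0, 2*pi})"
      using that cis_eq_period[of x x'] cis_eq_period[of y y'] by (auto simp: cell_def)
    then show ?thesis using f0[of p] f0[of q] by auto
  qed
  \<comment> \<open>Any preimage will do, since \<open>f\<close> agrees on all of them by
    \<open>inj\<close>.\<close>
  define g where "g = (\<lambda>z. f (SOME p. p \<in> cell \<and> ?t p = z))"
  have g: "g (?t p) = f p" if "p \<in> cell" for p
  proof -
    have "\<exists>q. q \<in> cell \<and> ?t q = ?t p" using that by blast
    from someI_ex[OF this] show ?thesis unfolding g_def using that by (intro inj) auto
  qed
  \<comment> \<open>Continuous images of compact sets are compact, so \<open>?t\<close> maps closed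
    subsets of the cell to closed sets; this makes preimages under \<open>g\<close> closed.\<close>
  have cg: "continuous_on (?t ` cell) g"
    unfolding continuous_on_closed_vimage[OF compact_imp_closed[OF compact_continuous_image[OF t compact_cell]]]
  proof (intro allI impI)
    fix B :: "real set" assume "closed B"
    have "g -` B \<inter> ?t ` cell = ?t ` (f -` B \<inter> cell)" using g by auto
    moreover have "closed (f -` B \<inter> cell)"
      using continuous_on_closed_vimage[OF compact_imp_closed[OF compact_cell]] f \<open>closed B\<close> by blast
    then have "compact (f -` B \<inter> cell)"
      using compact_cell by (metis Int_commute Int_lower1 compact_Int_closed inf.absorb_iff2 inf_le2)
    then have "compact (?t ` (f -` B \<inter> cell))"
      by (intro compact_continuous_image continuous_on_subset[OF t]) auto
    ultimately show "closed (g -` B \<inter> ?t ` cell)" by (simp add: compact_imp_closed)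
  qed
  then obtain h where h: "real_polynomial_function h" "\<And>z. z \<in> ?t ` cell \<Longrightarrow> \<bar>g z - h z\<bar> < e"
    using Stone_Weierstrass_real_polynomial_function[OF compact_continuous_image[OF t compact_cell] cg \<open>e > 0\<close>]
    by blast
  have "cmod (of_real (f p) - of_real (h (?t p))) < e" if "p \<in> cell" for p
    using h(2)[of "?t p"] g[OF that] that by (simp flip: of_real_diff)
  then show ?thesis using trig_poly_of_polynomial[OF h(1)] by blast
qed

definition trig_approximable :: "tfun \<Rightarrow> bool" where
  "trig_approximable f \<longleftrightarrow>
     (\<forall>e>0. \<exists>T. trig_poly T \<and> (LINT p|lebesgue_on cell. (cmod (of_real (f p) - T p))\<^sup>2) < e)"

text \<open>Periodicity is dropped because the indicators and truncations met in the induction over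
  measurable functions are not periodic.\<close>

definition square_integrable :: "tfun \<Rightarrow> bool" where
  "square_integrable f \<longleftrightarrow> f \<in> borel_measurable (lebesgue_on cell) \<and>
     integrable (lebesgue_on cell) (\<lambda>p. (f p)\<^sup>2)"

lemma borel_measurable_trig_poly: "trig_poly T \<Longrightarrow> T \<in> borel_measurable (lebesgue_on cell)"
  by (intro borel_measurable_integrable continuous_integrable_cell continuous_trig_poly)

lemma integrable_trig_poly_sq: "trig_poly T \<Longrightarrow> integrable (lebesgue_on cell) (\<lambda>p. (cmod (T p))\<^sup>2)"
  by (intro continuous_integrable_cell continuous_intros continuous_trig_poly)

lemma norm_add_sq_le: "(norm (a + b))\<^sup>2 \<le> 2 * (norm a)\<^sup>2 + 2 * (norm b)\<^sup>2"
  for a b :: "'a::real_normed_vector"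
proof -
  have "(norm (a + b))\<^sup>2 \<le> (norm a + norm b)\<^sup>2" by (intro power_mono norm_triangle_ineq) simp
  also have "\<dots> \<le> 2 * (norm a)\<^sup>2 + 2 * (norm b)\<^sup>2"
    using sum_squares_bound[of "norm a" "norm b"] by (simp add: power2_sum)
  finally show ?thesis .
qed

lemma integrable_approx_sq:
  assumes "square_integrable f" "trig_poly T"
  shows "integrable (lebesgue_on cell) (\<lambda>p. (cmod (of_real (f p) - T p))\<^sup>2)"
proof (rule Bochner_Integration.integrable_bound)
  show "integrable (lebesgue_on cell) (\<lambda>p. 2 * (f p)\<^sup>2 + 2 * (cmod (T p))\<^sup>2)"
    using assms integrable_trig_poly_sq by (simp add: square_integrable_def)
  have [measurable]: "f \<in> borel_measurable (lebesgue_on cell)" "T \<in> borel_measurable (lebesgue_on cell)"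
    using assms borel_measurable_trig_poly by (auto simp: square_integrable_def)
  show "(\<lambda>p. (cmod (of_real (f p) - T p))\<^sup>2) \<in> borel_measurable (lebesgue_on cell)" by measurable
  have "(cmod (of_real (f p) - T p))\<^sup>2 \<le> 2 * (f p)\<^sup>2 + 2 * (cmod (T p))\<^sup>2" for p
    using norm_add_sq_le[of "complex_of_real (f p)" "- T p"] by simp
  then show "AE p in lebesgue_on cell. norm ((cmod (of_real (f p) - T p))\<^sup>2) \<le> norm (2 * (f p)\<^sup>2 + 2 * (cmod (T p))\<^sup>2)"
    by (intro AE_I2) (smt (verit) real_norm_def zero_le_power2)
qed

lemma trig_approximable_add:
  assumes "square_integrable f" "square_integrable g" "trig_approximable f" "trig_approximable g"
  shows "trig_approximable (\<lambda>p. f p + g p)"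
  unfolding trig_approximable_def
proof (intro allI impI)
  fix e :: real assume "e > 0"
  then have "e / 4 > 0" by simp
  then obtain S T where ST: "trig_poly S" "(LINT p|lebesgue_on cell. (cmod (of_real (f p) - S p))\<^sup>2) < e / 4"
    "trig_poly T" "(LINT p|lebesgue_on cell. (cmod (of_real (g p) - T p))\<^sup>2) < e / 4"
    using assms(3,4) unfolding trig_approximable_def by meson
  note [simp] = integrable_approx_sq[OF assms(1) ST(1)] integrable_approx_sq[OF assms(2) ST(3)]
  have "(LINT p|lebesgue_on cell. (cmod (of_real (f p + g p) - (S p + T p)))\<^sup>2)
     \<le> (LINT p|lebesgue_on cell. 2 * (cmod (of_real (f p) - S p))\<^sup>2 + 2 * (cmod (of_real (g p) - T p))\<^sup>2)"
  proof (rule integral_mono_AE')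
    show "AE p in lebesgue_on cell. (cmod (of_real (f p + g p) - (S p + T p)))\<^sup>2
        \<le> 2 * (cmod (of_real (f p) - S p))\<^sup>2 + 2 * (cmod (of_real (g p) - T p))\<^sup>2"
    proof (rule AE_I2)
      fix p
      show "(cmod (of_real (f p + g p) - (S p + T p)))\<^sup>2
        \<le> 2 * (cmod (of_real (f p) - S p))\<^sup>2 + 2 * (cmod (of_real (g p) - T p))\<^sup>2"
        using norm_add_sq_le[of "of_real (f p) - S p" "of_real (g p) - T p"] by (simp add: algebra_simps)
    qed
  qed simp_all
  also have "\<dots> = 2 * (LINT p|lebesgue_on cell. (cmod (of_real (f p) - S p))\<^sup>2)
      + 2 * (LINT p|lebesgue_on cell. (cmod (of_real (g p) - T p))\<^sup>2)" by simp
  also have "\<dots> < e" using ST by simp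
  finally show "\<exists>T. trig_poly T \<and> (LINT p|lebesgue_on cell. (cmod (of_real (f p + g p) - T p))\<^sup>2) < e"
    using trig_poly.add[OF ST(1,3)] by blast
qed

lemma square_integrable_add:
  "\<lbrakk>square_integrable f; square_integrable g\<rbrakk> \<Longrightarrow> square_integrable (\<lambda>p. f p + g p)"
  using L2_product_integrable[of f "lebesgue_on cell" g]
  by (auto simp: square_integrable_def power2_sum mult.assoc)

lemma square_integrable_scale: "square_integrable f \<Longrightarrow> square_integrable (\<lambda>p. c * f p)"
  by (auto simp: square_integrable_def power_mult_distrib)

lemma trig_approximable_scale:
  assumes "trig_approximable f"
  shows "trig_approximable (\<lambda>p. c * f p)"
  unfolding trig_approximable_def
proof (intro allI impI)
  fix e :: real assume "e > 0"
  \<comment> \<open>Adding 1 to the square of c covers c = 0.\<close>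
  then have "e / (c\<^sup>2 + 1) > 0" by (simp add: add_nonneg_pos)
  then obtain T where T: "trig_poly T" "(LINT p|lebesgue_on cell. (cmod (of_real (f p) - T p))\<^sup>2) < e / (c\<^sup>2 + 1)"
    using assms unfolding trig_approximable_def by blast
  have "(cmod (of_real (c * f p) - of_real c * T p))\<^sup>2 = c\<^sup>2 * (cmod (of_real (f p) - T p))\<^sup>2" for p
    by (simp add: norm_mult power_mult_distrib flip: right_diff_distrib)
  then have "(LINT p|lebesgue_on cell. (cmod (of_real (c * f p) - of_real c * T p))\<^sup>2)
      = c\<^sup>2 * (LINT p|lebesgue_on cell. (cmod (of_real (f p) - T p))\<^sup>2)" by simp
  also have "\<dots> \<le> (c\<^sup>2 + 1) * (LINT p|lebesgue_on cell. (cmod (of_real (f p) - T p))\<^sup>2)"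
    by (intro mult_right_mono) auto
  also have "\<dots> < e" using T(2) by (simp add: pos_less_divide_eq add_nonneg_pos mult.commute)
  finally show "\<exists>T. trig_poly T \<and> (LINT p|lebesgue_on cell. (cmod (of_real (c * f p) - T p))\<^sup>2) < e"
    using trig_poly_scale[OF T(1), of "of_real c"] by blast
qed

text \<open>Reduces indicators to continuous functions, and monotone limits to their terms.\<close>

lemma trig_approximable_limit:
  assumes f: "square_integrable f"
    and ex: "\<And>e. e > 0 \<Longrightarrow> \<exists>g. square_integrable g \<and> trig_approximable g \<and>
      (LINT p|lebesgue_on cell. (f p - g p)\<^sup>2) < e"
  shows "trig_approximable f"
  unfolding trig_approximable_def
proof (intro allI impI)
  fix e :: real assume "e > 0"
  then have e: "e / 4 > 0" by simp
  from ex[OF e] obtain g where g: "square_integrable g" "trig_approximable g"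
      "(LINT p|lebesgue_on cell. (f p - g p)\<^sup>2) < e / 4" by blast
  with e obtain T where T: "trig_poly T" "(LINT p|lebesgue_on cell. (cmod (of_real (g p) - T p))\<^sup>2) < e / 4"
    unfolding trig_approximable_def by blast
  note [simp] = integrable_approx_sq[OF g(1) T(1)]
  have [simp]: "integrable (lebesgue_on cell) (\<lambda>p. (f p - g p)\<^sup>2)"
    using square_integrable_add[OF f square_integrable_scale[OF g(1), of "-1"]] by (simp add: square_integrable_def)
  have "(LINT p|lebesgue_on cell. (cmod (of_real (f p) - T p))\<^sup>2)
     \<le> (LINT p|lebesgue_on cell. 2 * (f p - g p)\<^sup>2 + 2 * (cmod (of_real (g p) - T p))\<^sup>2)"
  proof (rule integral_mono_AE')
    show "AE p in lebesgue_on cell. (cmod (of_real (f p) - T p))\<^sup>2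
        \<le> 2 * (f p - g p)\<^sup>2 + 2 * (cmod (of_real (g p) - T p))\<^sup>2"
    proof (rule AE_I2)
      fix p
      show "(cmod (of_real (f p) - T p))\<^sup>2 \<le> 2 * (f p - g p)\<^sup>2 + 2 * (cmod (of_real (g p) - T p))\<^sup>2"
        using norm_add_sq_le[of "complex_of_real (f p - g p)" "of_real (g p) - T p"]
        unfolding norm_of_real power2_abs by simp
    qed
  qed simp_all
  also have "\<dots> = 2 * (LINT p|lebesgue_on cell. (f p - g p)\<^sup>2)
      + 2 * (LINT p|lebesgue_on cell. (cmod (of_real (g p) - T p))\<^sup>2)" by simp
  also have "\<dots> < e" using g T by simp
  finally show "\<exists>T. trig_poly T \<and> (LINT p|lebesgue_on cell. (cmod (of_real (f p) - T p))\<^sup>2) < e"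
    using T(1) by blast
qed

lemma square_integrable_continuous: "continuous_on UNIV f \<Longrightarrow> square_integrable f"
  unfolding square_integrable_def
  by (auto intro!: borel_measurable_integrable continuous_integrable_cell continuous_intros)

lemma measure_cell: "measure (lebesgue_on cell) cell = (2*pi)\<^sup>2"
  by (simp add: measure_restrict_space) (simp add: cell_cbox content_Pair power2_eq_square)

lemma integral_cell_bound:
  fixes f :: "real \<times> real \<Rightarrow> real"
  assumes "\<And>p. p \<in> cell \<Longrightarrow> f p \<le> c" "0 \<le> c"
  shows "(LINT p|lebesgue_on cell. f p) \<le> c * (2*pi)\<^sup>2"
proof -
  interpret finite_measure "lebesgue_on cell" by (rule finite_measure_cell)
  have "(LINT p|lebesgue_on cell. f p) \<le> (LINT p|lebesgue_on cell. c)"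
    by (rule integral_mono_AE') (use assms in auto)
  also have "\<dots> = c * (2*pi)\<^sup>2" using measure_cell by simp
  finally show ?thesis .
qed

lemma trig_approximable_continuous:
  fixes f :: tfun
  assumes "continuous_on UNIV f" "\<And>p. p \<notin> {0<..<2*pi} \<times> {0<..<2*pi} \<Longrightarrow> f p = 0"
  shows "trig_approximable f"
  unfolding trig_approximable_def
proof (intro allI impI)
  fix e :: real assume "e > 0"
  \<comment> \<open>A uniform error d costs at most d^2 times the area of the cell, which is
    e/2.\<close>
  define d where "d = sqrt (e / (2 * (2*pi)\<^sup>2))"
  have d: "d > 0" using \<open>e > 0\<close> by (simp add: d_def)
  obtain T where T: "trig_poly T" "\<forall>p\<in>cell. cmod (of_real (f p) - T p) < d"
    using trig_poly_approx_continuous[OF continuous_on_subset[OF assms(1)] assms(2) d] by auto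
  have "(LINT p|lebesgue_on cell. (cmod (of_real (f p) - T p))\<^sup>2) \<le> d\<^sup>2 * (2*pi)\<^sup>2"
    using T(2) by (intro integral_cell_bound power_mono) (auto intro: less_imp_le)
  also have "\<dots> = e / 2" using \<open>e > 0\<close> by (simp add: d_def field_simps)
  also have "\<dots> < e" using \<open>e > 0\<close> by simp
  finally show "\<exists>T. trig_poly T \<and> (LINT p|lebesgue_on cell. (cmod (of_real (f p) - T p))\<^sup>2) < e"
    using T(1) by blast
qed

lemma integrable_indicator_cell:
  "A \<in> sets (lebesgue_on cell) \<Longrightarrow> integrable (lebesgue_on cell) (indicator A :: real \<times> real \<Rightarrow> real)"
  by (rule integrable_real_indicator)
    (simp_all add: finite_measure.emeasure_finite[OF finite_measure_cell] less_top[symmetric])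

lemma square_integrable_indicator:
  "A \<in> sets (lebesgue_on cell) \<Longrightarrow> square_integrable (indicator A)"
proof -
  have "(indicator A p :: real)\<^sup>2 = indicator A p" for p by (simp add: indicator_def)
  then show "A \<in> sets (lebesgue_on cell) \<Longrightarrow> ?thesis"
    by (simp add: square_integrable_def integrable_indicator_cell)
qed

lemma negligible_cell_boundary: "negligible (cell - {0<..<2*pi} \<times> {0<..<2*pi})"
proof -
  have "cell - {0<..<2*pi} \<times> {0<..<2*pi} = cbox (0, 0) (2*pi, 2*pi) - box (0, 0) (2*pi, 2*pi)"
    by (auto simp: cell_cbox box_def Basis_prod_def)
  then show ?thesis using negligible_frontier_interval by metis
qed

text \<open>Regularity of Lebesgue measure squeezes the set between a closed and an open one, and a
  Urysohn function interpolates. Working in the open square only discards the negligible boundary of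
  the cell.\<close>

lemma trig_approximable_indicator:
  assumes A: "A \<in> sets (lebesgue_on cell)"
  shows "trig_approximable (indicator A)"
proof (rule trig_approximable_limit[OF square_integrable_indicator[OF A]])
  fix e :: real assume "e > 0"
  let ?O = "{0<..<2*pi} \<times> {0<..<2*pi} :: (real \<times> real) set"
  have AL: "A \<in> sets lebesgue" and Ac: "A \<subseteq> cell"
    using A by (auto simp: sets_restrict_space)
  have OA: "A \<inter> ?O \<in> sets lebesgue" using AL by (auto simp: open_Times)
  from \<open>e > 0\<close> have e: "e / 2 > 0" by simp
  obtain K where K: "closed K" "K \<subseteq> A \<inter> ?O" "emeasure lebesgue (A \<inter> ?O - K) < ennreal (e / 2)"
    using sets_lebesgue_inner_closed[OF OA e] by metis
  obtain U where U: "open U" "A \<inter> ?O \<subseteq> U" "emeasure lebesgue (U - A \<inter> ?O) < ennreal (e / 2)"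
    using sets_lebesgue_outer_open[OF OA e] by metis
  \<comment> \<open>Cutting \<open>U\<close> down to the open square makes the Urysohn function
    vanish off that square, as \<open>trig_approximable_continuous\<close> demands.\<close>
  have "closed (- (U \<inter> ?O))" using U(1) by (intro closed_Compl) (simp add: open_Int open_Times)
  moreover have "K \<inter> - (U \<inter> ?O) = {}" using K U by blast
  ultimately obtain f :: "real \<times> real \<Rightarrow> real" where f: "continuous_on UNIV f" "\<And>x. f x \<in> closed_segment 1 0"
      "\<And>x. x \<in> K \<Longrightarrow> f x = 1" "\<And>x. x \<in> - (U \<inter> ?O) \<Longrightarrow> f x = 0"
    using Urysohn[OF K(1), where a = 1 and b = 0] by blast
  have bd: "0 \<le> f x \<and> f x \<le> 1" for x
    using f(2)[of x] by (auto simp: closed_segment_eq_real_ivl split: if_splits)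
  \<comment> \<open>Inside the open square, the indicator and \<open>f\<close> can differ only on
    \<open>D\<close>, and there by at most 1; the measure of \<open>D\<close> is below e.\<close>
  define D where "D = (U - A \<inter> ?O) \<union> (A \<inter> ?O - K)"
  have UK: "U \<in> sets lebesgue" "K \<in> sets lebesgue"
    using U(1) K(1) by (auto intro!: sets_completionI_sets)
  then have D: "D \<in> sets lebesgue" using OA unfolding D_def by blast
  have "emeasure lebesgue D \<le> emeasure lebesgue (U - A \<inter> ?O) + emeasure lebesgue (A \<inter> ?O - K)"
    using UK OA unfolding D_def by (intro emeasure_subadditive) blast+
  also have "\<dots> < ennreal (e / 2) + ennreal (e / 2)" using U K by (intro add_strict_mono) auto
  also have "\<dots> = ennreal e" using \<open>e > 0\<close> by (simp flip: ennreal_plus)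
  finally have eD: "emeasure lebesgue D < ennreal e" .
  have pt: "(indicator A p - f p)\<^sup>2 \<le> indicator (D \<inter> cell) p" if "p \<in> cell" "p \<notin> cell - ?O" for p
  proof (cases "p \<in> D")
    case True
    have "\<bar>indicator A p - f p\<bar> \<le> 1" using bd[of p] by (auto simp: indicator_def)
    then show ?thesis using True that by (simp add: abs_square_le_1)
  next
    case False
    then have "p \<in> K \<or> (p \<notin> A \<and> p \<notin> U)" using that K unfolding D_def by blast
    then show ?thesis using f(3,4)[of p] K that by (auto simp: indicator_def)
  qed
  have "cell - ?O \<in> null_sets lebesgue"
    using negligible_cell_boundary by (simp add: negligible_iff_null_sets)
  from AE_not_in[OF this] have "AE p in lebesgue. p \<notin> cell - ?O" .
  then have "AE p in lebesgue_on cell. (indicator A p - f p)\<^sup>2 \<le> indicator (D \<inter> cell) p"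
    by (simp add: AE_restrict_space_iff) (use pt in \<open>auto elim!: eventually_mono\<close>)
  then have "(LINT p|lebesgue_on cell. (indicator A p - f p)\<^sup>2) \<le> (LINT p|lebesgue_on cell. indicator (D \<inter> cell) p)"
    by (intro integral_mono_AE' integrable_indicator_cell)
      (use D in \<open>auto simp: sets_restrict_space\<close>)
  also have "\<dots> = measure lebesgue (D \<inter> cell)"
    using D by (simp add: measure_restrict_space Int_assoc)
  also have "\<dots> < e"
  proof -
    have "emeasure lebesgue (D \<inter> cell) \<le> emeasure lebesgue D" using D by (intro emeasure_mono) auto
    then have lt: "emeasure lebesgue (D \<inter> cell) < ennreal e" using eD by (rule le_less_trans)
    then have nt: "emeasure lebesgue (D \<inter> cell) \<noteq> top" by auto
    have "ennreal (measure lebesgue (D \<inter> cell)) < ennreal e"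
      using lt unfolding emeasure_eq_ennreal_measure[OF nt] .
    then show ?thesis by (simp add: ennreal_less_iff)
  qed
  finally have "(LINT p|lebesgue_on cell. (indicator A p - f p)\<^sup>2) < e" .
  moreover have "trig_approximable f"
    by (rule trig_approximable_continuous[OF f(1)]) (use f(4) in auto)
  ultimately show "\<exists>g. square_integrable g \<and> trig_approximable g \<and>
      (LINT p|lebesgue_on cell. (indicator A p - g p)\<^sup>2) < e"
    using square_integrable_continuous[OF f(1)] by blast
qed

lemma square_integrable_bound:
  assumes "square_integrable g" "f \<in> borel_measurable (lebesgue_on cell)" "\<And>p. p \<in> cell \<Longrightarrow> \<bar>f p\<bar> \<le> \<bar>g p\<bar>"
  shows "square_integrable f"
  unfolding square_integrable_def
proof
  show "integrable (lebesgue_on cell) (\<lambda>p. (f p)\<^sup>2)"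
    by (rule Bochner_Integration.integrable_bound[where f="\<lambda>p. (g p)\<^sup>2"])
      (use assms in \<open>auto simp: square_integrable_def abs_le_square_iff\<close>)
qed fact

lemma trig_approximable_nonneg:
  assumes "square_integrable f" "\<And>p. 0 \<le> f p"
  shows "trig_approximable f"
proof -
  have "f \<in> borel_measurable (lebesgue_on cell)" using assms by (simp add: square_integrable_def)
  \<comment> \<open>The induction ranges over all nonnegative measurable functions, so square
    integrability becomes a premise that each case hands down to its parts.\<close>
  then have "square_integrable f \<longrightarrow> trig_approximable f"
    using assms(2)
  proof (induction rule: borel_measurable_induct_real)
    case (set A)
    then show ?case by (simp add: trig_approximable_indicator)
  next
    case (mult u c)
    show ?case
    \<comment> \<open>For c = 0 the product says nothing about \<open>u\<close>; the zero function
      is treated as the indicator of the empty set.\<close>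
    proof (cases "c = 0")
      case True
      then show ?thesis using trig_approximable_indicator[of "{}"] by (simp add: indicator_def[abs_def])
    next
      case False
      then have "square_integrable (\<lambda>x. c * u x) \<Longrightarrow> square_integrable u"
        using square_integrable_scale[of "\<lambda>x. c * u x" "1 / c"] by simp
      then show ?thesis using mult trig_approximable_scale by blast
    qed
  next
    case (add u v)
    show ?case
    proof
      assume *: "square_integrable (\<lambda>x. v x + u x)"
      have "square_integrable u" "square_integrable v"
        by (rule square_integrable_bound[OF *]; use add in \<open>auto simp: add_nonneg_nonneg\<close>)+
      then show "trig_approximable (\<lambda>x. v x + u x)" using add trig_approximable_add by blast
    qed
  next
    case (seq U)
    show ?case
    proof
      assume f: "square_integrable f"
      have inc: "incseq U" and PU: "square_integrable (U i) \<longrightarrow> trig_approximable (U i)"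
        and nn: "0 \<le> U i p" and Um[measurable]: "U i \<in> borel_measurable (lebesgue_on cell)"
        and lim: "p \<in> space (lebesgue_on cell) \<Longrightarrow> (\<lambda>i. U i p) \<longlonglongrightarrow> f p" for i p
        by fact+
      have [measurable]: "f \<in> borel_measurable (lebesgue_on cell)" using f by (simp add: square_integrable_def)
      have le: "U i p \<le> f p" if "p \<in> cell" for i p
      proof (rule incseq_le)
        show "incseq (\<lambda>i. U i p)" by (rule incseq_SucI) (rule le_funD[OF incseq_SucD[OF inc]])
        show "(\<lambda>i. U i p) \<longlonglongrightarrow> f p" using lim that by simp
      qed
      have sU: "square_integrable (U i)" for i
      proof (rule square_integrable_bound[OF f Um])
        show "\<bar>U i p\<bar> \<le> \<bar>f p\<bar>" if "p \<in> cell" for p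
          using le[OF that, of i] nn[of i p] by simp
      qed
      have "(\<lambda>i. LINT p|lebesgue_on cell. (f p - U i p)\<^sup>2) \<longlonglongrightarrow> (LINT p|lebesgue_on cell. 0)"
      proof (rule integral_dominated_convergence)
        show "integrable (lebesgue_on cell) (\<lambda>p. (f p)\<^sup>2)" using f by (simp add: square_integrable_def)
        show "AE p in lebesgue_on cell. (\<lambda>i. (f p - U i p)\<^sup>2) \<longlonglongrightarrow> 0"
        proof (rule AE_I2)
          fix p assume "p \<in> space (lebesgue_on cell)"
          from tendsto_power[OF tendsto_diff[OF tendsto_const lim[OF this]], of "f p" 2]
          show "(\<lambda>i. (f p - U i p)\<^sup>2) \<longlonglongrightarrow> 0" by simp
        qed
        show "AE p in lebesgue_on cell. norm ((f p - U i p)\<^sup>2) \<le> (f p)\<^sup>2" for i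
          by (rule AE_I2) (use le nn in \<open>auto intro!: power_mono\<close>)
      qed simp_all
      then have lim0: "(\<lambda>i. LINT p|lebesgue_on cell. (f p - U i p)\<^sup>2) \<longlonglongrightarrow> 0" by simp
      show "trig_approximable f"
      proof (rule trig_approximable_limit[OF f])
        fix e :: real assume "e > 0"
        from order_tendstoD(2)[OF lim0 this] obtain i where "(LINT p|lebesgue_on cell. (f p - U i p)\<^sup>2) < e"
          by (auto simp: eventually_sequentially)
        then show "\<exists>g. square_integrable g \<and> trig_approximable g \<and> (LINT p|lebesgue_on cell. (f p - g p)\<^sup>2) < e"
          using sU PU by blast
      qed
    qed
  qed
  then show ?thesis using assms by blast
qed

lemma trig_approximable_square_integrable:
  assumes "square_integrable f"
  shows "trig_approximable f"
proof -
  have [measurable]: "f \<in> borel_measurable (lebesgue_on cell)" using assms by (simp add: square_integrable_def)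
  have *: "square_integrable (\<lambda>p. max 0 (f p))" "square_integrable (\<lambda>p. max 0 (- f p))"
    by (rule square_integrable_bound[OF assms]; simp)+
  have "trig_approximable (\<lambda>p. max 0 (f p) + (-1) * max 0 (- f p))"
    by (intro trig_approximable_add trig_approximable_scale square_integrable_scale *
        trig_approximable_nonneg) auto
  also have "(\<lambda>p. max 0 (f p) + (-1) * max 0 (- f p)) = f" by (auto simp: max_def)
  finally show ?thesis .
qed

section \<open>Parseval's identity\<close>

lemma has_sum_minus:
  fixes f g :: "'a \<Rightarrow> real"
  assumes "(f has_sum a) A" "(g has_sum b) A"
  shows "((\<lambda>x. f x - g x) has_sum (a - b)) A"
  using has_sum_add[OF assms(1) has_sum_uminusI[OF assms(2)]] by simp

lemma L2_torus_square_integrable: "u \<in> L2_torus \<Longrightarrow> square_integrable u"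
  by (simp add: square_integrable_def L2_torusD)

lemma L2_torus_integrable_mult:
  assumes "u \<in> L2_torus" "continuous_on UNIV g"
  shows "integrable (lebesgue_on cell) (\<lambda>p. complex_of_real (u p) * g p)"
proof (rule Bochner_Integration.integrable_bound)
  have [measurable]: "u \<in> borel_measurable (lebesgue_on cell)" "g \<in> borel_measurable (lebesgue_on cell)"
    using assms by (auto intro: L2_torusD borel_measurable_integrable continuous_integrable_cell)
  show "integrable (lebesgue_on cell) (\<lambda>p. (u p)\<^sup>2 + (cmod (g p))\<^sup>2)"
    using assms by (intro Bochner_Integration.integrable_add L2_torusD continuous_integrable_cell continuous_intros)
  show "(\<lambda>p. complex_of_real (u p) * g p) \<in> borel_measurable (lebesgue_on cell)" by measurable
  have "\<bar>u p\<bar> * cmod (g p) \<le> (u p)\<^sup>2 + (cmod (g p))\<^sup>2" for p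
    using sum_squares_bound[of "\<bar>u p\<bar>" "cmod (g p)"] zero_le_power2[of "u p"] zero_le_power2[of "cmod (g p)"]
    by (simp only: power2_abs)
  then show "AE p in lebesgue_on cell. norm (complex_of_real (u p) * g p) \<le> norm ((u p)\<^sup>2 + (cmod (g p))\<^sup>2)"
    by (simp add: norm_mult)
qed

lemma integral_mult_ch:
  "(LINT p|lebesgue_on cell. complex_of_real (u p) * ch (- \<xi>) p) = of_real ((2*pi)\<^sup>2) * fourier_coeff u \<xi>"
  by (simp add: fourier_coeff_ch)

lemma fourier_coeff_add:
  "\<lbrakk>u \<in> L2_torus; v \<in> L2_torus\<rbrakk> \<Longrightarrow>
     fourier_coeff (\<lambda>p. u p + v p) \<xi> = fourier_coeff u \<xi> + fourier_coeff v \<xi>"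
  by (simp add: fourier_coeff_ch distrib_right add_divide_distrib
      Bochner_Integration.integral_add[OF L2_torus_integrable_mult L2_torus_integrable_mult] continuous_ch)

lemma fourier_coeff_scale: "fourier_coeff (\<lambda>p. c * u p) \<xi> = of_real c * fourier_coeff u \<xi>"
  by (simp add: fourier_coeff_ch mult.assoc)

lemma fourier_coeff_diff:
  "\<lbrakk>u \<in> L2_torus; v \<in> L2_torus\<rbrakk> \<Longrightarrow>
     fourier_coeff (\<lambda>p. u p - v p) \<xi> = fourier_coeff u \<xi> - fourier_coeff v \<xi>"
  using fourier_coeff_add[of u "\<lambda>p. (-1) * v p" \<xi>] fourier_coeff_scale[of "-1" v \<xi>]
    L2_torus_scale[of v "-1"] by simp

text \<open>Completing the square in the coefficients. The choice \<open>d = fourier_coeff u\<close>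
  gives Bessel's inequality, and dropping the last term for arbitrary \<open>d\<close> shows that no
  other choice is closer.\<close>

lemma trig_distance:
  assumes u: "u \<in> L2_torus" and "finite F"
  shows "(LINT p|lebesgue_on cell. (cmod (of_real (u p) - (\<Sum>\<xi>\<in>F. d \<xi> * ch \<xi> p)))\<^sup>2)
    = L2_inner u u - (2*pi)\<^sup>2 * (\<Sum>\<xi>\<in>F. (cmod (fourier_coeff u \<xi>))\<^sup>2)
      + (2*pi)\<^sup>2 * (\<Sum>\<xi>\<in>F. (cmod (fourier_coeff u \<xi> - d \<xi>))\<^sup>2)"
proof -
  have Re_mult_real: "Re (of_real c * z) = c * Re z" for c z by simp
  define T where "T = (\<lambda>p. \<Sum>\<xi>\<in>F. d \<xi> * ch \<xi> p)"
  have cT: "continuous_on UNIV T" by (auto simp: T_def intro!: continuous_intros)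
  have ccT: "continuous_on UNIV (\<lambda>p. cnj (T p))" by (intro continuous_intros cT)
  have iuT: "integrable (lebesgue_on cell) (\<lambda>p. of_real (u p) * cnj (T p))"
    by (rule L2_torus_integrable_mult[OF u ccT])
  have iT: "integrable (lebesgue_on cell) (\<lambda>p. (cmod (T p))\<^sup>2)"
    by (intro continuous_integrable_cell continuous_intros cT)
  have "(cmod (of_real a - t))\<^sup>2 = a\<^sup>2 - 2 * Re (of_real a * cnj t) + (cmod t)\<^sup>2" for a t
    unfolding cmod_power2 by (simp add: power2_eq_square algebra_simps)
  then have "(LINT p|lebesgue_on cell. (cmod (of_real (u p) - T p))\<^sup>2)
     = (LINT p|lebesgue_on cell. (u p)\<^sup>2 - 2 * Re (of_real (u p) * cnj (T p)) + (cmod (T p))\<^sup>2)" by simp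
  also have "\<dots> = L2_inner u u - 2 * Re (LINT p|lebesgue_on cell. of_real (u p) * cnj (T p))
      + (LINT p|lebesgue_on cell. (cmod (T p))\<^sup>2)"
    using iuT iT L2_torusD(2)[OF u] integrable_Re[OF iuT] integral_Re[OF iuT]
    by (simp add: L2_inner_def power2_eq_square)
  also have "(LINT p|lebesgue_on cell. of_real (u p) * cnj (T p))
      = of_real ((2*pi)\<^sup>2) * (\<Sum>\<xi>\<in>F. cnj (d \<xi>) * fourier_coeff u \<xi>)"
  proof -
    have "(LINT p|lebesgue_on cell. of_real (u p) * cnj (T p))
       = (LINT p|lebesgue_on cell. (\<Sum>\<xi>\<in>F. cnj (d \<xi>) * (of_real (u p) * ch (- \<xi>) p)))"
      by (simp add: T_def cnj_ch sum_distrib_left mult_ac)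
    also have "\<dots> = (\<Sum>\<xi>\<in>F. cnj (d \<xi>) * (LINT p|lebesgue_on cell. of_real (u p) * ch (- \<xi>) p))"
      by (subst Bochner_Integration.integral_sum)
        (auto intro!: integrable_mult_right L2_torus_integrable_mult u continuous_ch)
    finally show ?thesis by (simp only: integral_mult_ch) (simp add: sum_distrib_left mult_ac)
  qed
  also have "(LINT p|lebesgue_on cell. (cmod (T p))\<^sup>2) = (2*pi)\<^sup>2 * (\<Sum>\<xi>\<in>F. (cmod (d \<xi>))\<^sup>2)"
  proof -
    have "complex_of_real (LINT p|lebesgue_on cell. (cmod (T p))\<^sup>2) = (LINT p|lebesgue_on cell. T p * cnj (T p))"
      by (simp only: complex_norm_square flip: integral_complex_of_real)
    also have "\<dots> = (LINT p|lebesgue_on cell. (\<Sum>\<xi>\<in>F. \<Sum>\<eta>\<in>F. d \<xi> * cnj (d \<eta>) * ch (\<xi> - \<eta>) p))"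
      using ch_add[of _ "- _"] by (simp add: T_def sum_product cnj_ch mult_ac)
    also have "\<dots> = (\<Sum>\<xi>\<in>F. \<Sum>\<eta>\<in>F. d \<xi> * cnj (d \<eta>) * (LINT p|lebesgue_on cell. ch (\<xi> - \<eta>) p))"
      by (simp add: continuous_integrable_cell[OF continuous_ch])
    also have "\<dots> = (\<Sum>\<xi>\<in>F. d \<xi> * cnj (d \<xi>) * of_real ((2*pi)\<^sup>2))"
      using \<open>finite F\<close> by (intro sum.cong refl) (simp add: integral_ch if_distrib sum.delta' cong: if_cong)
    also have "\<dots> = of_real ((2*pi)\<^sup>2 * (\<Sum>\<xi>\<in>F. (cmod (d \<xi>))\<^sup>2))"
      by (simp add: complex_norm_square sum_distrib_left mult_ac del: of_real_power)
    finally show ?thesis using of_real_eq_iff by blast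
  qed
  also have "L2_inner u u - 2 * Re (of_real ((2*pi)\<^sup>2) * (\<Sum>\<xi>\<in>F. cnj (d \<xi>) * fourier_coeff u \<xi>))
      + (2*pi)\<^sup>2 * (\<Sum>\<xi>\<in>F. (cmod (d \<xi>))\<^sup>2)
    = L2_inner u u + (2*pi)\<^sup>2 * (\<Sum>\<xi>\<in>F. (cmod (d \<xi>))\<^sup>2 - 2 * Re (cnj (d \<xi>) * fourier_coeff u \<xi>))"
    unfolding Re_mult_real Re_sum by (simp add: sum_subtractf sum_distrib_left algebra_simps)
  also have "(\<Sum>\<xi>\<in>F. (cmod (d \<xi>))\<^sup>2 - 2 * Re (cnj (d \<xi>) * fourier_coeff u \<xi>))
    = (\<Sum>\<xi>\<in>F. (cmod (fourier_coeff u \<xi> - d \<xi>))\<^sup>2 - (cmod (fourier_coeff u \<xi>))\<^sup>2)"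
    unfolding cmod_power2 by (intro sum.cong) (auto simp: power2_eq_square algebra_simps)
  finally show ?thesis by (simp add: T_def sum_subtractf algebra_simps)
qed

lemma trig_poly_sum: "finite F \<Longrightarrow> trig_poly (\<lambda>p. \<Sum>\<xi>\<in>F. d \<xi> * ch \<xi> p)"
  by (induction F rule: finite_induct) (auto intro: trig_poly_const trig_poly.intros)

text \<open>Bessel bounds the finite sums from above. Density yields a finite set whose sum is
  within e of the limit, and larger sets only increase it.\<close>

lemma Parseval:
  assumes u: "u \<in> L2_torus"
  shows "((\<lambda>\<xi>. (cmod (fourier_coeff u \<xi>))\<^sup>2) has_sum (L2_inner u u / (2*pi)\<^sup>2)) UNIV"
proof -
  let ?S = "\<lambda>F. \<Sum>\<xi>\<in>F. (cmod (fourier_coeff u \<xi>))\<^sup>2"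
  have bessel: "?S F \<le> L2_inner u u / (2*pi)\<^sup>2" if "finite F" for F
  proof -
    have "0 \<le> L2_inner u u - (2*pi)\<^sup>2 * ?S F"
      using trig_distance[OF u that, of "fourier_coeff u"]
      by (metis (no_types, lifting) Bochner_Integration.integral_nonneg add.right_neutral cancel_comm_monoid_add_class.diff_cancel mult_zero_right norm_zero power_zero_numeral sum.neutral zero_le_power2)
    then show ?thesis by (simp add: field_simps)
  qed
  have "\<exists>F. finite F \<and> L2_inner u u / (2*pi)\<^sup>2 - e < ?S F" if "e > 0" for e
  proof -
    have "e * (2*pi)\<^sup>2 > 0" using that by simp
    then obtain T where T: "trig_poly T" "(LINT p|lebesgue_on cell. (cmod (of_real (u p) - T p))\<^sup>2) < e * (2*pi)\<^sup>2"
      using trig_approximable_square_integrable[OF L2_torus_square_integrable[OF u]]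
      unfolding trig_approximable_def by blast
    obtain F d where F: "finite F" "T = (\<lambda>p. \<Sum>\<xi>\<in>F. d \<xi> * ch \<xi> p)"
      using trig_poly_sum_form[OF T(1)] by metis
    have "0 \<le> (2*pi)\<^sup>2 * (\<Sum>\<xi>\<in>F. (cmod (fourier_coeff u \<xi> - d \<xi>))\<^sup>2)"
      by (intro mult_nonneg_nonneg sum_nonneg) auto
    then have "L2_inner u u - (2*pi)\<^sup>2 * ?S F < e * (2*pi)\<^sup>2"
      using T(2) trig_distance[OF u F(1), of d] unfolding F(2) by linarith
    then have "L2_inner u u / (2*pi)\<^sup>2 - e < ?S F" by (simp add: field_simps)
    with F(1) show ?thesis by blast
  qed
  note approx = this
  show ?thesis unfolding has_sum_def
  proof (rule tendstoI)
    fix e :: real assume "e > 0"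
    then obtain F where F: "finite F" "L2_inner u u / (2*pi)\<^sup>2 - e < ?S F" using approx by blast
    have "dist (?S G) (L2_inner u u / (2*pi)\<^sup>2) < e" if "finite G" "F \<subseteq> G" for G
      using sum_mono2[OF that(1,2), of "\<lambda>\<xi>. (cmod (fourier_coeff u \<xi>))\<^sup>2"] bessel[OF that(1)] F(2)
      by (simp add: dist_real_def)
    then show "\<forall>\<^sub>F G in finite_subsets_at_top UNIV. dist (?S G) (L2_inner u u / (2*pi)\<^sup>2) < e"
      using F(1) by (auto simp: eventually_finite_subsets_at_top)
  qed
qed

text \<open>Polarisation of \<open>Parseval\<close>.\<close>

lemma Parseval_inner:
  assumes "u \<in> L2_torus" "v \<in> L2_torus"
  shows "((\<lambda>\<xi>. Re (fourier_coeff u \<xi> * cnj (fourier_coeff v \<xi>))) has_sum (L2_inner u v / (2*pi)\<^sup>2)) UNIV"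
proof -
  let ?p = "\<lambda>p. u p + v p" and ?m = "\<lambda>p. u p - v p"
  have "((\<lambda>\<xi>. 1/4 * ((cmod (fourier_coeff ?p \<xi>))\<^sup>2 - (cmod (fourier_coeff ?m \<xi>))\<^sup>2))
      has_sum (1/4 * (L2_inner ?p ?p / (2*pi)\<^sup>2 - (L2_inner ?m ?m / (2*pi)\<^sup>2)))) UNIV"
    using assms by (intro has_sum_cmult_right has_sum_minus Parseval L2_torus_add L2_torus_diff)
  moreover have "1/4 * ((cmod (fourier_coeff ?p \<xi>))\<^sup>2 - (cmod (fourier_coeff ?m \<xi>))\<^sup>2)
      = Re (fourier_coeff u \<xi> * cnj (fourier_coeff v \<xi>))" for \<xi>
    unfolding fourier_coeff_add[OF assms] fourier_coeff_diff[OF assms] cmod_power2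
    by (simp add: power2_eq_square algebra_simps)
  moreover have "1/4 * (L2_inner ?p ?p / (2*pi)\<^sup>2 - (L2_inner ?m ?m / (2*pi)\<^sup>2)) = L2_inner u v / (2*pi)\<^sup>2"
    using assms by (simp add: L2_inner_add L2_inner_add_right L2_inner_diff L2_inner_diff_right
        L2_torus_add L2_torus_diff L2_inner_commute[of v u] field_simps)
  ultimately show ?thesis by (simp only:)
qed

text \<open>The series converges uniformly to a continuous function, while its partial sums converge
  to \<open>v\<close> in mean square by Parseval; the two limits are at L2 distance zero.\<close>

lemma fourier_inversion:
  assumes v: "v \<in> L2_torus" and sm: "(\<lambda>\<xi>. cmod (fourier_coeff v \<xi>)) summable_on UNIV"
  shows "AE p in lebesgue_on cell. complex_of_real (v p) = (\<Sum>\<^sub>\<infinity>\<xi>. fourier_coeff v \<xi> * ch \<xi> p)"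
proof -
  define U where "U = (\<lambda>p. \<Sum>\<^sub>\<infinity>\<xi>. fourier_coeff v \<xi> * ch \<xi> p)"
  let ?S = "\<lambda>F p. \<Sum>\<xi>\<in>F. fourier_coeff v \<xi> * ch \<xi> p"
  have lim: "uniform_limit UNIV ?S U (finite_subsets_at_top UNIV)"
    unfolding U_def by (rule Weierstrass_m_test_general[OF _ sm]) (simp add: norm_mult)
  have cU: "continuous_on UNIV U"
    by (rule uniform_limit_theorem[OF _ lim]) (auto intro!: always_eventually continuous_intros)
  then have [measurable]: "U \<in> borel_measurable (lebesgue_on cell)" "v \<in> borel_measurable (lebesgue_on cell)"
    using v by (auto intro: borel_measurable_integrable continuous_integrable_cell L2_torusD)
  let ?I = "LINT p|lebesgue_on cell. (cmod (of_real (v p) - U p))\<^sup>2"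
  have iI: "integrable (lebesgue_on cell) (\<lambda>p. (cmod (of_real (v p) - U p))\<^sup>2)"
  proof (rule Bochner_Integration.integrable_bound)
    show "integrable (lebesgue_on cell) (\<lambda>p. 2 * (v p)\<^sup>2 + 2 * (cmod (U p))\<^sup>2)"
      using v cU by (intro Bochner_Integration.integrable_add integrable_mult_right L2_torusD
          continuous_integrable_cell continuous_intros)
    have "(cmod (of_real (v p) - U p))\<^sup>2 \<le> 2 * (v p)\<^sup>2 + 2 * (cmod (U p))\<^sup>2" for p
      using norm_add_sq_le[of "complex_of_real (v p)" "- U p"] by simp
    then show "AE p in lebesgue_on cell. norm ((cmod (of_real (v p) - U p))\<^sup>2) \<le> norm (2 * (v p)\<^sup>2 + 2 * (cmod (U p))\<^sup>2)"
      by simp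
  qed measurable
  have le: "?I \<le> e" if "e > 0" for e
  proof -
    \<comment> \<open>Each of the two squared distances below is at most d^2 times the area and
      enters with factor 2; the sum is then e.\<close>
    define d where "d = sqrt (e / (4 * (2*pi)\<^sup>2))"
    have d: "d > 0" "d\<^sup>2 = e / (4 * (2*pi)\<^sup>2)" using that by (simp_all add: d_def)
    have ev1: "\<forall>\<^sub>F F in finite_subsets_at_top UNIV. \<forall>p\<in>UNIV. dist (?S F p) (U p) < d"
      using uniform_limitD[OF lim d(1)] .
    have ev2: "\<forall>\<^sub>F F in finite_subsets_at_top UNIV.
        dist (\<Sum>\<xi>\<in>F. (cmod (fourier_coeff v \<xi>))\<^sup>2) (L2_inner v v / (2*pi)\<^sup>2) < d\<^sup>2"
      using Parseval[OF v] d(1) unfolding has_sum_def by (intro tendstoD) auto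
    have ev3: "\<forall>\<^sub>F F in finite_subsets_at_top (UNIV :: (int \<times> int) set). finite F"
      by (rule eventually_finite_subsets_at_top_weakI)
    obtain F where F: "finite F" "\<And>p. dist (?S F p) (U p) < d"
        "dist (\<Sum>\<xi>\<in>F. (cmod (fourier_coeff v \<xi>))\<^sup>2) (L2_inner v v / (2*pi)\<^sup>2) < d\<^sup>2"
      using eventually_happens'[OF finite_subsets_at_top_neq_bot eventually_conj[OF ev3 eventually_conj[OF ev1 ev2]]]
      by auto
    note i1 = integrable_approx_sq[OF L2_torus_square_integrable[OF v] trig_poly_sum[OF F(1), of "fourier_coeff v"]]
    have i2: "integrable (lebesgue_on cell) (\<lambda>p. (cmod (?S F p - U p))\<^sup>2)"
      using cU by (intro continuous_integrable_cell continuous_intros)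
    have "L2_inner v v / (2*pi)\<^sup>2 - (\<Sum>\<xi>\<in>F. (cmod (fourier_coeff v \<xi>))\<^sup>2) < d\<^sup>2"
      using F(3) by (simp add: dist_real_def)
    then have "(LINT p|lebesgue_on cell. (cmod (of_real (v p) - ?S F p))\<^sup>2) \<le> d\<^sup>2 * (2*pi)\<^sup>2"
      unfolding trig_distance[OF v F(1)] by (simp add: field_simps)
    moreover have "(LINT p|lebesgue_on cell. (cmod (?S F p - U p))\<^sup>2) \<le> d\<^sup>2 * (2*pi)\<^sup>2"
      using F(2) by (intro integral_cell_bound power_mono) (auto simp: dist_norm intro: less_imp_le)
    moreover have "?I \<le> (LINT p|lebesgue_on cell. 2 * (cmod (of_real (v p) - ?S F p))\<^sup>2 + 2 * (cmod (?S F p - U p))\<^sup>2)"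
    proof (rule integral_mono[OF iI])
      show "integrable (lebesgue_on cell) (\<lambda>p. 2 * (cmod (of_real (v p) - ?S F p))\<^sup>2 + 2 * (cmod (?S F p - U p))\<^sup>2)"
        using i1 i2 by simp
      show "(cmod (of_real (v p) - U p))\<^sup>2 \<le> 2 * (cmod (of_real (v p) - ?S F p))\<^sup>2 + 2 * (cmod (?S F p - U p))\<^sup>2" for p
        using norm_add_sq_le[of "of_real (v p) - ?S F p" "?S F p - U p"] by simp
    qed
    moreover have "\<dots> = 2 * (LINT p|lebesgue_on cell. (cmod (of_real (v p) - ?S F p))\<^sup>2)
        + 2 * (LINT p|lebesgue_on cell. (cmod (?S F p - U p))\<^sup>2)"
      using i1 i2 by simp
    ultimately have "?I \<le> 4 * (d\<^sup>2 * (2*pi)\<^sup>2)" by linarith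
    then show ?thesis using d by simp
  qed
  have "?I \<le> 0" by (rule field_le_epsilon) (use le in auto)
  moreover have "0 \<le> ?I" by simp
  ultimately have "?I = 0" by (rule antisym)
  then have "AE p in lebesgue_on cell. (cmod (of_real (v p) - U p))\<^sup>2 = 0"
    using integral_nonneg_eq_0_iff_AE[OF iI] by simp
  then show ?thesis by (simp add: U_def)
qed

section \<open>Regular representatives\<close>

text \<open>The square of the Japanese bracket, so that the weight of order s is its s-th
  power.\<close>

definition bracket :: "int \<times> int \<Rightarrow> real" where
  "bracket \<xi> = 1 + (of_int (fst \<xi>))\<^sup>2 + (of_int (snd \<xi>))\<^sup>2"

lemma bracket_ge_1: "1 \<le> bracket \<xi>"
  by (simp add: bracket_def)

lemma sobolev_weight_bracket: "sobolev_weight s u \<xi> = bracket \<xi> ^ s * (cmod (fourier_coeff u \<xi>))\<^sup>2"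
  by (simp add: sobolev_weight_def bracket_def case_prod_beta)

lemma summable_on_inverse_square_int: "(\<lambda>k::int. 1 / (1 + (real_of_int k)\<^sup>2)) summable_on UNIV"
proof -
  let ?f = "\<lambda>k::int. 1 / (1 + (real_of_int k)\<^sup>2)"
  have "summable (\<lambda>n::nat. 1 / (1 + (real n)\<^sup>2))"
  proof (rule summable_comparison_test_ev)
    show "summable (\<lambda>n::nat. inverse (real n ^ 2))" by (rule inverse_power_summable) simp
    show "\<forall>\<^sub>F n in sequentially. norm (1 / (1 + (real n)\<^sup>2)) \<le> inverse (real n ^ 2)"
      using eventually_gt_at_top[of 0] by eventually_elim (simp add: field_simps add_pos_nonneg)
  qed
  then have s: "(\<lambda>n::nat. 1 / (1 + (real n)\<^sup>2)) summable_on UNIV"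
    by (subst summable_on_UNIV_nonneg_real_iff) auto
  have "?f summable_on range int"
    using s by (subst summable_on_reindex) (auto simp: o_def inj_on_def)
  moreover have "?f summable_on range (\<lambda>n. - int n)"
    using s by (subst summable_on_reindex) (auto simp: o_def inj_on_def)
  ultimately have "?f summable_on (range int \<union> range (\<lambda>n. - int n))" by (rule summable_on_union)
  moreover have "range int \<union> range (\<lambda>n. - int n) = UNIV"
    by (auto intro: int_cases2)
  ultimately show ?thesis by simp
qed

text \<open>The bracket dominates both 1 + k^2 and 1 + l^2, so its square dominates their product
  and the double series splits into two single ones.\<close>

lemma summable_on_inverse_bracket: "(\<lambda>\<xi>. 1 / (bracket \<xi>)\<^sup>2) summable_on UNIV"
proof (rule summable_on_comparison_test)
  let ?g = "\<lambda>k::int. 1 / (1 + (real_of_int k)\<^sup>2)"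
  have "(\<lambda>(k, l). ?g k * ?g l) summable_on UNIV \<times> UNIV"
  proof (rule summable_on_SigmaI)
    show "((\<lambda>l. case (k, l) of (k, l) \<Rightarrow> ?g k * ?g l) has_sum (?g k * infsum ?g UNIV)) UNIV" for k
      using has_sum_cmult_right[OF has_sum_infsum[OF summable_on_inverse_square_int], of "?g k"] by simp
    show "(\<lambda>k. ?g k * infsum ?g UNIV) summable_on UNIV"
      by (rule summable_on_cmult_left) (rule summable_on_inverse_square_int)
  qed auto
  then show "(\<lambda>(k, l). ?g k * ?g l) summable_on UNIV" by simp
  show "1 / (bracket \<xi>)\<^sup>2 \<le> (case \<xi> of (k, l) \<Rightarrow> ?g k * ?g l)" for \<xi>
  proof (cases \<xi>)
    case (Pair k l)
    have "(1 + (real_of_int k)\<^sup>2) * (1 + (real_of_int l)\<^sup>2) \<le> (bracket \<xi>)\<^sup>2"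
      unfolding power2_eq_square[of "bracket \<xi>"] by (intro mult_mono) (auto simp: bracket_def Pair)
    then show ?thesis
      using Pair bracket_ge_1[of \<xi>] by (simp add: divide_simps add_pos_nonneg)
  qed
qed auto

text \<open>The inequality of arithmetic and geometric means for bracket^2 times the modulus, and
  1/bracket. The bound contains the square of the H^4 norm because it is the square that is
  integrable in time.\<close>

lemma bracket_mult_le:
  "bracket \<xi> * cmod (fourier_coeff u \<xi>) \<le> 1/2 * (sobolev_weight 4 u \<xi> + 1 / (bracket \<xi>)\<^sup>2)"
proof -
  let ?n = "cmod (fourier_coeff u \<xi>)" and ?x = "bracket \<xi>"
  have "0 \<le> (?x\<^sup>2 * ?n - 1 / ?x)\<^sup>2" by simp
  also have "\<dots> = ?x ^ 4 * ?n\<^sup>2 + 1 / ?x\<^sup>2 - 2 * (?x * ?n)"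
    using bracket_ge_1[of \<xi>] by (simp add: field_simps power2_eq_square power4_eq_xxxx)
  finally show ?thesis by (simp add: sobolev_weight_bracket)
qed

lemma abs_k_le_bracket: "\<bar>real_of_int (fst \<xi>)\<bar> \<le> bracket \<xi>"
proof -
  let ?k = "real_of_int (fst \<xi>)"
  have "2 * \<bar>?k\<bar> \<le> 1 + ?k\<^sup>2"
    using zero_le_power2[of "\<bar>?k\<bar> - 1"] by (simp add: power2_diff)
  then show ?thesis
    using zero_le_power2[of "real_of_int (snd \<xi>)"] zero_le_power2[of ?k] unfolding bracket_def by linarith
qed

definition sobolev_const :: real where
  "sobolev_const = (\<Sum>\<^sub>\<infinity>\<xi>. 1 / (bracket \<xi>)\<^sup>2)"

lemma H_norm_power2: "(H_norm s u)\<^sup>2 = (\<Sum>\<^sub>\<infinity>\<xi>. sobolev_weight s u \<xi>)"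
  unfolding H_norm_def
  by (intro real_sqrt_pow2 infsum_nonneg) (simp add: sobolev_weight_bracket bracket_def)

lemma H4_coeff_summable:
  assumes "u \<in> H_torus 4"
  shows "(\<lambda>\<xi>. bracket \<xi> * cmod (fourier_coeff u \<xi>)) summable_on UNIV"
    and "(\<Sum>\<^sub>\<infinity>\<xi>. bracket \<xi> * cmod (fourier_coeff u \<xi>)) \<le> 1/2 * ((H_norm 4 u)\<^sup>2 + sobolev_const)"
proof -
  have "sobolev_weight 4 u summable_on UNIV" using assms by (simp add: H_torus_def)
  then have s: "((\<lambda>\<xi>. 1/2 * (sobolev_weight 4 u \<xi> + 1 / (bracket \<xi>)\<^sup>2)) has_sum
      (1/2 * ((H_norm 4 u)\<^sup>2 + sobolev_const))) UNIV"
    unfolding H_norm_power2 sobolev_const_def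
    by (intro has_sum_cmult_right has_sum_add has_sum_infsum summable_on_inverse_bracket)
  show 1: "(\<lambda>\<xi>. bracket \<xi> * cmod (fourier_coeff u \<xi>)) summable_on UNIV"
    by (rule summable_on_comparison_test[OF has_sum_imp_summable[OF s] bracket_mult_le])
      (simp add: order_trans[OF zero_le_one bracket_ge_1])
  show "(\<Sum>\<^sub>\<infinity>\<xi>. bracket \<xi> * cmod (fourier_coeff u \<xi>)) \<le> 1/2 * ((H_norm 4 u)\<^sup>2 + sobolev_const)"
    by (rule has_sum_mono[OF has_sum_infsum[OF 1] s bracket_mult_le])
qed

section \<open>Absolutely convergent Fourier series and their x-derivatives\<close>

text \<open>Taking the real part gives a \<open>tfun\<close> without a symmetry condition on the
  coefficients. For summable coefficients of a real function nothing is lost, by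
  \<open>fourier_inversion\<close>.\<close>

definition fourier_series :: "(int \<times> int \<Rightarrow> complex) \<Rightarrow> tfun" where
  "fourier_series c p = Re (\<Sum>\<^sub>\<infinity>\<xi>. c \<xi> * ch \<xi> p)"

lemma fourier_series_uniform_limit:
  assumes "(\<lambda>\<xi>. cmod (c \<xi>)) summable_on UNIV"
  shows "uniform_limit UNIV (\<lambda>F p. Re (\<Sum>\<xi>\<in>F. c \<xi> * ch \<xi> p)) (fourier_series c) (finite_subsets_at_top UNIV)"
proof -
  have "uniform_limit UNIV (\<lambda>F p. \<Sum>\<xi>\<in>F. c \<xi> * ch \<xi> p) (\<lambda>p. \<Sum>\<^sub>\<infinity>\<xi>. c \<xi> * ch \<xi> p) (finite_subsets_at_top UNIV)"
    by (rule Weierstrass_m_test_general[OF _ assms]) (simp add: norm_mult)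
  from bounded_linear.uniform_limit[OF bounded_linear_Re this]
  show ?thesis by (simp add: fourier_series_def[abs_def])
qed

lemma continuous_fourier_series:
  assumes "(\<lambda>\<xi>. cmod (c \<xi>)) summable_on UNIV"
  shows "continuous_on UNIV (fourier_series c)"
  by (rule uniform_limit_theorem[OF _ fourier_series_uniform_limit[OF assms]])
    (auto intro!: always_eventually continuous_intros)

lemma ch_periodic: "ch \<xi> (x + 2*pi, y) = ch \<xi> (x, y)" "ch \<xi> (x, y + 2*pi) = ch \<xi> (x, y)"
proof -
  have *: "cis (of_int k * (2*pi)) = 1" for k
    by (metis cis_2pi cis_power_int mult.commute power_int_1_left)
  have "ch \<xi> (x + 2*pi, y) = ch \<xi> (x, y) * cis (of_int (fst \<xi>) * (2*pi))"
    by (simp add: ch_def cis_mult algebra_simps)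
  then show "ch \<xi> (x + 2*pi, y) = ch \<xi> (x, y)" by (simp add: *)
  have "ch \<xi> (x, y + 2*pi) = ch \<xi> (x, y) * cis (of_int (snd \<xi>) * (2*pi))"
    by (simp add: ch_def cis_mult algebra_simps)
  then show "ch \<xi> (x, y + 2*pi) = ch \<xi> (x, y)" by (simp add: *)
qed

lemma fourier_series_periodic:
  "fourier_series c (x + 2*pi, y) = fourier_series c (x, y)"
  "fourier_series c (x, y + 2*pi) = fourier_series c (x, y)"
  by (simp_all add: fourier_series_def ch_periodic)

text \<open>The differentiated partial sums converge uniformly, so their integrals converge and the
  fundamental theorem of calculus passes to the limit; the limit of integrals is then
  differentiated.\<close>

lemma fourier_series_deriv:
  assumes s: "(\<lambda>\<xi>. cmod (c \<xi>)) summable_on UNIV"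
    and s': "(\<lambda>\<xi>. cmod (sym_dx \<xi> * c \<xi>)) summable_on UNIV"
  shows "((\<lambda>s. fourier_series c (s, y)) has_real_derivative fourier_series (\<lambda>\<xi>. sym_dx \<xi> * c \<xi>) (x, y)) (at x)"
proof -
  let ?D = "fourier_series (\<lambda>\<xi>. sym_dx \<xi> * c \<xi>)"
  let ?S = "\<lambda>F s. Re (\<Sum>\<xi>\<in>F. c \<xi> * ch \<xi> (s, y))"
  let ?S' = "\<lambda>F s. Re (\<Sum>\<xi>\<in>F. (sym_dx \<xi> * c \<xi>) * ch \<xi> (s, y))"
  have dch: "((\<lambda>s. ch \<xi> (s, y)) has_vector_derivative (sym_dx \<xi> * ch \<xi> (s, y))) (at s within A)" for \<xi> s A
  proof -
    have "((\<lambda>z. exp (\<i> * (of_int (fst \<xi>) * z + of_real (of_int (snd \<xi>) * y)))) has_field_derivative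
        (\<i> * of_int (fst \<xi>)) * exp (\<i> * (of_int (fst \<xi>) * z + of_real (of_int (snd \<xi>) * y)))) (at z within B)" for z B
      by (auto intro!: derivative_eq_intros)
    from has_vector_derivative_real_field[OF this, of "of_real s"]
    show ?thesis by (simp add: ch_def cis_conv_exp sym_dx_def)
  qed
  have dS: "(?S F has_vector_derivative ?S' F s) (at s within A)" for F s A
  proof (rule bounded_linear.has_vector_derivative[OF bounded_linear_Re])
    have "((\<lambda>s. \<Sum>\<xi>\<in>F. c \<xi> * ch \<xi> (s, y)) has_vector_derivative (\<Sum>\<xi>\<in>F. c \<xi> * (sym_dx \<xi> * ch \<xi> (s, y)))) (at s within A)"
      by (intro has_vector_derivative_sum has_vector_derivative_mult_right dch)
    then show "((\<lambda>s. \<Sum>\<xi>\<in>F. c \<xi> * ch \<xi> (s, y)) has_vector_derivative (\<Sum>\<xi>\<in>F. (sym_dx \<xi> * c \<xi>) * ch \<xi> (s, y))) (at s within A)"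
      by (simp add: mult_ac)
  qed
  have cD: "continuous_on A (\<lambda>s. ?D (s, y))" for A
    by (rule continuous_on_compose2[OF continuous_fourier_series[OF s']]) (auto intro!: continuous_intros)
  have ftc: "fourier_series c (b, y) - fourier_series c (a, y) = integral {a..b} (\<lambda>s. ?D (s, y))" if "a \<le> b" for a b
  proof -
    have ul: "uniform_limit {a..b} ?S' (\<lambda>s. ?D (s, y)) (finite_subsets_at_top UNIV)"
      using uniform_limit_on_subset[OF fourier_series_uniform_limit[OF s'], of "(\<lambda>s. (s, y)) ` {a..b}"]
      by (simp add: uniform_limit_iff)
    have cS: "continuous_on {a..b} (?S' F)" for F
    proof -
      have "continuous_on {a..b} (\<lambda>s. ch \<xi> (s, y))" for \<xi>
        by (rule continuous_on_compose2[OF continuous_ch]) (auto intro!: continuous_intros)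
      then show ?thesis by (intro continuous_intros)
    qed
    obtain I J where I: "\<And>F. (?S' F has_integral I F) {a..b}"
        "((\<lambda>s. ?D (s, y)) has_integral J) {a..b}" "(I \<longlongrightarrow> J) (finite_subsets_at_top UNIV)"
      using uniform_limit_integral[OF ul cS finite_subsets_at_top_neq_bot] by blast
    have I_eq: "I = (\<lambda>F. ?S F b - ?S F a)"
      by (rule ext, rule has_integral_unique[OF I(1)]) (rule fundamental_theorem_of_calculus[OF that dS])
    have "((\<lambda>F. ?S F b - ?S F a) \<longlongrightarrow> J) (finite_subsets_at_top UNIV)"
      using I(3) unfolding I_eq .
    moreover have "((\<lambda>F. ?S F b - ?S F a) \<longlongrightarrow> fourier_series c (b, y) - fourier_series c (a, y)) (finite_subsets_at_top UNIV)"
      by (intro tendsto_diff tendsto_uniform_limitI[OF fourier_series_uniform_limit[OF s]]) auto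
    ultimately have "J = fourier_series c (b, y) - fourier_series c (a, y)"
      by (rule tendsto_unique[OF finite_subsets_at_top_neq_bot])
    then show ?thesis using I(2) by (simp add: integral_unique)
  qed
  \<comment> \<open>The interval only has to contain x in its interior, so that the derivative
    within it is the full derivative.\<close>
  have "((\<lambda>s. integral {x - 1..s} (\<lambda>s. ?D (s, y))) has_real_derivative ?D (x, y)) (at x within {x - 1..x + 1})"
    by (rule integral_has_real_derivative[OF cD]) simp
  then have "((\<lambda>s. fourier_series c (x - 1, y) + integral {x - 1..s} (\<lambda>s. ?D (s, y))) has_real_derivative ?D (x, y)) (at x within {x - 1..x + 1})"
    by (rule DERIV_cong[OF DERIV_add[OF DERIV_const]]) (rule add_0)
  then have "((\<lambda>s. fourier_series c (s, y)) has_real_derivative ?D (x, y)) (at x within {x - 1..x + 1})"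
    by (rule has_field_derivative_transform_within[of _ _ _ _ 1]) (auto simp flip: ftc)
  moreover have "at x within {x - 1..x + 1} = at x" by (rule at_within_interior) simp
  ultimately show ?thesis by simp
qed

lemma fourier_series_odd:
  assumes "\<And>k l. c (- k, l) = - c (k, l)"
  shows "fourier_series c (- x, y) = - fourier_series c (x, y)"
proof -
  have "(\<Sum>\<^sub>\<infinity>\<xi>. c \<xi> * ch \<xi> (- x, y)) = (\<Sum>\<^sub>\<infinity>\<xi>. - (c \<xi> * ch \<xi> (x, y)))"
  proof (rule infsum_reindex_bij_witness[of _ "\<lambda>(k, l). (- k, l)" "\<lambda>(k, l). (- k, l)"])
    show "- (c (case \<xi> of (k, l) \<Rightarrow> (- k, l)) * ch (case \<xi> of (k, l) \<Rightarrow> (- k, l)) (x, y)) = c \<xi> * ch \<xi> (- x, y)" for \<xi>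
      by (cases \<xi>) (simp add: assms ch_def)
  qed auto
  then show ?thesis by (simp add: fourier_series_def infsum_uminus)
qed

text \<open>Only the variable x is differentiated, since every integration by parts below is in x;
  the linear part is handled on the Fourier side.\<close>

definition xderiv :: "tfun \<Rightarrow> tfun \<Rightarrow> bool" where
  "xderiv U V \<longleftrightarrow> continuous_on UNIV U \<and> continuous_on UNIV V \<and>
     (\<forall>x y. U (x + 2*pi, y) = U (x, y)) \<and> (\<forall>x y. U (x, y + 2*pi) = U (x, y)) \<and>
     (\<forall>x y. V (x + 2*pi, y) = V (x, y)) \<and> (\<forall>x y. V (x, y + 2*pi) = V (x, y)) \<and>
     (\<forall>x y. ((\<lambda>s. U (s, y)) has_real_derivative V (x, y)) (at x))"

text \<open>The pointwise bound on the derivative feeds the Gronwall argument for the even part;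
  pointwise oddness gives the zero at x = 0 that the Hardy inequality requires.\<close>

lemma H4_representative:
  assumes u: "u \<in> H_torus 4" and v: "fourier_mult sym_dx u v"
  shows "\<exists>U V. xderiv U V \<and> (AE p in lebesgue_on cell. u p = U p) \<and> (AE p in lebesgue_on cell. v p = V p) \<and>
    (\<forall>p. \<bar>V p\<bar> \<le> 1/2 * ((H_norm 4 u)\<^sup>2 + sobolev_const)) \<and>
    ((\<forall>k l. fourier_coeff u (- k, l) = - fourier_coeff u (k, l)) \<longrightarrow> (\<forall>x y. U (- x, y) = - U (x, y)))"
proof (intro exI conjI allI impI)
  let ?c = "fourier_coeff u" and ?d = "\<lambda>\<xi>. sym_dx \<xi> * fourier_coeff u \<xi>"
  have uL: "u \<in> L2_torus" and vL: "v \<in> L2_torus" and vd: "fourier_coeff v = ?d"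
    using u v by (auto simp: H_torus_def fourier_mult_def)
  have le: "cmod (?d \<xi>) \<le> bracket \<xi> * cmod (?c \<xi>)" for \<xi>
    using abs_k_le_bracket[of \<xi>] by (simp add: sym_dx_def norm_mult mult_right_mono)
  have s: "(\<lambda>\<xi>. cmod (?c \<xi>)) summable_on UNIV"
    by (rule summable_on_comparison_test[OF H4_coeff_summable(1)[OF u]])
      (use mult_right_mono[OF bracket_ge_1] in auto)
  have s': "(\<lambda>\<xi>. cmod (?d \<xi>)) summable_on UNIV"
    by (rule summable_on_comparison_test[OF H4_coeff_summable(1)[OF u] le]) auto
  show "xderiv (fourier_series ?c) (fourier_series ?d)"
    unfolding xderiv_def
    by (intro conjI allI continuous_fourier_series s s' fourier_series_periodic fourier_series_deriv)
  have "AE p in lebesgue_on cell. complex_of_real (u p) = (\<Sum>\<^sub>\<infinity>\<xi>. ?c \<xi> * ch \<xi> p)"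
    by (rule fourier_inversion[OF uL s])
  then show "AE p in lebesgue_on cell. u p = fourier_series ?c p"
    by (rule eventually_mono) (metis fourier_series_def Re_complex_of_real)
  have "AE p in lebesgue_on cell. complex_of_real (v p) = (\<Sum>\<^sub>\<infinity>\<xi>. ?d \<xi> * ch \<xi> p)"
    using fourier_inversion[OF vL] s' unfolding vd by simp
  then show "AE p in lebesgue_on cell. v p = fourier_series ?d p"
    by (rule eventually_mono) (metis fourier_series_def Re_complex_of_real)
  show "\<bar>fourier_series ?d p\<bar> \<le> 1/2 * ((H_norm 4 u)\<^sup>2 + sobolev_const)" for p
  proof -
    have a: "(\<lambda>\<xi>. cmod (?d \<xi> * ch \<xi> p)) summable_on UNIV" using s' by (simp add: norm_mult)
    have "\<bar>fourier_series ?d p\<bar> \<le> cmod (\<Sum>\<^sub>\<infinity>\<xi>. ?d \<xi> * ch \<xi> p)"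
      unfolding fourier_series_def by (rule abs_Re_le_cmod)
    also have "\<dots> \<le> (\<Sum>\<^sub>\<infinity>\<xi>. cmod (?d \<xi> * ch \<xi> p))" by (rule norm_infsum_bound[OF a])
    also have "\<dots> \<le> (\<Sum>\<^sub>\<infinity>\<xi>. bracket \<xi> * cmod (?c \<xi>))"
      by (rule infsum_mono[OF a H4_coeff_summable(1)[OF u]]) (use le in \<open>simp add: norm_mult\<close>)
    also have "\<dots> \<le> 1/2 * ((H_norm 4 u)\<^sup>2 + sobolev_const)" by (rule H4_coeff_summable(2)[OF u])
    finally show ?thesis .
  qed
  show "fourier_series ?c (- x, y) = - fourier_series ?c (x, y)"
    if "\<forall>k l. ?c (- k, l) = - ?c (k, l)" for x y
    by (rule fourier_series_odd) (use that in blast)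
qed

text \<open>Every integration by parts below is an instance, with \<open>G\<close> the product being
  differentiated.\<close>

lemma integral_xderiv:
  fixes G V :: tfun
  assumes "continuous_on UNIV V" "\<And>x y. ((\<lambda>s. G (s, y)) has_real_derivative V (x, y)) (at x)"
    "\<And>y. G (2*pi, y) = G (0, y)"
  shows "(LINT p|lebesgue_on cell. V p) = 0"
proof -
  have "integral {0..2*pi} (\<lambda>x. V (x, y)) = 0" for y
  proof -
    have "((\<lambda>x. V (x, y)) has_integral G (2*pi, y) - G (0, y)) {0..2*pi}"
      by (rule fundamental_theorem_of_calculus)
        (auto simp: has_real_derivative_iff_has_vector_derivative[symmetric] intro: has_field_derivative_at_within assms(2))
    then show ?thesis using assms(3) by (simp add: integral_unique)
  qed
  then show ?thesis by (simp add: integral_cell_continuous(2)[OF assms(1)])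
qed

section \<open>Coercivity of the linear part\<close>

lemma xderivD:
  assumes "xderiv U V"
  shows "continuous_on A U" "continuous_on A V" "U (x + 2*pi, y) = U (x, y)" "V (x + 2*pi, y) = V (x, y)"
    "((\<lambda>s. U (s, y)) has_real_derivative V (x, y)) (at x)" "U \<in> L2_torus" "V \<in> L2_torus"
  using assms by (auto simp: xderiv_def intro: continuous_on_subset continuous_L2_torus)

text \<open>The Fourier symbol of the linear part of the equation; it is real because \<Lambda> and
  the squares of the derivatives have real symbols.\<close>

definition symbol :: "real \<Rightarrow> real \<Rightarrow> real \<Rightarrow> int \<times> int \<Rightarrow> real" where
  "symbol \<beta> \<delta> \<epsilon> \<xi> = (let k = real_of_int (fst \<xi>); l = real_of_int (snd \<xi>); r = sqrt (k\<^sup>2 + l\<^sup>2)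
     in - (\<beta> - 1) * k\<^sup>2 + l\<^sup>2 - \<delta> * r ^ 3 + \<epsilon> * r ^ 4)"

text \<open>This makes the linear part commute with reflection.\<close>

lemma symbol_even: "symbol \<beta> \<delta> \<epsilon> (- k, l) = symbol \<beta> \<delta> \<epsilon> (k, l)"
  by (simp add: symbol_def Let_def)

text \<open>The quartic term is split in halves: one absorbs the cubic term at the price of a
  quadratic one, the other absorbs all quadratic terms at the price of a constant. The k^2 that
  survives comes from -(\<beta> - 1) k^2.\<close>

lemma symbol_coercive:
  assumes "\<epsilon> > 0"
  shows "\<exists>C\<ge>0. \<forall>\<xi>. (real_of_int (fst \<xi>))\<^sup>2 - C \<le> symbol \<beta> \<delta> \<epsilon> \<xi>"
proof (intro exI conjI allI)
  \<comment> \<open>The total coefficient of r^2 to be absorbed: the price of the cubic term plus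
    the bound for \<beta> k^2.\<close>
  define B where "B = \<delta>\<^sup>2 / (2 * \<epsilon>) + \<bar>\<beta>\<bar>"
  show "0 \<le> B\<^sup>2 / (2 * \<epsilon>)" using assms by simp
  fix \<xi> :: "int \<times> int"
  define k l r where "k = real_of_int (fst \<xi>)" "l = real_of_int (snd \<xi>)" "r = sqrt (k\<^sup>2 + l\<^sup>2)"
  have r2: "r\<^sup>2 = k\<^sup>2 + l\<^sup>2" by (simp add: k_l_r_def)
  have q: "0 \<le> \<epsilon> / 2 * s\<^sup>2 - b * s + b\<^sup>2 / (2 * \<epsilon>)" for s b
  proof -
    have "0 \<le> (\<epsilon> * s - b)\<^sup>2" by simp
    also have "\<dots> = 2 * \<epsilon> * (\<epsilon> / 2 * s\<^sup>2 - b * s + b\<^sup>2 / (2 * \<epsilon>))"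
      using assms by (simp add: power2_eq_square algebra_simps)
    finally show ?thesis using assms by (simp add: zero_le_mult_iff)
  qed
  have "0 \<le> r\<^sup>2 * (\<epsilon> / 2 * r\<^sup>2 - \<delta> * r + \<delta>\<^sup>2 / (2 * \<epsilon>))" by (intro mult_nonneg_nonneg q) simp
  also have "\<dots> = \<epsilon> / 2 * r ^ 4 - \<delta> * r ^ 3 + \<delta>\<^sup>2 / (2 * \<epsilon>) * r\<^sup>2"
    by (simp add: distrib_left right_diff_distrib power2_eq_square power3_eq_cube power4_eq_xxxx mult_ac)
  finally have 1: "0 \<le> \<epsilon> / 2 * r ^ 4 - \<delta> * r ^ 3 + \<delta>\<^sup>2 / (2 * \<epsilon>) * r\<^sup>2" .
  have 2: "0 \<le> \<epsilon> / 2 * r ^ 4 - B * r\<^sup>2 + B\<^sup>2 / (2 * \<epsilon>)"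
    using q[of "r\<^sup>2" B] by simp
  have "\<beta> * k\<^sup>2 \<le> \<bar>\<beta>\<bar> * r\<^sup>2" by (intro mult_mono) (auto simp: r2)
  moreover have "B * r\<^sup>2 = \<delta>\<^sup>2 / (2 * \<epsilon>) * r\<^sup>2 + \<bar>\<beta>\<bar> * r\<^sup>2" by (simp add: B_def distrib_right)
  moreover have "symbol \<beta> \<delta> \<epsilon> \<xi> = k\<^sup>2 - \<beta> * k\<^sup>2 + l\<^sup>2 - \<delta> * r ^ 3 + \<epsilon> / 2 * r ^ 4 + \<epsilon> / 2 * r ^ 4"
    by (simp add: symbol_def Let_def k_l_r_def algebra_simps)
  ultimately have "k\<^sup>2 - B\<^sup>2 / (2 * \<epsilon>) \<le> symbol \<beta> \<delta> \<epsilon> \<xi>"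
    using 1 2 zero_le_power2[of l] by linarith
  then show "(real_of_int (fst \<xi>))\<^sup>2 - B\<^sup>2 / (2 * \<epsilon>) \<le> symbol \<beta> \<delta> \<epsilon> \<xi>" by (simp add: k_l_r_def)
qed

lemma Re_mult_cnj_self: "Re (of_real a * z * cnj z) = a * (cmod z)\<^sup>2"
  unfolding cmod_power2 by (simp add: power2_eq_square algebra_simps)

text \<open>Termwise comparison of Parseval series, where \<open>v\<close> contributes the weight
  k^2.\<close>

lemma energy_coercive:
  assumes u: "u \<in> L2_torus" and A: "fourier_mult (\<lambda>\<xi>. of_real (a \<xi>)) u Au" and v: "fourier_mult sym_dx u v"
    and C: "\<And>\<xi>. (real_of_int (fst \<xi>))\<^sup>2 - C \<le> a \<xi>"
  shows "L2_inner v v - C * L2_inner u u \<le> L2_inner Au u"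
proof -
  have AL: "Au \<in> L2_torus" "\<And>\<xi>. fourier_coeff Au \<xi> = of_real (a \<xi>) * fourier_coeff u \<xi>"
    and vL: "v \<in> L2_torus" "\<And>\<xi>. fourier_coeff v \<xi> = sym_dx \<xi> * fourier_coeff u \<xi>"
    using A v by (auto simp: fourier_mult_def)
  have "L2_inner v v / (2*pi)\<^sup>2 - C * (L2_inner u u / (2*pi)\<^sup>2) \<le> L2_inner Au u / (2*pi)\<^sup>2"
  proof (rule has_sum_mono[OF has_sum_minus[OF Parseval[OF vL(1)] has_sum_cmult_right[OF Parseval[OF u]]]
        Parseval_inner[OF AL(1) u]])
    fix \<xi>
    have "(cmod (fourier_coeff v \<xi>))\<^sup>2 = (real_of_int (fst \<xi>))\<^sup>2 * (cmod (fourier_coeff u \<xi>))\<^sup>2"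
      by (simp add: vL sym_dx_def norm_mult power_mult_distrib)
    then have "(cmod (fourier_coeff v \<xi>))\<^sup>2 - C * (cmod (fourier_coeff u \<xi>))\<^sup>2
        = ((real_of_int (fst \<xi>))\<^sup>2 - C) * (cmod (fourier_coeff u \<xi>))\<^sup>2"
      by (simp add: left_diff_distrib)
    also have "\<dots> \<le> a \<xi> * (cmod (fourier_coeff u \<xi>))\<^sup>2" by (intro mult_right_mono C) simp
    also have "\<dots> = Re (fourier_coeff Au \<xi> * cnj (fourier_coeff u \<xi>))"
      unfolding AL(2) by (rule Re_mult_cnj_self[symmetric])
    finally show "(cmod (fourier_coeff v \<xi>))\<^sup>2 - C * (cmod (fourier_coeff u \<xi>))\<^sup>2
      \<le> Re (fourier_coeff Au \<xi> * cnj (fourier_coeff u \<xi>))" .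
  qed
  then have "(L2_inner v v - C * L2_inner u u) / (2*pi)\<^sup>2 \<le> L2_inner Au u / (2*pi)\<^sup>2"
    by (simp only: diff_divide_distrib times_divide_eq_right)
  then show ?thesis unfolding divide_le_cancel by simp
qed

text \<open>Serves the even part, for which any growth bound is enough.\<close>

lemma energy_lower_bound:
  assumes u: "u \<in> L2_torus" and A: "fourier_mult (\<lambda>\<xi>. of_real (a \<xi>)) u Au" and C: "\<And>\<xi>. - C \<le> a \<xi>"
  shows "- C * L2_inner u u \<le> L2_inner Au u"
proof -
  have AL: "Au \<in> L2_torus" "\<And>\<xi>. fourier_coeff Au \<xi> = of_real (a \<xi>) * fourier_coeff u \<xi>"
    using A by (auto simp: fourier_mult_def)
  have "- C * (L2_inner u u / (2*pi)\<^sup>2) \<le> L2_inner Au u / (2*pi)\<^sup>2"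
  proof (rule has_sum_mono[OF has_sum_cmult_right[OF Parseval[OF u]] Parseval_inner[OF AL(1) u]])
    fix \<xi>
    have "- C * (cmod (fourier_coeff u \<xi>))\<^sup>2 \<le> a \<xi> * (cmod (fourier_coeff u \<xi>))\<^sup>2"
      by (intro mult_right_mono C) simp
    then show "- C * (cmod (fourier_coeff u \<xi>))\<^sup>2 \<le> Re (fourier_coeff Au \<xi> * cnj (fourier_coeff u \<xi>))"
      unfolding AL(2) Re_mult_cnj_self .
  qed
  then have "(- C * L2_inner u u) / (2*pi)\<^sup>2 \<le> L2_inner Au u / (2*pi)\<^sup>2"
    by (simp only: times_divide_eq_right)
  then show ?thesis unfolding divide_le_cancel by simp
qed


section \<open>Fejer kernels and a Hardy inequality with Fejer weight\<close>

text \<open>The cosine form instead of the quotient: the mean and the primitive of 1 - F can be read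
  off termwise. The quotient is recovered in \<open>fejer_identity\<close>.\<close>

definition fejer :: "nat \<Rightarrow> real \<Rightarrow> real" where
  "fejer N x = 1 + 2 * (\<Sum>n=1..N. (1 - real n / (real N + 1)) * cos (real n * x))"

lemma dirichlet_identity:
  "(1 + 2 * (\<Sum>n=1..N. cos (real n * x))) * (1 - cos x) = cos (real N * x) - cos ((real N + 1) * x)"
proof (induction N)
  case (Suc N)
  have "2 * cos ((real N + 1) * x) * cos x = cos ((real N + 2) * x) + cos (real N * x)"
    using cos_add[of "(real N + 1) * x" x] cos_diff[of "(real N + 1) * x" x] by (simp add: algebra_simps)
  then show ?case using Suc by (simp add: algebra_simps)
qed simp

text \<open>N + 1 times the kernel is the sum of the Dirichlet kernels of orders 0 to N, and
  \<open>dirichlet_identity\<close> telescopes.\<close>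

lemma fejer_identity:
  "(real N + 1) * fejer N x * (1 - cos x) = 1 - cos ((real N + 1) * x)"
proof -
  define G where "G N = real N + 1 + 2 * (\<Sum>n=1..N. (real N + 1 - real n) * cos (real n * x))" for N
  have G: "(real N + 1) * fejer N x = G N" for N
  proof -
    have "(real N + 1) * (1 - real n / (real N + 1)) = real N + 1 - real n" for n
      by (simp add: field_simps)
    then have "(real N + 1) * (\<Sum>n=1..N. (1 - real n / (real N + 1)) * cos (real n * x))
        = (\<Sum>n=1..N. (real N + 1 - real n) * cos (real n * x))"
      unfolding sum_distrib_left by (intro sum.cong refl) (simp only: mult.assoc[symmetric])
    moreover have "a * (1 + 2 * S) = a + 2 * (a * S)" for a S :: real by (simp add: algebra_simps)
    ultimately show ?thesis unfolding fejer_def G_def by (simp only:)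
  qed
  have step: "G (Suc N) = G N + (1 + 2 * (\<Sum>n=1..Suc N. cos (real n * x)))" for N
  proof -
    \<comment> \<open>The new index n = N + 1 has coefficient zero in the first sum on the right, so
      that sum may be extended for free.\<close>
    have "(\<Sum>n=1..Suc N. (real (Suc N) + 1 - real n) * cos (real n * x))
       = (\<Sum>n=1..Suc N. (real N + 1 - real n) * cos (real n * x)) + (\<Sum>n=1..Suc N. cos (real n * x))"
      by (simp only: sum.distrib[symmetric]) (intro sum.cong; simp add: algebra_simps)
    then show ?thesis by (simp add: G_def)
  qed
  have "G N * (1 - cos x) = 1 - cos ((real N + 1) * x)"
  proof (induction N)
    case 0
    then show ?case by (simp add: G_def)
  next
    case (Suc N)
    then show ?case using dirichlet_identity[of x "Suc N"]
      unfolding step distrib_right[of "G N"] by (simp add: add_ac)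
  qed
  then show ?thesis by (simp add: G)
qed

text \<open>Where cos x = 1 the closed form is void, but there all cosines are 1 and the
  coefficients are nonnegative.\<close>

lemma fejer_nonneg: "0 \<le> fejer N x"
proof (cases "cos x = 1")
  case True
  then have "sin x = 0" by (metis sin_cos_squared_add3 add_cancel_left_left cancel_comm_monoid_add_class.diff_cancel mult_eq_0_iff mult_1 add.commute add_diff_cancel_right')
  then have "cis x = 1" using True by (simp add: complex_eq_iff)
  then have "cis (real n * x) = 1" for n using Complex.DeMoivre[of x n] by simp
  then have "cos (real n * x) = 1" for n by (metis cis.sel(1) one_complex.sel(1))
  then show ?thesis by (auto simp: fejer_def intro!: add_nonneg_nonneg sum_nonneg)
next
  case False
  then have "0 < (real N + 1) * (1 - cos x)" using cos_le_one[of x] by (simp add: less_le)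
  moreover have "0 \<le> ((real N + 1) * (1 - cos x)) * fejer N x"
    using fejer_identity[of N x] by (simp add: mult_ac)
  ultimately show ?thesis by (simp add: zero_le_mult_iff)
qed

lemma continuous_fejer [continuous_intros]:
  fixes g :: "'a::t2_space \<Rightarrow> real"
  shows "continuous_on A g \<Longrightarrow> continuous_on A (\<lambda>p. fejer N (g p))"
  unfolding fejer_def by (auto intro!: continuous_intros)

text \<open>The quantitative form of concentration at multiples of 2 pi: away from them the kernel
  is O(1/N).\<close>

lemma fejer_weight: "fejer N x * (1 - cos x) \<le> 2 / (real N + 1)"
proof -
  have "(real N + 1) * (fejer N x * (1 - cos x)) \<le> 2"
    using fejer_identity[of N x] cos_ge_minus_one[of "(real N + 1) * x"] by (simp only: mult.assoc)
  then show ?thesis by (simp add: pos_le_divide_eq mult.commute)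
qed

lemma has_integral_cos: "n \<noteq> 0 \<Longrightarrow> ((\<lambda>x. cos (real n * x)) has_integral 0) {0..2*pi}"
proof -
  assume n: "n \<noteq> 0"
  have "((\<lambda>x. cos (real n * x)) has_integral sin (real n * (2*pi)) / real n - sin (real n * 0) / real n) {0..2*pi}"
    using n by (intro fundamental_theorem_of_calculus)
      (auto intro!: derivative_eq_intros simp flip: has_real_derivative_iff_has_vector_derivative)
  moreover have "sin (real n * (2*pi)) = 0"
    using sin_npi2[of "2 * n"] by (simp add: mult_ac)
  ultimately show ?thesis by simp
qed

lemma has_integral_fejer: "(fejer N has_integral 2*pi) {0..2*pi}"
proof -
  have "((\<lambda>x. 1 + 2 * (\<Sum>n=1..N. (1 - real n / (real N + 1)) * cos (real n * x))) has_integral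
      (2*pi) + 2 * (\<Sum>n=1..N. (1 - real n / (real N + 1)) * 0)) {0..2*pi}"
    using has_integral_const_real[of "1::real" 0 "2*pi"]
    by (intro has_integral_add has_integral_mult_right has_integral_sum has_integral_cos) auto
  then show ?thesis by (simp add: fejer_def[abs_def])
qed

text \<open>A crude Jordan inequality: use y cos y <= sin y at y = z/2 and the double angle
  formulas, with cos z >= 0.\<close>

lemma half_le_sin:
  assumes "0 \<le> z" "z \<le> pi / 2"
  shows "z / 2 \<le> sin z"
proof -
  have tan: "y * cos y \<le> sin y" if "0 \<le> y" "y \<le> pi" for y
  proof -
    have "(\<lambda>y. sin y - y * cos y) 0 \<le> (\<lambda>y. sin y - y * cos y) y"
    proof (rule DERIV_nonneg_imp_nondecreasing[OF that(1)])
      fix x assume "0 \<le> x" "x \<le> y"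
      have "((\<lambda>y. sin y - y * cos y) has_real_derivative x * sin x) (at x)"
        by (auto intro!: derivative_eq_intros)
      moreover have "0 \<le> x * sin x" using \<open>0 \<le> x\<close> \<open>x \<le> y\<close> that by (simp add: sin_ge_zero)
      ultimately show "\<exists>d. ((\<lambda>y. sin y - y * cos y) has_real_derivative d) (at x) \<and> 0 \<le> d" by blast
    qed
    then show ?thesis by simp
  qed
  have c: "0 \<le> cos (z / 2)" using assms by (intro cos_ge_zero) auto
  have "z / 2 \<le> z * (1 + cos z) / 2" using assms cos_ge_zero[of z] by (simp add: mult_left_mono divide_right_mono algebra_simps)
  also have "\<dots> = 2 * ((z / 2) * cos (z / 2)) * cos (z / 2)"
    using cos_double_cos[of "z / 2"] by (simp add: power2_eq_square)
  also have "\<dots> \<le> 2 * sin (z / 2) * cos (z / 2)"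
    using tan[of "z / 2"] assms c by (intro mult_right_mono mult_left_mono) auto
  also have "\<dots> = sin z" using sin_double[of "z / 2"] by simp
  finally show ?thesis .
qed

text \<open>The 8 comes from sin (x/2) >= x/4 in 1 - cos x = 2 sin^2 (x/2).\<close>

lemma square_le_cos:
  assumes "0 \<le> x" "x \<le> pi"
  shows "x\<^sup>2 \<le> 8 * (1 - cos x)"
proof -
  have "(x / 2 / 2)\<^sup>2 \<le> (sin (x / 2))\<^sup>2" using half_le_sin[of "x / 2"] assms by (intro power_mono) auto
  moreover have "1 - cos x = 2 * (sin (x / 2))\<^sup>2" using cos_double_sin[of "x / 2"] by simp
  ultimately show ?thesis by (simp add: power_divide)
qed

text \<open>Cauchy-Schwarz in the form that the mean square deviation of h' from its mean slope m is
  nonnegative.\<close>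

lemma increment_square_le:
  fixes h h' :: "real \<Rightarrow> real"
  assumes h: "\<And>x. (h has_real_derivative h' x) (at x)" and c: "continuous_on UNIV h'" and "a < b"
  shows "(h b - h a)\<^sup>2 \<le> (b - a) * integral {a..b} (\<lambda>x. (h' x)\<^sup>2)"
proof -
  define m where "m = (h b - h a) / (b - a)"
  have i1: "(h' has_integral (h b - h a)) {a..b}"
    using \<open>a < b\<close> h by (intro fundamental_theorem_of_calculus)
      (auto simp flip: has_real_derivative_iff_has_vector_derivative intro: has_field_derivative_at_within)
  have i2: "((\<lambda>x. (h' x)\<^sup>2) has_integral integral {a..b} (\<lambda>x. (h' x)\<^sup>2)) {a..b}"
    by (intro integrable_integral integrable_continuous_real continuous_intros continuous_on_subset[OF c]) simp
  have "((\<lambda>x. (h' x)\<^sup>2 - 2 * m * h' x + m\<^sup>2) has_integral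
      (integral {a..b} (\<lambda>x. (h' x)\<^sup>2) - 2 * m * (h b - h a) + (b - a) * m\<^sup>2)) {a..b}"
    using has_integral_const_real[of "m\<^sup>2" a b] \<open>a < b\<close>
    by (intro has_integral_add has_integral_diff has_integral_mult_right i1 i2) auto
  then have "0 \<le> integral {a..b} (\<lambda>x. (h' x)\<^sup>2) - 2 * m * (h b - h a) + (b - a) * m\<^sup>2"
  proof (rule has_integral_nonneg)
    show "0 \<le> (h' x)\<^sup>2 - 2 * m * h' x + m\<^sup>2" for x
      using zero_le_power2[of "h' x - m"] by (simp add: power2_diff mult_ac)
  qed
  moreover have d: "h b - h a = m * (b - a)" using \<open>a < b\<close> by (simp add: m_def)
  ultimately have "m\<^sup>2 * (b - a) \<le> integral {a..b} (\<lambda>x. (h' x)\<^sup>2)"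
    by (simp add: power2_eq_square algebra_simps)
  then have "(b - a) * (m\<^sup>2 * (b - a)) \<le> (b - a) * integral {a..b} (\<lambda>x. (h' x)\<^sup>2)"
    using \<open>a < b\<close> by (intro mult_left_mono) auto
  moreover have "(h b - h a)\<^sup>2 = (b - a) * (m\<^sup>2 * (b - a))" unfolding d by (simp add: power2_eq_square mult_ac)
  ultimately show ?thesis by simp
qed

text \<open>Since h vanishes at both ends, its square is at most E times the distance to the nearer
  end. That distance is split into a small constant \<theta>, which the kernel integrates to 2 pi
  \<theta>, and a multiple of 1 - cos x, which \<open>fejer_weight\<close> makes small for large
  N.\<close>

lemma fejer_hardy:
  fixes h h' :: "real \<Rightarrow> real"
  assumes h: "\<And>x. (h has_real_derivative h' x) (at x)" and c: "continuous_on UNIV h'"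
    and h0: "h 0 = 0" "h (2*pi) = 0" and \<theta>: "\<theta> > 0"
  shows "integral {0..2*pi} (\<lambda>x. fejer N x * (h x)\<^sup>2)
    \<le> (2*pi*\<theta> + 8*pi/(\<theta> * (real N + 1))) * integral {0..2*pi} (\<lambda>x. (h' x)\<^sup>2)"
proof -
  define E where "E = integral {0..2*pi} (\<lambda>x. (h' x)\<^sup>2)"
  have io: "(\<lambda>x. (h' x)\<^sup>2) integrable_on {a..b}" for a b
    by (intro integrable_continuous_real continuous_intros continuous_on_subset[OF c]) simp
  have sub: "integral {a..b} (\<lambda>x. (h' x)\<^sup>2) \<le> E" if "{a..b} \<subseteq> {0..2*pi}" for a b
    unfolding E_def using that by (intro integral_subset_le io) auto
  have E0: "0 \<le> E" unfolding E_def by (intro integral_nonneg io) auto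
  have ch: "continuous_on A h" for A
    using h by (intro continuous_at_imp_continuous_on) (auto intro: DERIV_isCont)
  \<comment> \<open>The kernel controls only the weight 1 - cos x, which is quadratic near 0; this
    trades the linear distance s for it, leaving \<theta>.\<close>
  have amgm: "s \<le> \<theta> + 2 * K / \<theta>" if "s\<^sup>2 \<le> 8 * K" for s K
  proof -
    have "0 \<le> (s / 2 - \<theta>)\<^sup>2" by simp
    then have "s * \<theta> \<le> \<theta>\<^sup>2 + 2 * K" using that by (simp add: power2_diff power_divide)
    then show ?thesis using \<theta> by (simp add: field_simps power2_eq_square)
  qed
  have pt: "(h x)\<^sup>2 \<le> E * (\<theta> + 2 * (1 - cos x) / \<theta>)" if x: "x \<in> {0..2*pi}" for x
  proof -
    have "(h x)\<^sup>2 \<le> E * x"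
    proof (cases "x = 0")
      case False
      with x have "(h x - h 0)\<^sup>2 \<le> (x - 0) * integral {0..x} (\<lambda>x. (h' x)\<^sup>2)" by (intro increment_square_le[OF h c]) auto
      also have "\<dots> \<le> (x - 0) * E" using x by (intro mult_left_mono sub) auto
      finally show ?thesis by (simp add: h0 mult.commute)
    qed (simp add: h0)
    moreover have "(h x)\<^sup>2 \<le> E * (2*pi - x)"
    proof (cases "x = 2*pi")
      case False
      with x have "(h (2*pi) - h x)\<^sup>2 \<le> (2*pi - x) * integral {x..2*pi} (\<lambda>x. (h' x)\<^sup>2)" by (intro increment_square_le[OF h c]) auto
      also have "\<dots> \<le> (2*pi - x) * E" using x by (intro mult_left_mono sub) auto
      finally have le: "(h (2*pi) - h x)\<^sup>2 \<le> (2*pi - x) * E" .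
      show ?thesis using le[unfolded h0] by (simp add: mult.commute[of E])
    qed (simp add: h0)
    moreover have "x \<le> \<theta> + 2 * (1 - cos x) / \<theta> \<or> 2*pi - x \<le> \<theta> + 2 * (1 - cos x) / \<theta>"
    proof (cases "x \<le> pi")
      case True
      then show ?thesis using amgm[OF square_le_cos[of x]] x True by auto
    next
      case False
      have "cos (2*pi - x) = cos x" by (simp add: cos_diff)
      then show ?thesis using amgm[OF square_le_cos[of "2*pi - x"]] x False by auto
    qed
    ultimately show ?thesis using E0 by (meson mult_left_mono order_trans)
  qed
  have "integral {0..2*pi} (\<lambda>x. fejer N x * (h x)\<^sup>2) \<le> integral {0..2*pi} (\<lambda>x. E * \<theta> * fejer N x + E * 4 / (\<theta> * (real N + 1)))"
  proof (rule integral_le)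
    fix x assume x: "x \<in> {0..2*pi}"
    have "fejer N x * (h x)\<^sup>2 \<le> fejer N x * (E * (\<theta> + 2 * (1 - cos x) / \<theta>))"
      by (intro mult_left_mono pt x fejer_nonneg)
    also have "\<dots> = E * \<theta> * fejer N x + E * 2 / \<theta> * (fejer N x * (1 - cos x))"
      by (simp add: field_simps)
    also have "\<dots> \<le> E * \<theta> * fejer N x + E * 2 / \<theta> * (2 / (real N + 1))"
      using E0 \<theta> by (intro add_left_mono mult_left_mono fejer_weight) auto
    finally show "fejer N x * (h x)\<^sup>2 \<le> E * \<theta> * fejer N x + E * 4 / (\<theta> * (real N + 1))" by (simp add: mult.commute[of E 4])
  qed (intro integrable_continuous_real continuous_intros ch)+
  also have "\<dots> = E * \<theta> * (2*pi) + 2*pi * (E * 4 / (\<theta> * (real N + 1)))"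
    using has_integral_const_real[of "E * 4 / (\<theta> * (real N + 1))" 0 "2*pi"]
    by (intro integral_unique has_integral_add has_integral_mult_right has_integral_fejer) auto
  also have "\<dots> = (2*pi*\<theta> + 8*pi/(\<theta> * (real N + 1))) * E" by (simp add: algebra_simps)
  finally show ?thesis by (simp add: E_def)
qed

lemma fejer_hardy_torus:
  assumes UV: "xderiv U V" and U0: "\<And>y. U (0, y) = 0" and \<theta>: "\<theta> > 0"
  shows "(LINT p|lebesgue_on cell. fejer N (fst p) * (U p)\<^sup>2)
    \<le> (2*pi*\<theta> + 8*pi/(\<theta> * (real N + 1))) * (LINT p|lebesgue_on cell. (V p)\<^sup>2)"
proof -
  let ?m = "2*pi*\<theta> + 8*pi/(\<theta> * (real N + 1))"
  let ?G = "\<lambda>p. ?m * (V p)\<^sup>2 - fejer N (fst p) * (U p)\<^sup>2"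
  note c = xderivD(1,2)[OF UV]
  have cG: "continuous_on UNIV ?G" by (intro continuous_intros c)
  have "0 \<le> integral {0..2*pi} (\<lambda>x. ?G (x, y))" for y
  proof -
    have cs: "continuous_on A (\<lambda>x. V (x, y))" "continuous_on A (\<lambda>x. U (x, y))" for A
      by (rule continuous_on_compose2[OF c(2)] continuous_on_compose2[OF c(1)]; auto intro!: continuous_intros)+
    have U1: "U (2*pi, y) = 0" using xderivD(3)[OF UV, of 0 y] U0 by simp
    have "integral {0..2*pi} (\<lambda>x. ?G (x, y)) = ?m * integral {0..2*pi} (\<lambda>x. (V (x, y))\<^sup>2) - integral {0..2*pi} (\<lambda>x. fejer N x * (U (x, y))\<^sup>2)"
      unfolding fst_conv
      by (subst Henstock_Kurzweil_Integration.integral_diff)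
        (auto intro!: integrable_continuous_real continuous_intros cs)
    with fejer_hardy[of "\<lambda>x. U (x, y)" "\<lambda>x. V (x, y)" \<theta> N, OF xderivD(5)[OF UV] cs(1) U0 U1 \<theta>]
    show ?thesis by simp
  qed
  \<comment> \<open>If the inner integral were not integrable in y, the outer one would be 0 by
    convention, so the sign is right in either case.\<close>
  then have "0 \<le> (LINT p|lebesgue_on cell. ?G p)"
    unfolding integral_cell_continuous(2)[OF cG]
    by (metis (no_types, lifting) Henstock_Kurzweil_Integration.integral_nonneg not_integrable_integral order_refl)
  also have "\<dots> = ?m * (LINT p|lebesgue_on cell. (V p)\<^sup>2) - (LINT p|lebesgue_on cell. fejer N (fst p) * (U p)\<^sup>2)"
    by (subst Bochner_Integration.integral_diff)
      (auto intro!: continuous_integrable_cell continuous_intros c)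
  finally show ?thesis by simp
qed

section \<open>Estimates at a fixed time\<close>

text \<open>Collects the linear terms into one real multiplier, so that the equation reads w + u u_x
  + A u = 0 from here on.\<close>

lemma fourier_mult_symbol:
  assumes u: "u \<in> L2_torus"
    and "fourier_mult (\<lambda>\<xi>. sym_dx \<xi> ^ 2) u uxx" "fourier_mult (\<lambda>\<xi>. sym_dy \<xi> ^ 2) u uyy"
    and "fourier_mult (\<lambda>\<xi>. sym_Lambda \<xi> ^ 3) u L3"
    and "fourier_mult (\<lambda>\<xi>. (sym_dx \<xi> ^ 2 + sym_dy \<xi> ^ 2) ^ 2) u D2"
  shows "fourier_mult (\<lambda>\<xi>. of_real (symbol \<beta> \<delta> \<epsilon> \<xi>)) u
    (\<lambda>p. (\<beta> - 1) * uxx p - uyy p - \<delta> * L3 p + \<epsilon> * D2 p)"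
proof -
  have L: "uxx \<in> L2_torus" "uyy \<in> L2_torus" "L3 \<in> L2_torus" "D2 \<in> L2_torus"
    and c: "fourier_coeff uxx \<xi> = sym_dx \<xi> ^ 2 * fourier_coeff u \<xi>"
      "fourier_coeff uyy \<xi> = sym_dy \<xi> ^ 2 * fourier_coeff u \<xi>"
      "fourier_coeff L3 \<xi> = sym_Lambda \<xi> ^ 3 * fourier_coeff u \<xi>"
      "fourier_coeff D2 \<xi> = (sym_dx \<xi> ^ 2 + sym_dy \<xi> ^ 2) ^ 2 * fourier_coeff u \<xi>" for \<xi>
    using assms unfolding fourier_mult_def by blast+
  note LL = L L2_torus_scale L2_torus_diff L2_torus_add
  have "fourier_coeff (\<lambda>p. (\<beta> - 1) * uxx p - uyy p - \<delta> * L3 p + \<epsilon> * D2 p) \<xi>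
     = of_real (symbol \<beta> \<delta> \<epsilon> \<xi>) * fourier_coeff u \<xi>" for \<xi>
  proof -
    define k l where "k = real_of_int (fst \<xi>)" "l = real_of_int (snd \<xi>)"
    have r4: "sqrt (k\<^sup>2 + l\<^sup>2) ^ 4 = (k\<^sup>2 + l\<^sup>2)\<^sup>2"
      using power_mult[of "sqrt (k\<^sup>2 + l\<^sup>2)" 2 2] by simp
    have s: "sym_dx \<xi> ^ 2 = of_real (- k\<^sup>2)" "sym_dy \<xi> ^ 2 = of_real (- l\<^sup>2)"
      "sym_Lambda \<xi> ^ 3 = of_real (sqrt (k\<^sup>2 + l\<^sup>2) ^ 3)"
      by (simp_all add: sym_dx_def sym_dy_def sym_Lambda_def k_l_def power_mult_distrib)
    have "fourier_coeff (\<lambda>p. (\<beta> - 1) * uxx p - uyy p - \<delta> * L3 p + \<epsilon> * D2 p) \<xi>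
       = of_real ((\<beta> - 1) * (- k\<^sup>2) - (- l\<^sup>2) - \<delta> * sqrt (k\<^sup>2 + l\<^sup>2) ^ 3 + \<epsilon> * (- k\<^sup>2 + - l\<^sup>2)\<^sup>2) * fourier_coeff u \<xi>"
      by (simp only: fourier_coeff_add fourier_coeff_diff fourier_coeff_scale LL c s
          of_real_add[symmetric] of_real_power[symmetric])
        (simp add: algebra_simps)
    also have "(\<beta> - 1) * (- k\<^sup>2) - (- l\<^sup>2) - \<delta> * sqrt (k\<^sup>2 + l\<^sup>2) ^ 3 + \<epsilon> * (- k\<^sup>2 + - l\<^sup>2)\<^sup>2 = symbol \<beta> \<delta> \<epsilon> \<xi>"
    proof -
      have X: "(- k\<^sup>2 + - l\<^sup>2)\<^sup>2 = (k\<^sup>2 + l\<^sup>2)\<^sup>2" by (simp add: power2_eq_square algebra_simps)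
      show ?thesis unfolding X by (simp add: symbol_def Let_def r4 left_diff_distrib flip: k_l_def)
    qed
    finally show ?thesis .
  qed
  then show ?thesis using LL by (simp add: fourier_mult_def)
qed

lemma continuous_borel_cell:
  fixes f :: "real \<times> real \<Rightarrow> 'b::euclidean_space"
  shows "continuous_on UNIV f \<Longrightarrow> f \<in> borel_measurable (lebesgue_on cell)"
  by (intro borel_measurable_integrable continuous_integrable_cell)

text \<open>The triple product is moved to continuous representatives, since a product of three L2
  functions need not be integrable.\<close>

lemma nonlinear_pairing:
  assumes L: "w \<in> L2_torus" "Au \<in> L2_torus" "\<psi> \<in> L2_torus"
    and eq: "AE p in lebesgue_on cell. w p + u p * v p + Au p = 0"
    and AE: "AE p in lebesgue_on cell. u p = U p" "AE p in lebesgue_on cell. v p = V p"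
      "AE p in lebesgue_on cell. \<psi> p = \<Psi> p"
    and c: "continuous_on UNIV U" "continuous_on UNIV V" "continuous_on UNIV \<Psi>"
  shows "L2_inner w \<psi> = - (LINT p|lebesgue_on cell. U p * V p * \<Psi> p) - L2_inner Au \<psi>"
proof -
  have "L2_inner w \<psi> + L2_inner Au \<psi> = L2_inner (\<lambda>p. w p + Au p) \<psi>" by (simp add: L2_inner_add L)
  also have "\<dots> = (LINT p|lebesgue_on cell. - (U p * V p * \<Psi> p))"
    unfolding L2_inner_def
  proof (rule integral_cong_AE)
    show "AE p in lebesgue_on cell. (w p + Au p) * \<psi> p = - (U p * V p * \<Psi> p)"
      using eq AE
    proof eventually_elim
      case (elim p)
      then have "w p + Au p = - (U p * V p)" by simp
      then show ?case using elim by simp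
    qed
    show "(\<lambda>p. (w p + Au p) * \<psi> p) \<in> borel_measurable (lebesgue_on cell)"
      using L2_torus_prod[OF L2_torus_add[OF L(1,2)] L(3)] by (rule borel_measurable_integrable)
    show "(\<lambda>p. - (U p * V p * \<Psi> p)) \<in> borel_measurable (lebesgue_on cell)"
      by (intro continuous_borel_cell continuous_intros c)
  qed
  finally show ?thesis by simp
qed

lemma L2_inner_AE_continuous:
  assumes "u \<in> L2_torus" "AE p in lebesgue_on cell. u p = U p" "continuous_on UNIV U"
  shows "L2_inner u u = (LINT p|lebesgue_on cell. (U p)\<^sup>2)"
  unfolding L2_inner_def
proof (rule integral_cong_AE)
  show "AE p in lebesgue_on cell. u p * u p = (U p)\<^sup>2"
    using assms(2) by eventually_elim (simp add: power2_eq_square)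
  show "(\<lambda>p. u p * u p) \<in> borel_measurable (lebesgue_on cell)"
    using L2_torus_prod[OF assms(1,1)] by (rule borel_measurable_integrable)
  show "(\<lambda>p. (U p)\<^sup>2) \<in> borel_measurable (lebesgue_on cell)"
    by (intro continuous_borel_cell continuous_intros assms)
qed

lemma integral_cubic:
  assumes "xderiv U V"
  shows "(LINT p|lebesgue_on cell. U p * V p * U p) = 0"
proof (rule integral_xderiv[where G = "\<lambda>p. (U p) ^ 3 / 3"])
  show "continuous_on UNIV (\<lambda>p. U p * V p * U p)" by (intro continuous_intros xderivD[OF assms])
  show "((\<lambda>s. (U (s, y)) ^ 3 / 3) has_real_derivative U (x, y) * V (x, y) * U (x, y)) (at x)" for x y
    by (rule DERIV_cong[OF DERIV_cdivide[OF DERIV_power[OF xderivD(5)[OF assms]]]])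
      (simp add: power2_eq_square)
  show "(U (2*pi, y)) ^ 3 / 3 = (U (0, y)) ^ 3 / 3" for y
    using xderivD(3)[OF assms, of 0 y] by simp
qed

lemma integral_by_parts_background:
  assumes UV: "xderiv U V" and g: "\<And>x. (g has_real_derivative g' x) (at x)" "continuous_on UNIV g'"
    and per: "g (2*pi) = g 0"
  shows "(LINT p|lebesgue_on cell. U p * V p * g (fst p)) = - 1/2 * (LINT p|lebesgue_on cell. (U p)\<^sup>2 * g' (fst p))"
proof -
  have "continuous_on UNIV g"
    using g(1) by (meson DERIV_isCont continuous_at_imp_continuous_on)
  then have cg: "continuous_on A (\<lambda>p. g (fst p))" "continuous_on A (\<lambda>p. g' (fst p))" for A :: "(real \<times> real) set"
    using g(2) by (auto intro: continuous_on_compose2[OF _ continuous_on_fst[OF continuous_on_id]])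
  note c = xderivD(1,2)[OF UV] cg
  have "(LINT p|lebesgue_on cell. U p * V p * g (fst p) + 1/2 * ((U p)\<^sup>2 * g' (fst p))) = 0"
  proof (rule integral_xderiv[where G = "\<lambda>p. 1/2 * ((U p)\<^sup>2 * g (fst p))"])
    show "((\<lambda>s. 1/2 * ((U (s, y))\<^sup>2 * g (fst (s, y)))) has_real_derivative
        U (x, y) * V (x, y) * g (fst (x, y)) + 1/2 * ((U (x, y))\<^sup>2 * g' (fst (x, y)))) (at x)" for x y
      by (auto intro!: derivative_eq_intros xderivD(5)[OF UV] g(1) simp: field_simps power2_eq_square)
    show "1/2 * ((U (2*pi, y))\<^sup>2 * g (fst (2*pi, y))) = 1/2 * ((U (0, y))\<^sup>2 * g (fst (0, y)))" for y
      using xderivD(3)[OF UV, of 0 y] per by simp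
  qed (intro continuous_intros c)
  then show ?thesis
    by (subst (asm) Bochner_Integration.integral_add)
      (auto intro!: continuous_integrable_cell continuous_intros c)
qed

text \<open>\<open>fourier_coeff\<close> integrates against the conjugate character, so frequency -n
  is the one that produces +sin (n x).\<close>

lemma L2_inner_sin:
  assumes "f \<in> L2_torus"
  shows "L2_inner f (\<lambda>p. sin (real n * fst p)) = (2*pi)\<^sup>2 * Im (fourier_coeff f (- int n, 0))"
proof -
  have i: "integrable (lebesgue_on cell) (\<lambda>p. complex_of_real (f p) * ch (- (- int n, 0)) p)"
    by (rule L2_torus_integrable_mult[OF assms continuous_ch])
  have "L2_inner f (\<lambda>p. sin (real n * fst p)) = (LINT p|lebesgue_on cell. Im (complex_of_real (f p) * ch (- (- int n, 0)) p))"
    by (simp add: L2_inner_def ch_def)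
  also have "\<dots> = Im (of_real ((2*pi)\<^sup>2) * fourier_coeff f (- int n, 0))"
    unfolding integral_Im[OF i] integral_mult_ch ..
  finally show ?thesis by (simp del: of_real_power)
qed

lemma sin_L2_torus: "(\<lambda>p. sin (real n * fst p)) \<in> L2_torus"
proof (rule continuous_L2_torus)
  have "sin (real n * (x + 2 * pi)) = sin (real n * x)" for x
  proof -
    have "sin (real n * 2 * pi) = 0" "cos (real n * 2 * pi) = 1"
      using sin_npi2[of "2 * n"] cos_npi[of "2 * n"] by (simp_all add: mult_ac)
    then show ?thesis by (simp add: distrib_left sin_add mult.assoc[symmetric])
  qed
  then show "sin (real n * fst (x + 2 * pi, y)) = sin (real n * fst (x, y))" for x y :: real by simp
qed (auto intro!: continuous_intros)

text \<open>Symmetry of a real multiplier against a sine sum. It puts all derivatives on the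
  profile, leaving only the L2 norm of u to be controlled.\<close>

lemma L2_inner_multiplier_sin:
  assumes u: "u \<in> L2_torus" and A: "fourier_mult (\<lambda>\<xi>. of_real (a \<xi>)) u Au"
  shows "L2_inner Au (\<lambda>p. \<Sum>n=1..N. d n * sin (real n * fst p))
    = L2_inner u (\<lambda>p. \<Sum>n=1..N. a (- int n, 0) * d n * sin (real n * fst p))"
proof -
  have AL: "Au \<in> L2_torus" "\<And>\<xi>. fourier_coeff Au \<xi> = of_real (a \<xi>) * fourier_coeff u \<xi>"
    using A by (auto simp: fourier_mult_def)
  have "L2_inner Au (\<lambda>p. sin (real n * fst p)) = a (- int n, 0) * L2_inner u (\<lambda>p. sin (real n * fst p))" for n
    by (simp add: L2_inner_sin AL u)
  then show ?thesis
    by (simp add: L2_inner_sum_right L2_torus_scale sin_L2_torus AL u L2_inner_scale_right mult.assoc)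
      (simp add: mult.left_commute)
qed

text \<open>Time is absent: \<open>w\<close> stands for the time derivative at one instant. The
  profile and \<open>K\<close> precede \<open>u\<close> in the quantifiers, which is why the final
  radius is independent of the data.\<close>

lemma absorbing_estimate:
  assumes "\<epsilon> > 0"
  shows "\<exists>\<Phi>\<in>L2_torus. \<exists>K\<ge>0. \<forall>u v Au w. u \<in> H_torus 4 \<longrightarrow>
    (\<forall>k l. fourier_coeff u (- k, l) = - fourier_coeff u (k, l)) \<longrightarrow> fourier_mult sym_dx u v \<longrightarrow>
    fourier_mult (\<lambda>\<xi>. of_real (symbol \<beta> \<delta> \<epsilon> \<xi>)) u Au \<longrightarrow> w \<in> L2_torus \<longrightarrow>
    (AE p in lebesgue_on cell. w p + u p * v p + Au p = 0) \<longrightarrow>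
    2 * L2_inner w (\<lambda>p. u p - \<Phi> p) \<le> K - 1/2 * L2_inner (\<lambda>p. u p - \<Phi> p) (\<lambda>p. u p - \<Phi> p)"
proof -
  obtain C where C: "C \<ge> 0" "\<And>\<xi>. (real_of_int (fst \<xi>))\<^sup>2 - C \<le> symbol \<beta> \<delta> \<epsilon> \<xi>"
    using symbol_coercive[OF assms] by blast
  \<comment> \<open>Makes q/2 = C + 1, so that the damping beats the loss C of the coercivity bound
    by exactly 1.\<close>
  define q where "q = 2 * (C + 1)"
  have q: "q > 0" using C by (simp add: q_def)
  \<comment> \<open>With q m / 2 = 1 the term q/2 times the Fejer integral costs at most the squared
    norm of u_x gained by coercivity.\<close>
  define m where "m = 2 / q"
  have m: "m > 0" using q by (simp add: m_def)
  \<comment> \<open>\<theta> and then N are chosen so that each of the two terms in the Hardy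
    constant is at most m/2.\<close>
  define \<theta> where "\<theta> = m / (4*pi)"
  have \<theta>: "\<theta> > 0" using m by (simp add: \<theta>_def)
  obtain N where "16 * pi / (\<theta> * m) < real N" using reals_Archimedean2 by blast
  then have N: "16 * pi \<le> \<theta> * m * (real N + 1)"
    using \<theta> m by (simp add: field_simps) (smt (verit) mult_nonneg_nonneg)
  have "8*pi/(\<theta> * (real N + 1)) \<le> m / 2" using N \<theta> by (simp add: pos_divide_le_eq mult_ac)
  moreover have "2*pi*\<theta> = m / 2" by (simp add: \<theta>_def)
  ultimately have mN: "2*pi*\<theta> + 8*pi/(\<theta> * (real N + 1)) \<le> m" by simp
  \<comment> \<open>The termwise primitive of q (1 - F): the cosine coefficients of -q F for n >= 1,
    divided by n.\<close>
  define d where "d n = - 2 * q * (1 - real n / (real N + 1)) / real n" for n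
  define g where "g x = (\<Sum>n=1..N. d n * sin (real n * x))" for x
  define \<Phi> where "\<Phi> = (\<lambda>p :: real \<times> real. \<Sum>n=1..N. d n * sin (real n * fst p))"
  \<comment> \<open>The linear operator applied to the profile, in the form
    \<open>L2_inner_multiplier_sin\<close> returns.\<close>
  define \<Gamma> where "\<Gamma> = (\<lambda>p :: real \<times> real. \<Sum>n=1..N. symbol \<beta> \<delta> \<epsilon> (- int n, 0) * d n * sin (real n * fst p))"
  have L: "\<Phi> \<in> L2_torus" "\<Gamma> \<in> L2_torus"
    unfolding \<Phi>_def \<Gamma>_def by (intro L2_torus_sum L2_torus_scale sin_L2_torus)+
  have \<Phi>g: "\<Phi> p = g (fst p)" for p by (simp add: \<Phi>_def g_def)
  have g': "(g has_real_derivative q * (1 - fejer N x)) (at x)" for x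
  proof -
    have "(g has_real_derivative (\<Sum>n=1..N. d n * (cos (real n * x) * real n))) (at x)"
      unfolding g_def by (auto intro!: derivative_eq_intros sum.cong)
    also have "(\<Sum>n=1..N. d n * (cos (real n * x) * real n)) = q * (1 - fejer N x)"
      unfolding fejer_def by (simp add: sum_distrib_left d_def sum_negf[symmetric]) (intro sum.cong; simp add: algebra_simps)
    finally show ?thesis .
  qed
  have per: "g (2*pi) = g 0"
  proof -
    have "sin (real n * (2*pi)) = 0" for n using sin_npi2[of "2 * n"] by (simp add: mult_ac)
    then show ?thesis by (simp add: g_def)
  qed
  \<comment> \<open>One term pays for 2 <u, \<Gamma>>, the other for replacing the norm of u by that
    of u - \<Phi>.\<close>
  define K where "K = L2_inner \<Phi> \<Phi> + L2_inner \<Gamma> \<Gamma>"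
  have K: "K \<ge> 0" by (simp add: K_def L2_inner_self_ge)
  have main: "2 * L2_inner w (\<lambda>p. u p - \<Phi> p) \<le> K - 1/2 * L2_inner (\<lambda>p. u p - \<Phi> p) (\<lambda>p. u p - \<Phi> p)"
    if u: "u \<in> H_torus 4" and odd: "\<And>k l. fourier_coeff u (- k, l) = - fourier_coeff u (k, l)"
      and v: "fourier_mult sym_dx u v" and A: "fourier_mult (\<lambda>\<xi>. of_real (symbol \<beta> \<delta> \<epsilon> \<xi>)) u Au"
      and w: "w \<in> L2_torus" and eq: "AE p in lebesgue_on cell. w p + u p * v p + Au p = 0" for u v Au w
  proof -
    obtain U V where UV: "xderiv U V" "AE p in lebesgue_on cell. u p = U p" "AE p in lebesgue_on cell. v p = V p"
      and V: "\<forall>p. \<bar>V p\<bar> \<le> 1/2 * ((H_norm 4 u)\<^sup>2 + sobolev_const)"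
      and Uodd: "(\<forall>k l. fourier_coeff u (- k, l) = - fourier_coeff u (k, l)) \<longrightarrow> (\<forall>x y. U (- x, y) = - U (x, y))"
      using H4_representative[OF u v] by (elim exE conjE) (rule that)
    have U0: "U (0, y) = 0" for y
    proof -
      have "U (- 0, y) = - U (0, y)" using Uodd odd by blast
      then show ?thesis by simp
    qed
    have uL: "u \<in> L2_torus" and vL: "v \<in> L2_torus" and AL: "Au \<in> L2_torus"
      using u v A by (auto simp: H_torus_def fourier_mult_def)
    note c = xderivD(1,2)[OF UV(1)]
    have cg: "continuous_on UNIV (\<lambda>p :: real \<times> real. g (fst p))" unfolding g_def by (auto intro!: continuous_intros)
    have w_u: "L2_inner w u = - L2_inner Au u"
      using nonlinear_pairing[OF w AL uL eq UV(2,3,2) c c(1)] integral_cubic[OF UV(1)] by simp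
    have "(LINT p|lebesgue_on cell. (U p)\<^sup>2 * (q * (1 - fejer N (fst p))))
        = q * L2_inner u u - q * (LINT p|lebesgue_on cell. fejer N (fst p) * (U p)\<^sup>2)"
    proof -
      have "(LINT p|lebesgue_on cell. (U p)\<^sup>2 * (q * (1 - fejer N (fst p))))
         = (LINT p|lebesgue_on cell. q * (U p)\<^sup>2 - q * (fejer N (fst p) * (U p)\<^sup>2))"
        by (simp add: algebra_simps)
      also have "\<dots> = q * (LINT p|lebesgue_on cell. (U p)\<^sup>2) - q * (LINT p|lebesgue_on cell. fejer N (fst p) * (U p)\<^sup>2)"
        by (subst Bochner_Integration.integral_diff) (auto intro!: continuous_integrable_cell continuous_intros c)
      finally show ?thesis by (simp add: L2_inner_AE_continuous[OF uL UV(2) c(1)])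
    qed
    moreover have "(LINT p|lebesgue_on cell. fejer N (fst p) * (U p)\<^sup>2) \<le> m * L2_inner v v"
      using fejer_hardy_torus[OF UV(1) U0 \<theta>, of N]
        mult_right_mono[OF mN, of "LINT p|lebesgue_on cell. (V p)\<^sup>2"]
      by (simp add: L2_inner_AE_continuous[OF vL UV(3) c(2)])
    then have "q * (LINT p|lebesgue_on cell. fejer N (fst p) * (U p)\<^sup>2) \<le> q * (m * L2_inner v v)"
      using q by (intro mult_left_mono) auto
    then have "q * (LINT p|lebesgue_on cell. fejer N (fst p) * (U p)\<^sup>2) \<le> 2 * L2_inner v v"
      using q by (simp add: m_def)
    ultimately have I: "q * L2_inner u u - 2 * L2_inner v v
        \<le> (LINT p|lebesgue_on cell. (U p)\<^sup>2 * (q * (1 - fejer N (fst p))))" by linarith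
    have "L2_inner w \<Phi> = - (LINT p|lebesgue_on cell. U p * V p * g (fst p)) - L2_inner Au \<Phi>"
      by (rule nonlinear_pairing[OF w AL L(1) eq UV(2,3) _ c cg]) (simp add: \<Phi>g)
    also have "L2_inner Au \<Phi> = L2_inner u \<Gamma>"
      unfolding \<Phi>_def \<Gamma>_def by (rule L2_inner_multiplier_sin[OF uL A])
    also have "(LINT p|lebesgue_on cell. U p * V p * g (fst p))
        = - 1/2 * (LINT p|lebesgue_on cell. (U p)\<^sup>2 * (q * (1 - fejer N (fst p))))"
      by (rule integral_by_parts_background[OF UV(1) g' _ per]) (intro continuous_intros)
    finally have w_\<Phi>: "L2_inner w \<Phi> = 1/2 * (LINT p|lebesgue_on cell. (U p)\<^sup>2 * (q * (1 - fejer N (fst p)))) - L2_inner u \<Gamma>"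
      by simp
    have "L2_inner v v - C * L2_inner u u \<le> L2_inner Au u"
      by (rule energy_coercive[OF uL A v C(2)])
    then have "L2_inner w (\<lambda>p. u p - \<Phi> p) \<le> - L2_inner u u + L2_inner u \<Gamma>"
      using I unfolding L2_inner_diff_right[OF uL L(1) w] w_u w_\<Phi> q_def by (simp add: algebra_simps)
    moreover have "2 * L2_inner u \<Gamma> \<le> L2_inner u u + L2_inner \<Gamma> \<Gamma>"
      using L2_inner_self_ge[of "\<lambda>p. u p - \<Gamma> p"] uL L
      by (simp add: L2_inner_diff L2_inner_diff_right L2_torus_diff L2_inner_commute[of \<Gamma> u])
    moreover have "L2_inner (\<lambda>p. u p - \<Phi> p) (\<lambda>p. u p - \<Phi> p) \<le> 2 * L2_inner u u + 2 * L2_inner \<Phi> \<Phi>"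
      using L2_inner_self_ge[of "\<lambda>p. u p + \<Phi> p"] uL L
      by (simp add: L2_inner_diff L2_inner_diff_right L2_inner_add L2_inner_add_right L2_torus_add L2_torus_diff L2_inner_commute[of \<Phi> u])
    ultimately show ?thesis unfolding K_def by linarith
  qed
  show ?thesis
    by (rule bexI[OF _ L(1)], rule exI[of _ K]) (use K main in blast)
qed

section \<open>The even part at a fixed time\<close>

text \<open>Works through the L2 norm of the difference, which reflection preserves.\<close>

lemma AE_xrefl:
  assumes L: "u \<in> L2_torus" "U \<in> L2_torus" and eq: "AE p in lebesgue_on cell. u p = U p"
  shows "AE p in lebesgue_on cell. xrefl u p = xrefl U p"
proof -
  let ?f = "\<lambda>p. u p - U p"
  have f: "?f \<in> L2_torus" by (rule L2_torus_diff[OF L])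
  have "L2_inner (xrefl ?f) (xrefl ?f) = L2_inner ?f ?f"
    by (simp add: L2_inner_xrefl f L2_torus_xrefl)
  also have "\<dots> = (LINT p|lebesgue_on cell. 0)"
    unfolding L2_inner_def
    by (rule integral_cong_AE) (use eq L2_torus_prod[OF f f] in \<open>auto elim!: eventually_mono\<close>)
  finally have "(LINT p|lebesgue_on cell. (xrefl ?f p)\<^sup>2) = 0" by (simp add: L2_inner_def power2_eq_square)
  then have "AE p in lebesgue_on cell. (xrefl ?f p)\<^sup>2 = 0"
    using integral_nonneg_eq_0_iff_AE[OF L2_torusD(2)[OF L2_torus_xrefl[OF f]]] by simp
  then show ?thesis by (rule eventually_mono) (auto simp: xrefl_def split: prod.splits)
qed

text \<open>Turns the transport term, tested with e = U + RU for the reflection R, into one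
  quadratic in e, as Gronwall requires. The derivative of RU is -RV, so integrating the derivative
  of U^2 RU and reflecting shows that the integral of V (RU)^2 is twice that of U V RU; the pure
  cubic terms vanish.\<close>

lemma nonlinear_even_part:
  assumes UV: "xderiv U V"
  shows "4 * (LINT p|lebesgue_on cell. U p * V p * (U p + xrefl U p))
    = (LINT p|lebesgue_on cell. V p * (U p + xrefl U p)\<^sup>2)"
proof -
  note c = xderivD(1,2)[OF UV]
  have r: "continuous_on UNIV (xrefl f)" if "continuous_on UNIV f" for f
  proof -
    have "xrefl f = (\<lambda>p. f (- fst p, snd p))" by (auto simp: xrefl_def)
    then show ?thesis by (auto intro!: continuous_on_compose2[OF that] continuous_intros)
  qed
  note cc = c r[OF c(1)] r[OF c(2)]
  have "(LINT p|lebesgue_on cell. 2 * (U p * V p * xrefl U p) - (U p)\<^sup>2 * xrefl V p) = 0"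
  proof (rule integral_xderiv[where G = "\<lambda>p. (U p)\<^sup>2 * xrefl U p"])
    show "continuous_on UNIV (\<lambda>p. 2 * (U p * V p * xrefl U p) - (U p)\<^sup>2 * xrefl V p)"
      by (intro continuous_intros cc)
    show "((\<lambda>s. (U (s, y))\<^sup>2 * xrefl U (s, y)) has_real_derivative
        2 * (U (x, y) * V (x, y) * xrefl U (x, y)) - (U (x, y))\<^sup>2 * xrefl V (x, y)) (at x)" for x y
    proof -
      have "((\<lambda>s. U (- s, y)) has_real_derivative - V (- x, y)) (at x)"
        using DERIV_chain2[OF xderivD(5)[OF UV, of y "- x"] DERIV_minus[OF DERIV_ident]] by simp
      then show ?thesis
        by (auto intro!: derivative_eq_intros xderivD(5)[OF UV] simp: power2_eq_square algebra_simps)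
    qed
    show "(U (2*pi, y))\<^sup>2 * xrefl U (2*pi, y) = (U (0, y))\<^sup>2 * xrefl U (0, y)" for y
      using xderivD(3)[OF UV, of 0 y] xderivD(3)[OF UV, of "-2*pi" y] by simp
  qed
  then have 1: "2 * (LINT p|lebesgue_on cell. U p * V p * xrefl U p) = (LINT p|lebesgue_on cell. (U p)\<^sup>2 * xrefl V p)"
    by (subst (asm) Bochner_Integration.integral_diff) (auto intro!: continuous_integrable_cell continuous_intros cc)
  have 2: "(LINT p|lebesgue_on cell. (U p)\<^sup>2 * xrefl V p) = (LINT p|lebesgue_on cell. (xrefl U p)\<^sup>2 * V p)"
  proof -
    have "(LINT p|lebesgue_on cell. (xrefl U p)\<^sup>2 * V p)
        = (LINT p|lebesgue_on cell. (\<lambda>p. (U p)\<^sup>2 * xrefl V p) (2*pi - fst p, snd p))"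
      using xrefl_flip[OF L2_torus_xrefl[OF xderivD(7)[OF UV]]] xrefl_flip[OF xderivD(6)[OF UV]] by simp
    also have "\<dots> = (LINT p|lebesgue_on cell. (U p)\<^sup>2 * xrefl V p)"
      by (rule integral_flip_cell(1)) (intro continuous_borel_cell continuous_intros cc)
    finally show ?thesis by simp
  qed
  note z = integral_cubic[OF UV]
  have "(LINT p|lebesgue_on cell. V p * (U p + xrefl U p)\<^sup>2)
     = (LINT p|lebesgue_on cell. U p * V p * U p + 2 * (U p * V p * xrefl U p) + (xrefl U p)\<^sup>2 * V p)"
    by (rule arg_cong[of _ _ "integral\<^sup>L _"]) (auto simp: power2_eq_square algebra_simps)
  also have "\<dots> = (LINT p|lebesgue_on cell. U p * V p * U p) + 2 * (LINT p|lebesgue_on cell. U p * V p * xrefl U p)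
      + (LINT p|lebesgue_on cell. (xrefl U p)\<^sup>2 * V p)"
    by (subst Bochner_Integration.integral_add Bochner_Integration.integral_add; auto intro!: continuous_integrable_cell continuous_intros cc)+
  also have "\<dots> = 4 * (LINT p|lebesgue_on cell. U p * V p * xrefl U p)" using z 1 2 by simp
  also have "(LINT p|lebesgue_on cell. U p * V p * xrefl U p) = (LINT p|lebesgue_on cell. U p * V p * (U p + xrefl U p))"
  proof -
    have "(LINT p|lebesgue_on cell. U p * V p * (U p + xrefl U p))
       = (LINT p|lebesgue_on cell. U p * V p * U p) + (LINT p|lebesgue_on cell. U p * V p * xrefl U p)"
      unfolding distrib_left by (subst Bochner_Integration.integral_add) (auto intro!: continuous_integrable_cell continuous_intros cc)
    then show ?thesis using z by simp
  qed
  finally show ?thesis by simp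
qed

text \<open>The factor 4 appears because the squared norm of e has derivative 2 <w + Rw, e>, and e
  is invariant under the reflection R.\<close>

lemma even_part_estimate:
  assumes C: "\<And>\<xi>. - C \<le> symbol \<beta> \<delta> \<epsilon> \<xi>" and u: "u \<in> H_torus 4" and v: "fourier_mult sym_dx u v"
    and A: "fourier_mult (\<lambda>\<xi>. of_real (symbol \<beta> \<delta> \<epsilon> \<xi>)) u Au" and w: "w \<in> L2_torus"
    and eq: "AE p in lebesgue_on cell. w p + u p * v p + Au p = 0"
  defines "e \<equiv> (\<lambda>p. u p + xrefl u p)"
  shows "4 * L2_inner w e \<le> (1/2 * ((H_norm 4 u)\<^sup>2 + sobolev_const) + 2 * C) * L2_inner e e"
proof -
  obtain U V where UV: "xderiv U V" "AE p in lebesgue_on cell. u p = U p" "AE p in lebesgue_on cell. v p = V p"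
    and V: "\<forall>p. \<bar>V p\<bar> \<le> 1/2 * ((H_norm 4 u)\<^sup>2 + sobolev_const)"
    and Uodd: "(\<forall>k l. fourier_coeff u (- k, l) = - fourier_coeff u (k, l)) \<longrightarrow> (\<forall>x y. U (- x, y) = - U (x, y))"
      using H4_representative[OF u v] by (elim exE conjE) (rule that)
  define S where "S = 1/2 * ((H_norm 4 u)\<^sup>2 + sobolev_const)"
  have uL: "u \<in> L2_torus" and AL: "Au \<in> L2_torus" "\<And>\<xi>. fourier_coeff Au \<xi> = of_real (symbol \<beta> \<delta> \<epsilon> \<xi>) * fourier_coeff u \<xi>"
    using u A by (auto simp: H_torus_def fourier_mult_def)
  note rL = L2_torus_xrefl[OF uL] L2_torus_xrefl[OF AL(1)]
  have eL: "e \<in> L2_torus" unfolding e_def by (intro L2_torus_add uL rL)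
  have re: "xrefl e = e" by (auto simp: e_def xrefl_def)
  define E where "E = (\<lambda>p. U p + xrefl U p)"
  note c = xderivD(1,2)[OF UV(1)]
  have cE: "continuous_on UNIV E"
  proof -
    have "E = (\<lambda>p. U p + U (- fst p, snd p))" by (auto simp: E_def xrefl_def)
    then show ?thesis by (auto intro!: continuous_intros continuous_on_compose2[OF c(1)] c)
  qed
  have eE: "AE p in lebesgue_on cell. e p = E p"
    using UV(2) AE_xrefl[OF uL xderivD(6)[OF UV(1)] UV(2)] by eventually_elim (simp add: e_def E_def)
  have "L2_inner w e = - (LINT p|lebesgue_on cell. U p * V p * E p) - L2_inner Au e"
    by (rule nonlinear_pairing[OF w AL(1) eL eq UV(2,3) eE c cE])
  then have "4 * L2_inner w e = - (LINT p|lebesgue_on cell. V p * (E p)\<^sup>2) - 4 * L2_inner Au e"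
    using nonlinear_even_part[OF UV(1)] by (simp add: E_def)
  moreover have "- (LINT p|lebesgue_on cell. V p * (E p)\<^sup>2) \<le> S * L2_inner e e"
  proof -
    have "- (LINT p|lebesgue_on cell. V p * (E p)\<^sup>2) = (LINT p|lebesgue_on cell. - (V p * (E p)\<^sup>2))" by simp
    also have "\<dots> \<le> (LINT p|lebesgue_on cell. S * (E p)\<^sup>2)"
    proof (rule integral_mono)
      show "- (V p * (E p)\<^sup>2) \<le> S * (E p)\<^sup>2" for p
        using V[rule_format, of p] mult_right_mono[of "- V p" S "(E p)\<^sup>2"] by (simp add: S_def abs_le_iff)
    qed (intro continuous_integrable_cell continuous_intros c cE)+
    also have "\<dots> = S * L2_inner e e" by (simp add: L2_inner_AE_continuous[OF eL eE cE])
    finally show ?thesis .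
  qed
  moreover have "- (4 * L2_inner Au e) \<le> 2 * C * L2_inner e e"
  proof -
    let ?Ae = "\<lambda>p. Au p + xrefl Au p"
    \<comment> \<open>Reflection sends k to -k, and the symbol is even in k.\<close>
    have "fourier_coeff ?Ae \<xi> = of_real (symbol \<beta> \<delta> \<epsilon> \<xi>) * fourier_coeff e \<xi>" for \<xi>
    proof (cases \<xi>)
      case (Pair k l)
      show ?thesis unfolding e_def Pair
        by (simp add: fourier_coeff_add uL AL rL fourier_coeff_xrefl symbol_even distrib_left)
    qed
    then have "fourier_mult (\<lambda>\<xi>. of_real (symbol \<beta> \<delta> \<epsilon> \<xi>)) e ?Ae"
      by (simp add: fourier_mult_def L2_torus_add AL rL)
    from energy_lower_bound[OF eL this C] have "- C * L2_inner e e \<le> L2_inner ?Ae e" .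
    moreover have "L2_inner ?Ae e = 2 * L2_inner Au e"
      using L2_inner_xrefl[OF AL(1) eL] by (simp add: L2_inner_add AL rL eL re)
    ultimately show ?thesis by simp
  qed
  ultimately have "4 * L2_inner w e \<le> S * L2_inner e e + 2 * C * L2_inner e e" by linarith
  then show ?thesis unfolding S_def by (simp only: distrib_right)
qed

section \<open>Energy inequality in time\<close>

lemma AE_lebesgue_on_subset:
  assumes "AE r in lebesgue_on S. P r" "S \<in> sets lebesgue" "S' \<in> sets lebesgue" "S' \<subseteq> S"
  shows "AE r in lebesgue_on S'. P r"
proof -
  have "AE r in lebesgue. r \<in> S \<longrightarrow> P r" using assms by (simp add: AE_restrict_space_iff)
  then have "AE r in lebesgue. r \<in> S' \<longrightarrow> P r" by (rule eventually_mono) (use assms in auto)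
  then show ?thesis using assms by (simp add: AE_restrict_space_iff)
qed

text \<open>Completeness of Lebesgue measure absorbs the exceptional null set; extension by 0 off
  \<open>S\<close> allows the limit to be taken on the whole space.\<close>

lemma measurable_AE_limit:
  fixes f :: "nat \<Rightarrow> 'a::euclidean_space \<Rightarrow> real"
  assumes "\<And>n. f n \<in> borel_measurable (lebesgue_on S)" "S \<in> sets lebesgue"
    and "AE r in lebesgue_on S. (\<lambda>n. f n r) \<longlonglongrightarrow> g r"
  shows "g \<in> borel_measurable (lebesgue_on S)"
proof -
  let ?f = "\<lambda>n r. if r \<in> S then f n r else 0" and ?g = "\<lambda>r. if r \<in> S then g r else 0"
  have "?f n \<in> borel_measurable lebesgue" for n
    using assms by (simp add: borel_measurable_if)
  then have "(\<lambda>r. lim (\<lambda>n. ?f n r)) \<in> borel_measurable lebesgue" by (rule borel_measurable_lim_metric)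
  moreover have "AE r in lebesgue. r \<in> S \<longrightarrow> (\<lambda>n. f n r) \<longlonglongrightarrow> g r"
    using assms by (simp add: AE_restrict_space_iff)
  then have "AE r in lebesgue. lim (\<lambda>n. ?f n r) = ?g r"
    by (rule eventually_mono) (auto simp: limI)
  ultimately have "?g \<in> borel_measurable lebesgue" by (rule borel_measurable_AE)
  then show ?thesis using assms by (simp add: borel_measurable_if)
qed

lemma integral_interval_combine:
  fixes f :: "real \<Rightarrow> real"
  assumes f: "integrable (lebesgue_on {0..T}) f" and "0 \<le> a" "a \<le> b" "b \<le> T"
  shows "(LINT r|lebesgue_on {a..b}. f r) = (LINT r|lebesgue_on {0..b}. f r) - (LINT r|lebesgue_on {0..a}. f r)"
proof -
  have i: "integrable (lebesgue_on {c..d}) f" if "0 \<le> c" "d \<le> T" for c d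
    by (rule integrable_subinterval[OF f]) (use that in auto)
  have "f integrable_on {0..b}" using i[of 0 b] assms by (simp add: integrable_on_lebesgue_on)
  then have "integral {0..a} f + integral {a..b} f = integral {0..b} f"
    using assms by (intro Henstock_Kurzweil_Integration.integral_combine) auto
  then show ?thesis using i assms by (simp add: lebesgue_integral_eq_integral)
qed

text \<open>Uniform continuity of the indefinite integral. The rates used below are integrable but
  not known to be bounded, so short intervals are chosen this way.\<close>

lemma uniformly_small_integral:
  fixes f :: "real \<Rightarrow> real"
  assumes f: "integrable (lebesgue_on {0..T}) f" and "e > 0"
  shows "\<exists>h>0. \<forall>a b. 0 \<le> a \<and> a \<le> b \<and> b \<le> T \<and> b - a \<le> h \<longrightarrow> (LINT r|lebesgue_on {a..b}. f r) \<le> e"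
proof -
  have "uniformly_continuous_on {0..T} (\<lambda>x. LINT r|lebesgue_on {0..x}. f r)"
    by (intro compact_uniformly_continuous indefinite_integral_continuous_real f) simp
  then obtain d where d: "d > 0" "\<And>x y. x \<in> {0..T} \<Longrightarrow> y \<in> {0..T} \<Longrightarrow> dist y x < d \<Longrightarrow>
      dist (LINT r|lebesgue_on {0..y}. f r) (LINT r|lebesgue_on {0..x}. f r) < e"
    using \<open>e > 0\<close> unfolding uniformly_continuous_on_def by metis
  have "(LINT r|lebesgue_on {a..b}. f r) \<le> e" if "0 \<le> a" "a \<le> b" "b \<le> T" "b - a \<le> d / 2" for a b
    using d(2)[of a b] that \<open>d > 0\<close> integral_interval_combine[OF f that(1-3)] by (simp add: dist_real_def)
  then show ?thesis using \<open>d > 0\<close> by (intro exI[of _ "d / 2"]) auto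
qed

text \<open>Chains steps of length at most h, turning estimates on short intervals into global
  ones.\<close>

lemma locally_nonincreasing:
  fixes F :: "real \<Rightarrow> real"
  assumes "h > 0" and loc: "\<And>a b. 0 \<le> a \<Longrightarrow> a \<le> b \<Longrightarrow> b \<le> T \<Longrightarrow> b - a \<le> h \<Longrightarrow> F b \<le> F a"
    and "0 \<le> a" "a \<le> b" "b \<le> T"
  shows "F b \<le> F a"
proof -
  have "b - a \<le> real n * h \<Longrightarrow> b \<le> T \<Longrightarrow> a \<le> b \<Longrightarrow> F b \<le> F a" for n b
  proof (induction n arbitrary: b)
    case 0
    then show ?case by simp
  next
    case (Suc n)
    define c where "c = max a (b - h)"
    have "F c \<le> F a" using Suc \<open>h > 0\<close> by (intro Suc.IH) (auto simp: c_def algebra_simps)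
    moreover have "F b \<le> F c" using Suc.prems \<open>h > 0\<close> \<open>0 \<le> a\<close> by (intro loc) (auto simp: c_def)
    ultimately show ?case by simp
  qed
  moreover obtain n where "(b - a) / h < real n" using reals_Archimedean2 by blast
  then have "b - a \<le> real n * h" using \<open>h > 0\<close> by (simp add: field_simps)
  ultimately show ?thesis using assms by blast
qed

text \<open>The derivative enters only through its pairings \<open>D r \<psi>\<close>. For \<open>\<eta> + xrefl \<eta>\<close> the pairing
  \<open>L2_inner w (\<psi> + xrefl \<psi>)\<close> is measurable at once, while strong measurability of \<open>w + xrefl w\<close> would need an argument.\<close>

definition weak_derivative :: "(real \<Rightarrow> tfun) \<Rightarrow> (real \<Rightarrow> tfun \<Rightarrow> real) \<Rightarrow> (real \<Rightarrow> real) \<Rightarrow> bool" where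
  "weak_derivative v D W \<longleftrightarrow> (\<forall>t\<ge>0. v t \<in> L2_torus) \<and> (\<forall>r. 0 \<le> W r) \<and>
     (\<forall>T>0. integrable (lebesgue_on {0..T}) W \<and>
       (\<forall>\<psi>\<in>L2_torus. (\<lambda>r. D r \<psi>) \<in> borel_measurable (lebesgue_on {0..T})) \<and>
       (AE r in lebesgue_on {0..T}. (\<forall>\<psi>\<in>L2_torus. \<bar>D r \<psi>\<bar> \<le> W r * L2_norm \<psi>) \<and>
         (\<forall>\<phi>\<in>L2_torus. \<forall>\<psi>\<in>L2_torus. D r (\<lambda>p. \<phi> p + \<psi> p) = D r \<phi> + D r \<psi>))) \<and>
     (\<forall>s t. 0 \<le> s \<and> s \<le> t \<longrightarrow> (\<forall>\<psi>\<in>L2_torus.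
        L2_inner (v t) \<psi> - L2_inner (v s) \<psi> = (LINT r|lebesgue_on {s..t}. D r \<psi>)))"

lemma weak_derivativeD:
  assumes "weak_derivative v D W"
  shows "t \<ge> 0 \<Longrightarrow> v t \<in> L2_torus" "0 \<le> W r" "T > 0 \<Longrightarrow> integrable (lebesgue_on {0..T}) W"
    "T > 0 \<Longrightarrow> \<psi> \<in> L2_torus \<Longrightarrow> (\<lambda>r. D r \<psi>) \<in> borel_measurable (lebesgue_on {0..T})"
    "T > 0 \<Longrightarrow> AE r in lebesgue_on {0..T}. (\<forall>\<psi>\<in>L2_torus. \<bar>D r \<psi>\<bar> \<le> W r * L2_norm \<psi>) \<and>
         (\<forall>\<phi>\<in>L2_torus. \<forall>\<psi>\<in>L2_torus. D r (\<lambda>p. \<phi> p + \<psi> p) = D r \<phi> + D r \<psi>)"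
    "0 \<le> s \<Longrightarrow> s \<le> t \<Longrightarrow> \<psi> \<in> L2_torus \<Longrightarrow>
        L2_inner (v t) \<psi> - L2_inner (v s) \<psi> = (LINT r|lebesgue_on {s..t}. D r \<psi>)"
  using assms unfolding weak_derivative_def by blast+

context
  fixes v :: "real \<Rightarrow> tfun" and D :: "real \<Rightarrow> tfun \<Rightarrow> real" and W :: "real \<Rightarrow> real" and T :: real
  assumes wd: "weak_derivative v D W" and T: "T > 0"
begin

lemma weak_integrable:
  fixes a b :: real
  assumes "\<psi> \<in> L2_torus" "0 \<le> a" "b \<le> T"
  shows "integrable (lebesgue_on {a..b}) (\<lambda>r. D r \<psi>)"
proof -
  have "integrable (lebesgue_on {0..T}) (\<lambda>r. D r \<psi>)"
  proof (rule Bochner_Integration.integrable_bound)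
    show "integrable (lebesgue_on {0..T}) (\<lambda>r. W r * L2_norm \<psi>)"
      using weak_derivativeD(3)[OF wd T] by simp
    show "AE r in lebesgue_on {0..T}. norm (D r \<psi>) \<le> norm (W r * L2_norm \<psi>)"
      using weak_derivativeD(5)[OF wd T]
      by (rule eventually_mono) (use assms weak_derivativeD(2)[OF wd] in \<open>auto simp: L2_norm_ge abs_mult\<close>)
  qed (rule weak_derivativeD(4)[OF wd T assms(1)])
  then show ?thesis by (rule integrable_subinterval) (use assms in auto)
qed

lemma W_integrable: "0 \<le> a \<Longrightarrow> b \<le> T \<Longrightarrow> integrable (lebesgue_on {a..b}) W"
  using weak_derivativeD(3)[OF wd T] by (rule integrable_subinterval) auto

lemma weak_AE:
  fixes a b :: real
  assumes "0 \<le> a" "b \<le> T"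
  shows "AE r in lebesgue_on {a..b}. (\<forall>\<psi>\<in>L2_torus. \<bar>D r \<psi>\<bar> \<le> W r * L2_norm \<psi>) \<and>
         (\<forall>\<phi>\<in>L2_torus. \<forall>\<psi>\<in>L2_torus. D r (\<lambda>p. \<phi> p + \<psi> p) = D r \<phi> + D r \<psi>)"
  by (rule AE_lebesgue_on_subset[OF weak_derivativeD(5)[OF wd T]]) (use assms in auto)

text \<open>Duality: the increment is tested with itself, which is admissible because it does not
  depend on the integration variable.\<close>

lemma increment_norm_le:
  assumes "0 \<le> a" "a \<le> b" "b \<le> T"
  shows "L2_norm (\<lambda>p. v b p - v a p) \<le> (LINT r|lebesgue_on {a..b}. W r)"
proof -
  let ?\<psi> = "\<lambda>p. v b p - v a p"
  have L: "v a \<in> L2_torus" "v b \<in> L2_torus" "?\<psi> \<in> L2_torus"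
    using assms by (auto intro!: L2_torus_diff weak_derivativeD(1)[OF wd])
  have "(L2_norm ?\<psi>)\<^sup>2 = (LINT r|lebesgue_on {a..b}. D r ?\<psi>)"
    using weak_derivativeD(6)[OF wd assms(1,2) L(3)] by (simp add: L2_norm_power2 L2_inner_diff L)
  also have "\<dots> \<le> (LINT r|lebesgue_on {a..b}. W r * L2_norm ?\<psi>)"
  proof (rule integral_mono_AE)
    show "AE r in lebesgue_on {a..b}. D r ?\<psi> \<le> W r * L2_norm ?\<psi>"
      using weak_AE[OF assms(1,3)] by (rule eventually_mono) (use L(3) in \<open>auto simp: abs_le_iff\<close>)
  qed (use weak_integrable[OF L(3) assms(1,3)] W_integrable[OF assms(1,3)] in auto)
  also have "\<dots> = (LINT r|lebesgue_on {a..b}. W r) * L2_norm ?\<psi>" by simp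
  finally have le: "L2_norm ?\<psi> * L2_norm ?\<psi> \<le> (LINT r|lebesgue_on {a..b}. W r) * L2_norm ?\<psi>"
    by (simp add: power2_eq_square)
  show ?thesis
  proof (cases "L2_norm ?\<psi> = 0")
    case True
    then show ?thesis using weak_derivativeD(2)[OF wd] by simp
  next
    case False
    then show ?thesis using le L2_norm_ge[of ?\<psi>] by (simp add: mult_le_cancel_right)
  qed
qed

lemma W_integral_mono:
  assumes "a \<le> c" "c \<le> d" "d \<le> b" "0 \<le> a" "b \<le> T"
  shows "(LINT r|lebesgue_on {c..d}. W r) \<le> (LINT r|lebesgue_on {a..b}. W r)"
proof -
  have nn: "0 \<le> (LINT r|lebesgue_on {x..y}. W r)" for x y
    using weak_derivativeD(2)[OF wd] by simp
  note comb = integral_interval_combine[OF weak_derivativeD(3)[OF wd T]]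
  show ?thesis
    using comb[of a c] comb[of c d] comb[of d b] comb[of a b] nn[of a c] nn[of d b] assms by auto
qed

text \<open>The difference of squares is the increment paired with v b + v a, a test function
  independent of r. Replacing it by 2 v r under the integral costs the two increments from r to the
  endpoints, hence an error quadratic in the integral of \<open>W\<close>.\<close>

lemma energy_local:
  assumes ab: "0 \<le> a" "a \<le> b" "b \<le> T" and g: "integrable (lebesgue_on {0..T}) g"
    and le: "AE r in lebesgue_on {0..T}. 2 * D r (v r) \<le> g r"
  shows "L2_inner (v b) (v b) - L2_inner (v a) (v a)
    \<le> (LINT r|lebesgue_on {a..b}. g r) + 2 * (LINT r|lebesgue_on {a..b}. W r) * (LINT r|lebesgue_on {a..b}. W r)"
proof -
  define \<omega> where "\<omega> = (LINT r|lebesgue_on {a..b}. W r)"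
  let ?\<psi> = "\<lambda>p. v b p + v a p"
  have vL: "v r \<in> L2_torus" if "0 \<le> r" for r using weak_derivativeD(1)[OF wd that] .
  have L: "v a \<in> L2_torus" "v b \<in> L2_torus" "?\<psi> \<in> L2_torus"
    using ab by (auto intro!: L2_torus_add vL)
  have gi: "integrable (lebesgue_on {a..b}) g" by (rule integrable_subinterval[OF g]) (use ab in auto)
  have "L2_inner (v b) (v b) - L2_inner (v a) (v a) = L2_inner (v b) ?\<psi> - L2_inner (v a) ?\<psi>"
    using L by (simp add: L2_inner_add_right L2_inner_commute[of "v a" "v b"])
  also have "\<dots> = (LINT r|lebesgue_on {a..b}. D r ?\<psi>)" by (rule weak_derivativeD(6)[OF wd ab(1,2) L(3)])
  also have "\<dots> \<le> (LINT r|lebesgue_on {a..b}. g r + 2 * \<omega> * W r)"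
  proof (rule integral_mono_AE)
    have "AE r in lebesgue_on {a..b}. 2 * D r (v r) \<le> g r"
      by (rule AE_lebesgue_on_subset[OF le]) (use ab in auto)
    moreover have "AE r in lebesgue_on {a..b}. r \<in> {a..b}" by (rule AE_I2) simp
    ultimately show "AE r in lebesgue_on {a..b}. D r ?\<psi> \<le> g r + 2 * \<omega> * W r"
      using weak_AE[OF ab(1,3)]
    proof eventually_elim
      case (elim r)
      then have r: "a \<le> r" "r \<le> b" "0 \<le> r" using ab by auto
      let ?x = "\<lambda>p. v b p - v r p" and ?y = "\<lambda>p. v a p - v r p"
      have LL: "v r \<in> L2_torus" "?x \<in> L2_torus" "?y \<in> L2_torus"
        using L r by (auto intro!: L2_torus_diff vL)
      have "L2_norm ?x \<le> \<omega>"
        using increment_norm_le[of r b] W_integral_mono[of a r b b] ab r unfolding \<omega>_def by linarith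
      then have x: "D r ?x \<le> W r * \<omega>"
        using elim LL(2) mult_left_mono[of "L2_norm ?x" \<omega> "W r"] weak_derivativeD(2)[OF wd, of r]
        by (meson abs_le_D1 order_trans)
      have "L2_norm ?y = L2_norm (\<lambda>p. v r p - v a p)"
        unfolding L2_norm_def by (simp add: power2_commute)
      then have "L2_norm ?y \<le> \<omega>"
        using increment_norm_le[of a r] W_integral_mono[of a a r b] ab r unfolding \<omega>_def by linarith
      then have y: "D r ?y \<le> W r * \<omega>"
        using elim LL(3) mult_left_mono[of "L2_norm ?y" \<omega> "W r"] weak_derivativeD(2)[OF wd, of r]
        by (meson abs_le_D1 order_trans)
      \<comment> \<open>The double of \<open>v r\<close> is written as a sum because
        \<open>weak_derivative\<close> provides additivity of \<open>D r\<close>, not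
        homogeneity.\<close>
      have "?\<psi> = (\<lambda>p. (v r p + v r p) + (?x p + ?y p))" by auto
      moreover have "D r (\<lambda>p. (v r p + v r p) + (?x p + ?y p)) = (D r (v r) + D r (v r)) + (D r ?x + D r ?y)"
      proof -
        have add: "D r (\<lambda>p. \<phi> p + \<psi> p) = D r \<phi> + D r \<psi>" if "\<phi> \<in> L2_torus" "\<psi> \<in> L2_torus" for \<phi> \<psi>
          using elim that by blast
        show ?thesis
          by (subst add, intro L2_torus_add LL, intro L2_torus_add LL) (simp only: add[OF LL(1,1)] add[OF LL(2,3)])
      qed
      ultimately have "D r ?\<psi> = 2 * D r (v r) + D r ?x + D r ?y" by simp
      then show ?case using x y elim by (simp add: mult_ac)
    qed
  qed (use weak_integrable[OF L(3) ab(1,3)] W_integrable[OF ab(1,3)] gi in auto)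
  also have "\<dots> = (LINT r|lebesgue_on {a..b}. g r) + 2 * \<omega> * (LINT r|lebesgue_on {a..b}. W r)"
    using gi W_integrable[OF ab(1,3)] by simp
  finally show ?thesis by (simp add: \<omega>_def)
qed

text \<open>On short intervals the quadratic error of \<open>energy_local\<close> is at most e times
  the integral of \<open>W\<close>; this is additive, so it survives chaining and disappears as e
  tends to 0. An integrable majorant \<open>g\<close> spares any measurability of
  \<open>D r (v r)\<close> in r.\<close>

lemma energy_inequality:
  assumes ab: "0 \<le> a" "a \<le> b" "b \<le> T" and g: "integrable (lebesgue_on {0..T}) g"
    and le: "AE r in lebesgue_on {0..T}. 2 * D r (v r) \<le> g r"
  shows "L2_inner (v b) (v b) - L2_inner (v a) (v a) \<le> (LINT r|lebesgue_on {a..b}. g r)"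
proof -
  define J where "J f x = (LINT r|lebesgue_on {0..x}. f r)" for f :: "real \<Rightarrow> real" and x
  note Wi = weak_derivativeD(3)[OF wd T]
  have nn: "0 \<le> (LINT r|lebesgue_on {x..y}. W r)" for x y
    using weak_derivativeD(2)[OF wd] by simp
  have "L2_inner (v b) (v b) - L2_inner (v a) (v a) \<le> (LINT r|lebesgue_on {a..b}. g r) + e * (LINT r|lebesgue_on {a..b}. W r)"
    if "e > 0" for e
  proof -
    have "e / 2 > 0" using that by simp
    from uniformly_small_integral[OF Wi this] obtain h where h: "h > 0"
      "\<And>a b. 0 \<le> a \<Longrightarrow> a \<le> b \<Longrightarrow> b \<le> T \<Longrightarrow> b - a \<le> h \<Longrightarrow> (LINT r|lebesgue_on {a..b}. W r) \<le> e / 2"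
      by blast
    \<comment> \<open>Subtracting both primitives turns the local inequality into
      monotonicity.\<close>
    let ?F = "\<lambda>x. L2_inner (v x) (v x) - J g x - e * J W x"
    have "?F b \<le> ?F a"
    proof (rule locally_nonincreasing[OF h(1) _ ab])
      fix c d assume cd: "0 \<le> c" "c \<le> d" "d \<le> T" "d - c \<le> h"
      have "2 * (LINT r|lebesgue_on {c..d}. W r) * (LINT r|lebesgue_on {c..d}. W r) \<le> e * (LINT r|lebesgue_on {c..d}. W r)"
        using h(2)[OF cd] nn by (intro mult_right_mono) auto
      then have "L2_inner (v d) (v d) - L2_inner (v c) (v c)
          \<le> (LINT r|lebesgue_on {c..d}. g r) + e * (LINT r|lebesgue_on {c..d}. W r)"
        using energy_local[OF cd(1-3) g le] by linarith
      then show "?F d \<le> ?F c"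
        using integral_interval_combine[OF g cd(1-3)] integral_interval_combine[OF Wi cd(1-3)]
        by (simp add: J_def right_diff_distrib)
    qed
    then show ?thesis
      using integral_interval_combine[OF g ab] integral_interval_combine[OF Wi ab]
      by (simp add: J_def right_diff_distrib)
  qed
  note e = this
  show ?thesis
  proof (rule field_le_epsilon)
    fix \<epsilon> :: real assume "\<epsilon> > 0"
    define I where "I = (LINT r|lebesgue_on {a..b}. W r)"
    have "I \<ge> 0" using nn by (simp add: I_def)
    then have "\<epsilon> / (I + 1) > 0" "\<epsilon> / (I + 1) * I \<le> \<epsilon>" using \<open>\<epsilon> > 0\<close> by (auto simp: field_simps)
    then show "L2_inner (v b) (v b) - L2_inner (v a) (v a) \<le> (LINT r|lebesgue_on {a..b}. g r) + \<epsilon>"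
      using e[of "\<epsilon> / (I + 1)"] unfolding I_def by linarith
  qed
qed

lemma continuous_norm: "continuous_on {0..T} (\<lambda>t. L2_inner (v t) (v t))"
proof -
  note Wi = weak_derivativeD(3)[OF wd T]
  have tri: "\<bar>L2_norm (v b) - L2_norm (v a)\<bar> \<le> (LINT r|lebesgue_on {a..b}. W r)" if ab: "0 \<le> a" "a \<le> b" "b \<le> T" for a b
  proof -
    have L: "v a \<in> L2_torus" "v b \<in> L2_torus"
      using ab by (auto intro!: weak_derivativeD(1)[OF wd])
    have "L2_norm (v b) \<le> L2_norm (\<lambda>p. v b p - v a p) + L2_norm (v a)"
      using L2_norm_triangle[OF L2_torus_diff[OF L(2,1)] L(1)] by simp
    moreover have "L2_norm (v a) \<le> L2_norm (\<lambda>p. v a p - v b p) + L2_norm (v b)"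
      using L2_norm_triangle[OF L2_torus_diff[OF L] L(2)] by simp
    moreover have "L2_norm (\<lambda>p. v a p - v b p) = L2_norm (\<lambda>p. v b p - v a p)"
      unfolding L2_norm_def by (simp add: power2_commute)
    ultimately show ?thesis using increment_norm_le[OF ab] by linarith
  qed
  have "continuous_on {0..T} (\<lambda>t. L2_norm (v t))"
    unfolding continuous_on_iff
  proof (intro ballI allI impI)
    fix x e :: real assume x: "x \<in> {0..T}" and "e > 0"
    then have "e / 2 > 0" by simp
    from uniformly_small_integral[OF Wi this] obtain h where h: "h > 0"
      "\<And>a b. 0 \<le> a \<Longrightarrow> a \<le> b \<Longrightarrow> b \<le> T \<Longrightarrow> b - a \<le> h \<Longrightarrow> (LINT r|lebesgue_on {a..b}. W r) \<le> e / 2"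
      by blast
    have "dist (L2_norm (v x')) (L2_norm (v x)) < e" if "x' \<in> {0..T}" "dist x' x < h" for x'
    proof (cases "x \<le> x'")
      case True
      with that x have "\<bar>L2_norm (v x') - L2_norm (v x)\<bar> \<le> e / 2"
        by (intro order_trans[OF tri h(2)]) (auto simp: dist_real_def)
      then show ?thesis using \<open>e > 0\<close> by (simp add: dist_real_def)
    next
      case False
      with that x have "\<bar>L2_norm (v x) - L2_norm (v x')\<bar> \<le> e / 2"
        by (intro order_trans[OF tri h(2)]) (auto simp: dist_real_def)
      then show ?thesis using \<open>e > 0\<close> abs_minus_commute[of "L2_norm (v x)"] by (simp add: dist_real_def)
    qed
    then show "\<exists>d>0. \<forall>x'\<in>{0..T}. dist x' x < d \<longrightarrow> dist (L2_norm (v x')) (L2_norm (v x)) < e"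
      using h(1) by blast
  qed
  then have "continuous_on {0..T} (\<lambda>t. (L2_norm (v t))\<^sup>2)" by (intro continuous_intros)
  then show ?thesis by (simp add: L2_norm_power2)
qed

end

section \<open>Scalar integral inequalities\<close>

text \<open>On an interval where the integral of \<open>M\<close> is at most 1/2, a \<open>G\<close>
  that vanishes on the left satisfies G c <= G c / 2 at its maximum point c, so it stays
  zero.\<close>

lemma gronwall_zero:
  fixes G M :: "real \<Rightarrow> real"
  assumes M: "integrable (lebesgue_on {0..T}) M" "\<And>r. 0 \<le> M r"
    and G: "continuous_on {0..T} G" "\<And>t. 0 \<le> G t" "G 0 = 0"
    and ineq: "\<And>a b. 0 \<le> a \<Longrightarrow> a \<le> b \<Longrightarrow> b \<le> T \<Longrightarrow> G b - G a \<le> (LINT r|lebesgue_on {a..b}. M r * G r)"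
    and t: "t \<in> {0..T}"
  shows "G t = 0"
proof -
  obtain h where h: "h > 0"
      "\<And>a b. 0 \<le> a \<Longrightarrow> a \<le> b \<Longrightarrow> b \<le> T \<Longrightarrow> b - a \<le> h \<Longrightarrow> (LINT r|lebesgue_on {a..b}. M r) \<le> 1/2"
    using uniformly_small_integral[OF M(1), of "1/2"] by auto
  \<comment> \<open>The indicator of G being nonzero turns persistence of zeros into monotonicity,
    so \<open>locally_nonincreasing\<close> applies.\<close>
  define F where "F t = (if G t = 0 then 0 else (1::real))" for t
  have "F t \<le> F 0"
  proof (rule locally_nonincreasing[where F = F and a = 0 and b = t and T = T, OF h(1)])
    fix a b assume ab: "0 \<le> a" "a \<le> b" "b \<le> T" "b - a \<le> h"
    have "G b = 0" if "G a = 0"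
    proof -
      have "continuous_on {a..b} G" by (rule continuous_on_subset[OF G(1)]) (use ab in auto)
      then obtain c where c: "c \<in> {a..b}" "\<And>r. r \<in> {a..b} \<Longrightarrow> G r \<le> G c"
        using continuous_attains_sup[of "{a..b}" G] ab by auto
      have i: "integrable (lebesgue_on {a..c}) M"
        by (rule integrable_subinterval[OF M(1)]) (use ab c in auto)
      have "G c \<le> (LINT r|lebesgue_on {a..c}. M r * G r)"
        using ineq[of a c] that ab c by auto
      also have "\<dots> \<le> (LINT r|lebesgue_on {a..c}. M r * G c)"
      proof (rule integral_mono_AE')
        show "integrable (lebesgue_on {a..c}) (\<lambda>r. M r * G c)" using i by simp
        show "AE r in lebesgue_on {a..c}. M r * G r \<le> M r * G c"
          by (rule AE_I2) (use c M(2) in \<open>auto intro!: mult_left_mono\<close>)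
        show "AE r in lebesgue_on {a..c}. 0 \<le> M r * G c" using M(2) G(2) by simp
      qed
      also have "\<dots> = (LINT r|lebesgue_on {a..c}. M r) * G c" by simp
      also have "\<dots> \<le> 1/2 * G c" using ab c G(2) by (intro mult_right_mono h(2)) auto
      finally have "G c \<le> 0" by simp
      then show ?thesis using c(2)[of b] ab G(2)[of b] by simp
    qed
    then show "F b \<le> F a" by (auto simp: F_def)
  qed (use t in auto)
  then show ?thesis using G(3) by (auto simp: F_def split: if_splits)
qed

text \<open>Above the level \<open>?B\<close> the function falls at rate at least 1/2. Being
  nonnegative it must get below once, and looking back to the last time below the level shows that
  it cannot leave again.\<close>

lemma absorbing_ball:
  fixes y :: "real \<Rightarrow> real"
  assumes cont: "\<And>T. T > 0 \<Longrightarrow> continuous_on {0..T} y" and y0: "\<And>t. 0 \<le> y t" and K: "0 \<le> K"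
    and ineq: "\<And>a b. 0 \<le> a \<Longrightarrow> a \<le> b \<Longrightarrow> y b - y a \<le> (LINT r|lebesgue_on {a..b}. K - 1/2 * y r)"
  shows "\<forall>\<^sub>F t in at_top. y t \<le> 2 * K + 1"
proof -
  \<comment> \<open>The level at which K - y/2 becomes -1/2.\<close>
  let ?B = "2 * K + 1"
  have decay: "y b - y a \<le> - 1/2 * (b - a)" if ab: "0 \<le> a" "a \<le> b" and ge: "\<And>r. r \<in> {a..b} \<Longrightarrow> ?B \<le> y r" for a b
  proof -
    have "continuous_on {a..b} y"
      using continuous_on_subset[OF cont[of "b + 1"], of "{a..b}"] ab by auto
    then have i: "integrable (lebesgue_on {a..b}) (\<lambda>r. K - 1/2 * y r)"
      by (intro continuous_imp_integrable_real continuous_intros)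
    have "y b - y a \<le> (LINT r|lebesgue_on {a..b}. K - 1/2 * y r)" using ineq ab by blast
    also have "\<dots> \<le> (LINT r|lebesgue_on {a..b}. - 1/2)"
    proof (rule integral_mono_AE[OF i])
      show "AE r in lebesgue_on {a..b}. K - 1/2 * y r \<le> - 1/2"
        by (rule AE_I2) (use ge in \<open>auto simp: field_simps\<close>)
    qed simp
    also have "\<dots> = - 1/2 * (b - a)"
      using ab lebesgue_integral_eq_integral[of "{a..b}" "\<lambda>r. - 1/2 :: real"] by simp
    finally show ?thesis .
  qed
  have "\<exists>t0\<ge>0. y t0 < ?B"
  proof (rule ccontr)
    assume "\<not> (\<exists>t0\<ge>0. y t0 < ?B)"
    then have big: "?B \<le> y r" if "r \<ge> 0" for r using that not_less by blast
    define c where "c = y 0"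
    \<comment> \<open>By time 2 c + 1 a fall at rate 1/2 from height c has reached -1/2.\<close>
    have "y (2 * c + 1) - y 0 \<le> - 1/2 * (2 * c + 1 - 0)"
      using y0[of 0] big by (intro decay) (auto simp: c_def)
    then show False using y0[of "2 * c + 1"] by (simp add: c_def[symmetric] field_simps)
  qed
  then obtain t0 where t0: "t0 \<ge> 0" "y t0 < ?B" by blast
  have "y t \<le> ?B" if "t \<ge> t0" for t
  proof (rule ccontr)
    assume gt: "\<not> y t \<le> ?B"
    \<comment> \<open>Its maximum s is the last time up to t at which y is at most
      \<open>?B\<close>; after s the decay applies, so y t <= y r for r just after s, contradicting
      continuity at s.\<close>
    define S where "S = {t0..t} \<inter> y -` {..?B}"
    have ct: "continuous_on {t0..t} y"
      using continuous_on_subset[OF cont[of "t + 1"], of "{t0..t}"] t0 that by auto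
    have "closed S" unfolding S_def by (rule continuous_closed_preimage[OF ct]) auto
    moreover have "bounded S" unfolding S_def by (rule bounded_subset[of "{t0..t}"]) auto
    ultimately have "compact S" by (simp add: compact_eq_bounded_closed)
    moreover have "t0 \<in> S" using t0 that by (simp add: S_def)
    ultimately obtain s where s: "s \<in> S" "\<And>r. r \<in> S \<Longrightarrow> r \<le> s"
      using compact_attains_sup[of S] by blast
    have st: "t0 \<le> s" "s < t" "y s \<le> ?B" using s(1) gt by (auto simp: S_def less_le)
    have above: "y t \<le> y r" if "s < r" "r \<le> t" for r
    proof -
      have "y t - y r \<le> - 1/2 * (t - r)"
      proof (rule decay)
        fix x assume "x \<in> {r..t}"
        then have "x \<notin> S" using s(2)[of x] that by auto
        then show "?B \<le> y x" using \<open>x \<in> {r..t}\<close> that st by (auto simp: S_def)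
      qed (use that st t0 in auto)
      then show ?thesis using that by (simp add: field_simps)
    qed
    have "0 < y t - y s" using gt st by simp
    with ct st obtain d where d: "d > 0" "\<And>r. r \<in> {t0..t} \<Longrightarrow> dist r s < d \<Longrightarrow> dist (y r) (y s) < y t - y s"
      unfolding continuous_on_iff by (metis atLeastAtMost_iff less_imp_le)
    define r where "r = min (s + d / 2) t"
    have "dist (y r) (y s) < y t - y s" using d st by (intro d(2)) (auto simp: r_def dist_real_def)
    moreover have "y t \<le> y r" using d(1) st by (intro above) (auto simp: r_def)
    ultimately show False by (simp add: dist_real_def)
  qed
  then show ?thesis by (auto simp: eventually_at_top_linorder)
qed

section \<open>Oddness and the absorbing ball\<close>

text \<open>The simple functions approximating \<open>w\<close> have measurable pairings, and
  Cauchy-Schwarz carries this to the limit.\<close>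

lemma L2_time_pairing_measurable:
  assumes w: "L2_time L2_torus L2_norm T w" and \<psi>: "\<psi> \<in> L2_torus"
  shows "(\<lambda>r. L2_inner (w r) \<psi>) \<in> borel_measurable (lebesgue_on {0..T})"
proof -
  have wL: "AE t in lebesgue_on {0..T}. w t \<in> L2_torus" using w by (simp add: L2_time_def)
  obtain f :: "nat \<Rightarrow> real \<Rightarrow> tfun" where
    f: "\<And>n. finite (range (f n))" "\<And>n. range (f n) \<subseteq> L2_torus" "\<And>n v. f n -` {v} \<in> sets lebesgue"
    and lim: "AE t in lebesgue_on {0..T}. (\<lambda>n. L2_norm (\<lambda>p. f n t p - w t p)) \<longlonglongrightarrow> 0"
    using w unfolding L2_time_def by blast
  have "simple_function lebesgue (f n)" for n
    using f by (simp add: simple_function_def)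
  then have "(\<lambda>r. L2_inner (f n r) \<psi>) \<in> borel_measurable lebesgue" for n
    by (intro borel_measurable_simple_function simple_function_compose1[where g = "\<lambda>v. L2_inner v \<psi>"])
  then have "(\<lambda>r. L2_inner (f n r) \<psi>) \<in> borel_measurable (lebesgue_on {0..T})" for n
    by (rule measurable_restrict_space1)
  then show ?thesis
  proof (rule measurable_AE_limit)
    show "AE r in lebesgue_on {0..T}. (\<lambda>n. L2_inner (f n r) \<psi>) \<longlonglongrightarrow> L2_inner (w r) \<psi>"
      using wL lim
    proof eventually_elim
      case (elim r)
      have fL: "f n r \<in> L2_torus" for n using f(2) by blast
      have "(\<lambda>n. L2_norm (\<lambda>p. f n r p - w r p) * L2_norm \<psi>) \<longlonglongrightarrow> 0"
        using tendsto_mult[OF elim(2) tendsto_const[of "L2_norm \<psi>"]] by simp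
      then have "(\<lambda>n. L2_inner (f n r) \<psi> - L2_inner (w r) \<psi>) \<longlonglongrightarrow> 0"
      proof (rule Lim_null_comparison[rotated])
        show "\<forall>\<^sub>F n in sequentially. norm (L2_inner (f n r) \<psi> - L2_inner (w r) \<psi>)
            \<le> L2_norm (\<lambda>p. f n r p - w r p) * L2_norm \<psi>"
          using L2_Cauchy_Schwarz[OF L2_torus_diff[OF fL elim(1)] \<psi>]
          by (simp add: L2_inner_diff fL elim \<psi>)
      qed
      then show ?case by (simp add: LIM_zero_iff)
    qed
  qed simp
qed

lemma L2_time_norm_integrable:
  assumes "L2_time X L2_norm T w"
  shows "integrable (lebesgue_on {0..T}) (\<lambda>r. L2_norm (w r))"
proof (rule Bochner_Integration.integrable_bound)
  have i: "integrable (lebesgue_on {0..T}) (\<lambda>r. (L2_norm (w r))\<^sup>2)" using assms by (simp add: L2_time_def)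
  then show "integrable (lebesgue_on {0..T}) (\<lambda>r. 1 + (L2_norm (w r))\<^sup>2)" by simp
  \<comment> \<open>\<open>L2_time\<close> speaks of the squared norm only, so measurability of the
    norm is recovered by a square root.\<close>
  have "(\<lambda>r. sqrt ((L2_norm (w r))\<^sup>2)) \<in> borel_measurable (lebesgue_on {0..T})"
    by (rule measurable_compose[OF borel_measurable_integrable[OF i]]) simp
  then show "(\<lambda>r. L2_norm (w r)) \<in> borel_measurable (lebesgue_on {0..T})" by (simp add: L2_norm_ge)
  have "x \<le> 1 + x\<^sup>2" if "0 \<le> x" for x :: real
    using zero_le_power2[of "x - 1/2"] by (simp add: power2_diff field_simps)
  then show "AE r in lebesgue_on {0..T}. norm (L2_norm (w r)) \<le> norm (1 + (L2_norm (w r))\<^sup>2)"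
    by (simp add: L2_norm_ge)
qed

text \<open>\<open>B\<close> is the adjoint of the operation that makes \<open>v\<close> from
  \<open>u\<close>: the identity for \<eta> - \<Phi>, since constants in time cancel in increments,
  and identity plus reflection for the even part.\<close>

lemma weak_derivative_transform:
  assumes w: "has_time_derivative u w" and B: "\<And>\<psi>. \<psi> \<in> L2_torus \<Longrightarrow> B \<psi> \<in> L2_torus"
    "\<And>\<psi>. \<psi> \<in> L2_torus \<Longrightarrow> L2_norm (B \<psi>) \<le> c * L2_norm \<psi>"
    "\<And>\<phi> \<psi>. \<phi> \<in> L2_torus \<Longrightarrow> \<psi> \<in> L2_torus \<Longrightarrow> B (\<lambda>p. \<phi> p + \<psi> p) = (\<lambda>p. B \<phi> p + B \<psi> p)"
    and c: "0 \<le> c" and v: "\<And>t. 0 \<le> t \<Longrightarrow> v t \<in> L2_torus"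
    "\<And>s t \<psi>. 0 \<le> s \<Longrightarrow> 0 \<le> t \<Longrightarrow> \<psi> \<in> L2_torus \<Longrightarrow>
       L2_inner (v t) \<psi> - L2_inner (v s) \<psi> = L2_inner (u t) (B \<psi>) - L2_inner (u s) (B \<psi>)"
  shows "weak_derivative v (\<lambda>r \<psi>. L2_inner (w r) (B \<psi>)) (\<lambda>r. c * L2_norm (w r))"
  unfolding weak_derivative_def
proof (intro conjI allI impI ballI)
  have L2t: "L2_time L2_torus L2_norm T w" if "T > 0" for T
    using w that by (simp add: has_time_derivative_def)
  show "v t \<in> L2_torus" if "0 \<le> t" for t using v that by simp
  show "0 \<le> c * L2_norm (w r)" for r using c by (simp add: L2_norm_ge)
  show "L2_inner (v t) \<psi> - L2_inner (v s) \<psi> = (LINT r|lebesgue_on {s..t}. L2_inner (w r) (B \<psi>))"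
    if "0 \<le> s \<and> s \<le> t" "\<psi> \<in> L2_torus" for s t \<psi>
    using w v(2)[of s t \<psi>] B(1)[OF that(2)] that by (simp add: has_time_derivative_def)
  fix T :: real assume T: "0 < T"
  show "integrable (lebesgue_on {0..T}) (\<lambda>r. c * L2_norm (w r))"
    using L2_time_norm_integrable[OF L2t[OF T]] by simp
  show "(\<lambda>r. L2_inner (w r) (B \<psi>)) \<in> borel_measurable (lebesgue_on {0..T})" if "\<psi> \<in> L2_torus" for \<psi>
    by (rule L2_time_pairing_measurable[OF L2t[OF T] B(1)[OF that]])
  have "AE r in lebesgue_on {0..T}. w r \<in> L2_torus" using L2t[OF T] by (simp add: L2_time_def)
  then show "AE r in lebesgue_on {0..T}.
      (\<forall>\<psi>\<in>L2_torus. \<bar>L2_inner (w r) (B \<psi>)\<bar> \<le> c * L2_norm (w r) * L2_norm \<psi>) \<and>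
      (\<forall>\<phi>\<in>L2_torus. \<forall>\<psi>\<in>L2_torus. L2_inner (w r) (B (\<lambda>p. \<phi> p + \<psi> p)) = L2_inner (w r) (B \<phi>) + L2_inner (w r) (B \<psi>))"
  proof eventually_elim
    case (elim r)
    show ?case
    proof (intro conjI ballI)
      fix \<psi> assume \<psi>: "\<psi> \<in> L2_torus"
      have "\<bar>L2_inner (w r) (B \<psi>)\<bar> \<le> L2_norm (w r) * L2_norm (B \<psi>)"
        by (rule L2_Cauchy_Schwarz[OF elim B(1)[OF \<psi>]])
      also have "\<dots> \<le> L2_norm (w r) * (c * L2_norm \<psi>)"
        by (intro mult_left_mono B(2) \<psi> L2_norm_ge)
      finally show "\<bar>L2_inner (w r) (B \<psi>)\<bar> \<le> c * L2_norm (w r) * L2_norm \<psi>" by (simp add: mult_ac)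
    next
      fix \<phi> \<psi> assume "\<phi> \<in> L2_torus" "\<psi> \<in> L2_torus"
      then show "L2_inner (w r) (B (\<lambda>p. \<phi> p + \<psi> p)) = L2_inner (w r) (B \<phi>) + L2_inner (w r) (B \<psi>)"
        by (simp add: B elim L2_inner_add_right)
    qed
  qed
qed

lemma fourier_coeff_cong_AE:
  assumes "u \<in> L2_torus" "v \<in> L2_torus" "AE p in lebesgue_on cell. u p = v p"
  shows "fourier_coeff u = fourier_coeff v"
proof (rule ext)
  fix \<xi>
  have "(LINT p|lebesgue_on cell. complex_of_real (u p) * ch (- \<xi>) p) = (LINT p|lebesgue_on cell. complex_of_real (v p) * ch (- \<xi>) p)"
    by (rule integral_cong_AE)
      (use assms L2_torus_integrable_mult[OF _ continuous_ch] in \<open>auto intro: borel_measurable_integrable elim!: eventually_mono\<close>)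
  then show "fourier_coeff u \<xi> = fourier_coeff v \<xi>" by (simp add: fourier_coeff_ch)
qed

lemma fourier_coeff_eq_0:
  assumes "u \<in> L2_torus" "L2_inner u u = 0"
  shows "fourier_coeff u \<xi> = 0"
proof -
  have "(LINT p|lebesgue_on cell. (u p)\<^sup>2) = 0" using assms(2) by (simp add: L2_inner_def power2_eq_square)
  then have "AE p in lebesgue_on cell. (u p)\<^sup>2 = 0"
    using integral_nonneg_eq_0_iff_AE[OF L2_torusD(2)[OF assms(1)]] by simp
  then have "AE p in lebesgue_on cell. u p = 0" by simp
  from fourier_coeff_cong_AE[OF assms(1) L2_torus_zero this] show ?thesis
    by (simp add: fourier_coeff_ch)
qed

lemma L2_inner_eq_0:
  assumes "u \<in> L2_torus" "\<And>\<xi>. fourier_coeff u \<xi> = 0"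
  shows "L2_inner u u = 0"
proof -
  have "((\<lambda>\<xi>::int \<times> int. 0 :: real) has_sum (L2_inner u u / (2*pi)\<^sup>2)) UNIV"
    using Parseval[OF assms(1)] by (simp add: assms(2))
  then have "L2_inner u u / (2*pi)\<^sup>2 = 0" using has_sum_unique[OF _ has_sum_0] by blast
  then show ?thesis by simp
qed

lemma L2_norm_xrefl: "u \<in> L2_torus \<Longrightarrow> L2_norm (xrefl u) = L2_norm u"
  by (simp add: L2_norm_sqrt L2_inner_xrefl L2_torus_xrefl)

lemma sobolev_const_nonneg: "0 \<le> sobolev_const"
  unfolding sobolev_const_def by (intro infsum_nonneg) simp

lemma global_solution_AE:
  assumes sol: "global_solution \<beta> \<delta> \<epsilon> \<eta>\<^sub>0 \<eta>"
  shows "\<And>t. 0 \<le> t \<Longrightarrow> \<eta> t \<in> L2_torus"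
    and "\<exists>w. has_time_derivative \<eta> w \<and> (\<forall>T>0. AE t in lebesgue_on {0..T}. \<eta> t \<in> H_torus 4 \<and> w t \<in> L2_torus \<and>
      (\<exists>v Au. fourier_mult sym_dx (\<eta> t) v \<and> fourier_mult (\<lambda>\<xi>. of_real (symbol \<beta> \<delta> \<epsilon> \<xi>)) (\<eta> t) Au \<and>
        (AE p in lebesgue_on cell. w t p + \<eta> t p * v p + Au p = 0)))"
proof -
  show L: "\<eta> t \<in> L2_torus" if "0 \<le> t" for t
  proof -
    \<comment> \<open>The horizon t + 1 is positive even when t = 0.\<close>
    have "C_time (H_torus 2) (H_norm 2) (t + 1) \<eta>" using sol that by (simp add: global_solution_def)
    then show ?thesis using that by (auto simp: C_time_def H_torus_def)
  qed
  obtain w where w: "has_time_derivative \<eta> w" and eq: "AE t in lebesgue_on {0..}. \<exists>ux uxx uyy L3 D2.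
           fourier_mult sym_dx (\<eta> t) ux \<and>
           fourier_mult (\<lambda>\<xi>. sym_dx \<xi> ^ 2) (\<eta> t) uxx \<and>
           fourier_mult (\<lambda>\<xi>. sym_dy \<xi> ^ 2) (\<eta> t) uyy \<and>
           fourier_mult (\<lambda>\<xi>. sym_Lambda \<xi> ^ 3) (\<eta> t) L3 \<and>
           fourier_mult (\<lambda>\<xi>. (sym_dx \<xi> ^ 2 + sym_dy \<xi> ^ 2) ^ 2) (\<eta> t) D2 \<and>
           (AE p in lebesgue. w t p + \<eta> t p * ux p + (\<beta> - 1) * uxx p - uyy p
                - \<delta> * L3 p + \<epsilon> * D2 p = 0)"
    using sol unfolding global_solution_def by blast
  have "AE t in lebesgue_on {0..T}. \<eta> t \<in> H_torus 4 \<and> w t \<in> L2_torus \<and>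
      (\<exists>v Au. fourier_mult sym_dx (\<eta> t) v \<and> fourier_mult (\<lambda>\<xi>. of_real (symbol \<beta> \<delta> \<epsilon> \<xi>)) (\<eta> t) Au \<and>
        (AE p in lebesgue_on cell. w t p + \<eta> t p * v p + Au p = 0))" if T: "T > 0" for T
  proof -
    have "AE t in lebesgue_on {0..T}. \<eta> t \<in> H_torus 4"
      using sol T by (simp add: global_solution_def L2_time_def)
    moreover have "AE t in lebesgue_on {0..T}. w t \<in> L2_torus"
      using w T by (simp add: has_time_derivative_def L2_time_def)
    moreover have "{0..T} \<subseteq> {0..}" "{0..T} \<in> sets lebesgue" "{0..} \<in> sets (lebesgue :: real measure)" by auto
    note AE_lebesgue_on_subset[OF eq this(3,2,1)]
    moreover have "AE t in lebesgue_on {0..T}. t \<in> {0..T}" by (rule AE_I2) simp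
    ultimately show ?thesis
    proof (eventually_elim)
      case (elim t)
      then obtain ux uxx uyy L3 D2 where m: "fourier_mult sym_dx (\<eta> t) ux"
          "fourier_mult (\<lambda>\<xi>. sym_dx \<xi> ^ 2) (\<eta> t) uxx" "fourier_mult (\<lambda>\<xi>. sym_dy \<xi> ^ 2) (\<eta> t) uyy"
          "fourier_mult (\<lambda>\<xi>. sym_Lambda \<xi> ^ 3) (\<eta> t) L3"
          "fourier_mult (\<lambda>\<xi>. (sym_dx \<xi> ^ 2 + sym_dy \<xi> ^ 2) ^ 2) (\<eta> t) D2"
        and e: "AE p in lebesgue. w t p + \<eta> t p * ux p + (\<beta> - 1) * uxx p - uyy p - \<delta> * L3 p + \<epsilon> * D2 p = 0"
        by blast
      have "fourier_mult (\<lambda>\<xi>. of_real (symbol \<beta> \<delta> \<epsilon> \<xi>)) (\<eta> t)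
          (\<lambda>p. (\<beta> - 1) * uxx p - uyy p - \<delta> * L3 p + \<epsilon> * D2 p)"
        using elim by (intro fourier_mult_symbol m L) auto
      moreover have "AE p in lebesgue_on cell. w t p + \<eta> t p * ux p + ((\<beta> - 1) * uxx p - uyy p - \<delta> * L3 p + \<epsilon> * D2 p) = 0"
        using e by (simp add: AE_restrict_space_iff) (auto elim!: eventually_mono simp: algebra_simps)
      ultimately show ?case using elim m(1) by blast
    qed
  qed
  with w show "\<exists>w. has_time_derivative \<eta> w \<and> (\<forall>T>0. AE t in lebesgue_on {0..T}. \<eta> t \<in> H_torus 4 \<and> w t \<in> L2_torus \<and>
      (\<exists>v Au. fourier_mult sym_dx (\<eta> t) v \<and> fourier_mult (\<lambda>\<xi>. of_real (symbol \<beta> \<delta> \<epsilon> \<xi>)) (\<eta> t) Au \<and>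
        (AE p in lebesgue_on cell. w t p + \<eta> t p * v p + Au p = 0)))" by blast
qed

text \<open>The initial condition holds only almost everywhere while \<eta>\<open>\<^sub>0\<close>
  is odd pointwise; Fourier coefficients ignore null sets and translate oddness into a sign change
  under k -> -k.\<close>

lemma initial_even_part:
  assumes "\<eta>\<^sub>0 \<in> H2_odd" "u \<in> L2_torus" "AE p in lebesgue. u p = \<eta>\<^sub>0 p"
  shows "L2_inner (\<lambda>p. u p + xrefl u p) (\<lambda>p. u p + xrefl u p) = 0"
proof (rule L2_inner_eq_0)
  have L0: "\<eta>\<^sub>0 \<in> L2_torus" and odd: "\<And>x y. - \<eta>\<^sub>0 (- x, y) = \<eta>\<^sub>0 (x, y)"
    using assms(1) by (auto simp: H2_odd_def H_torus_def)
  have "AE p in lebesgue_on cell. u p = \<eta>\<^sub>0 p"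
    using assms(3) by (simp add: AE_restrict_space_iff) (auto elim!: eventually_mono)
  from fourier_coeff_cong_AE[OF assms(2) L0 this] have eq: "fourier_coeff u = fourier_coeff \<eta>\<^sub>0" .
  have "xrefl \<eta>\<^sub>0 = (\<lambda>p. (-1) * \<eta>\<^sub>0 p)"
  proof (rule ext)
    show "xrefl \<eta>\<^sub>0 p = (-1) * \<eta>\<^sub>0 p" for p using odd[of "fst p" "snd p"] by (cases p) simp
  qed
  then have "fourier_coeff (xrefl \<eta>\<^sub>0) \<xi> = - fourier_coeff \<eta>\<^sub>0 \<xi>" for \<xi>
    using fourier_coeff_scale[of "-1" \<eta>\<^sub>0 \<xi>] by simp
  then have "fourier_coeff \<eta>\<^sub>0 (- k, l) = - fourier_coeff \<eta>\<^sub>0 (k, l)" for k l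
    using fourier_coeff_xrefl[OF L0, of k l] by simp
  then show "fourier_coeff (\<lambda>p. u p + xrefl u p) \<xi> = 0" for \<xi>
    by (cases \<xi>) (simp add: fourier_coeff_add assms(2) L2_torus_xrefl fourier_coeff_xrefl eq)
  show "(\<lambda>p. u p + xrefl u p) \<in> L2_torus" by (intro L2_torus_add L2_torus_xrefl assms)
qed

text \<open>The even part \<open>e\<close> satisfies a linear equation with coefficient \<open>\<eta>\<^sub>x\<close>, whose supremum is bounded by
  the squared \<open>H\<^sup>4\<close> norm and hence integrable in time, so that \<open>e = 0\<close> by Gronwall's lemma.\<close>

lemma solution_odd:
  assumes \<epsilon>: "\<epsilon> > 0" and \<eta>0: "\<eta>\<^sub>0 \<in> H2_odd" and sol: "global_solution \<beta> \<delta> \<epsilon> \<eta>\<^sub>0 \<eta>" and t: "0 \<le> t"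
  shows "fourier_coeff (\<eta> t) (- k, l) = - fourier_coeff (\<eta> t) (k, l)"
proof -
  note L = global_solution_AE(1)[OF sol]
  obtain w where w: "has_time_derivative \<eta> w" and
    pde: "\<And>T. T > 0 \<Longrightarrow> AE t in lebesgue_on {0..T}. \<eta> t \<in> H_torus 4 \<and> w t \<in> L2_torus \<and>
      (\<exists>v Au. fourier_mult sym_dx (\<eta> t) v \<and> fourier_mult (\<lambda>\<xi>. of_real (symbol \<beta> \<delta> \<epsilon> \<xi>)) (\<eta> t) Au \<and>
        (AE p in lebesgue_on cell. w t p + \<eta> t p * v p + Au p = 0))"
    using global_solution_AE(2)[OF sol] by blast
  obtain C where C: "C \<ge> 0" "\<And>\<xi>. (real_of_int (fst \<xi>))\<^sup>2 - C \<le> symbol \<beta> \<delta> \<epsilon> \<xi>"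
    using symbol_coercive[OF \<epsilon>] by blast
  have C': "- C \<le> symbol \<beta> \<delta> \<epsilon> \<xi>" for \<xi>
    using C(2)[of \<xi>] zero_le_power2[of "real_of_int (fst \<xi>)"] by linarith
  define e where "e t = (\<lambda>p. \<eta> t p + xrefl (\<eta> t) p)" for t
  define B where "B \<psi> = (\<lambda>p. \<psi> p + xrefl \<psi> p)" for \<psi> :: tfun
  have eL: "e t \<in> L2_torus" if "0 \<le> t" for t
    unfolding e_def by (intro L2_torus_add L2_torus_xrefl L that)
  have wd: "weak_derivative e (\<lambda>r \<psi>. L2_inner (w r) (B \<psi>)) (\<lambda>r. 2 * L2_norm (w r))"
  proof (rule weak_derivative_transform[OF w])
    show "B \<psi> \<in> L2_torus" if "\<psi> \<in> L2_torus" for \<psi>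
      unfolding B_def by (intro L2_torus_add L2_torus_xrefl that)
    show "L2_norm (B \<psi>) \<le> 2 * L2_norm \<psi>" if "\<psi> \<in> L2_torus" for \<psi>
      unfolding B_def using L2_norm_triangle[OF that L2_torus_xrefl[OF that]] L2_norm_xrefl[OF that] by simp
    show "B (\<lambda>p. \<phi> p + \<psi> p) = (\<lambda>p. B \<phi> p + B \<psi> p)" for \<phi> \<psi>
      by (auto simp: B_def xrefl_def split: prod.splits)
    have "L2_inner (e t) \<psi> = L2_inner (\<eta> t) (B \<psi>)" if "0 \<le> t" "\<psi> \<in> L2_torus" for t \<psi>
      unfolding e_def B_def using L[OF that(1)] that(2)
      by (simp add: L2_inner_add L2_inner_add_right L2_torus_xrefl L2_inner_xrefl)
    then show "L2_inner (e t) \<psi> - L2_inner (e s) \<psi> = L2_inner (\<eta> t) (B \<psi>) - L2_inner (\<eta> s) (B \<psi>)"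
      if "0 \<le> s" "0 \<le> t" "\<psi> \<in> L2_torus" for s t \<psi> using that by simp
  qed (use eL in auto)
  define T where "T = t + 1"
  have T: "T > 0" using t by (simp add: T_def)
  define M where "M r = 1/2 * ((H_norm 4 (\<eta> r))\<^sup>2 + sobolev_const) + 2 * C" for r
  define G where "G r = L2_inner (e r) (e r)" for r
  have Mi: "integrable (lebesgue_on {0..T}) M"
    unfolding M_def using sol T by (simp add: global_solution_def L2_time_def)
  have M0: "0 \<le> M r" for r
    unfolding M_def using sobolev_const_nonneg C(1) by simp
  have Gc: "continuous_on {0..T} G"
    unfolding G_def by (rule continuous_norm[OF wd T])
  have G0: "0 \<le> G r" for r by (simp add: G_def L2_inner_self_ge)
  have MG: "integrable (lebesgue_on {0..T}) (\<lambda>r. M r * G r)"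
  proof -
    obtain c where c: "\<And>r. r \<in> {0..T} \<Longrightarrow> G r \<le> c"
      using continuous_attains_sup[OF compact_Icc _ Gc] T by force
    show ?thesis
    proof (rule Bochner_Integration.integrable_bound)
      show "integrable (lebesgue_on {0..T}) (\<lambda>r. M r * c)" using Mi by simp
      show "(\<lambda>r. M r * G r) \<in> borel_measurable (lebesgue_on {0..T})"
        by (intro borel_measurable_times borel_measurable_integrable[OF Mi]
            continuous_imp_measurable_on_sets_lebesgue[OF Gc]) simp
      show "AE r in lebesgue_on {0..T}. norm (M r * G r) \<le> norm (M r * c)"
      proof (rule AE_I2)
        fix r assume "r \<in> space (lebesgue_on {0..T})"
        then have "G r \<le> c" using c by simp
        then have "M r * G r \<le> M r * c" using M0 by (intro mult_left_mono)
        then show "norm (M r * G r) \<le> norm (M r * c)" using M0[of r] G0[of r] by simp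
      qed
    qed
  qed
  have le: "AE r in lebesgue_on {0..T}. 2 * L2_inner (w r) (B (e r)) \<le> M r * G r"
    using pde[OF T]
  proof eventually_elim
    case (elim r)
    then obtain v Au where *: "fourier_mult sym_dx (\<eta> r) v"
      "fourier_mult (\<lambda>\<xi>. of_real (symbol \<beta> \<delta> \<epsilon> \<xi>)) (\<eta> r) Au"
      "AE p in lebesgue_on cell. w r p + \<eta> r p * v p + Au p = 0" by blast
    \<comment> \<open>\<open>e r\<close> is invariant under reflection, so \<open>B\<close> doubles
      it; this supplies the factor 4 of \<open>even_part_estimate\<close>.\<close>
    have "B (e r) = (\<lambda>p. 2 * e r p)" by (auto simp: B_def e_def xrefl_def)
    then have "2 * L2_inner (w r) (B (e r)) = 4 * L2_inner (w r) (e r)" by (simp add: L2_inner_scale_right)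
    then show ?case
      using even_part_estimate[OF C' _ *(1,2) _ *(3)] elim by (simp add: e_def M_def G_def)
  qed
  have "G t = 0"
  proof (rule gronwall_zero[OF Mi M0 Gc G0])
    have "AE p in lebesgue. \<eta> 0 p = \<eta>\<^sub>0 p" using sol by (simp add: global_solution_def)
    then show "G 0 = 0" unfolding G_def e_def by (intro initial_even_part[OF \<eta>0] L) auto
    show "G b - G a \<le> (LINT r|lebesgue_on {a..b}. M r * G r)" if "0 \<le> a" "a \<le> b" "b \<le> T" for a b
      unfolding G_def using energy_inequality[OF wd T that MG le] unfolding G_def .
  qed (use t in \<open>simp add: T_def\<close>)
  then have "fourier_coeff (e t) (k, l) = 0"
    unfolding G_def by (rule fourier_coeff_eq_0[OF eL[OF t]])
  then show ?thesis
    unfolding e_def using L[OF t] by (simp add: fourier_coeff_add L2_torus_xrefl fourier_coeff_xrefl add_eq_0_iff)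
qed

lemma absorbing_radius:
  assumes \<epsilon>: "\<epsilon> > 0"
  shows "\<exists>R. \<forall>\<eta>\<^sub>0\<in>H2_odd. \<forall>\<eta>. global_solution \<beta> \<delta> \<epsilon> \<eta>\<^sub>0 \<eta> \<longrightarrow>
    Limsup at_top (\<lambda>t. ereal (L2_norm (\<eta> t))) \<le> ereal R"
proof -
  obtain \<Phi> K where \<Phi>: "\<Phi> \<in> L2_torus" and K: "K \<ge> 0" and est: "\<forall>u v Au w. u \<in> H_torus 4 \<longrightarrow>
    (\<forall>k l. fourier_coeff u (- k, l) = - fourier_coeff u (k, l)) \<longrightarrow> fourier_mult sym_dx u v \<longrightarrow>
    fourier_mult (\<lambda>\<xi>. of_real (symbol \<beta> \<delta> \<epsilon> \<xi>)) u Au \<longrightarrow> w \<in> L2_torus \<longrightarrow>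
    (AE p in lebesgue_on cell. w p + u p * v p + Au p = 0) \<longrightarrow>
    2 * L2_inner w (\<lambda>p. u p - \<Phi> p) \<le> K - 1/2 * L2_inner (\<lambda>p. u p - \<Phi> p) (\<lambda>p. u p - \<Phi> p)"
    using absorbing_estimate[OF \<epsilon>, of \<beta> \<delta>] by (elim bexE exE conjE) (rule that)
  \<comment> \<open>Eventually \<eta> - \<Phi> has squared norm at most 2 K + 1; the triangle
    inequality adds the norm of \<Phi>.\<close>
  define R where "R = sqrt (2 * K + 1) + L2_norm \<Phi>"
  have "Limsup at_top (\<lambda>t. ereal (L2_norm (\<eta> t))) \<le> ereal R"
    if \<eta>0: "\<eta>\<^sub>0 \<in> H2_odd" and sol: "global_solution \<beta> \<delta> \<epsilon> \<eta>\<^sub>0 \<eta>" for \<eta>\<^sub>0 \<eta>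
  proof -
    note L = global_solution_AE(1)[OF sol]
    obtain w where w: "has_time_derivative \<eta> w" and
      pde: "\<And>T. T > 0 \<Longrightarrow> AE t in lebesgue_on {0..T}. \<eta> t \<in> H_torus 4 \<and> w t \<in> L2_torus \<and>
        (\<exists>v Au. fourier_mult sym_dx (\<eta> t) v \<and> fourier_mult (\<lambda>\<xi>. of_real (symbol \<beta> \<delta> \<epsilon> \<xi>)) (\<eta> t) Au \<and>
          (AE p in lebesgue_on cell. w t p + \<eta> t p * v p + Au p = 0))"
      using global_solution_AE(2)[OF sol] by blast
    define v where "v t = (\<lambda>p. \<eta> t p - \<Phi> p)" for t
    have vL: "v t \<in> L2_torus" if "0 \<le> t" for t
      unfolding v_def by (intro L2_torus_diff L \<Phi> that)
    have wd: "weak_derivative v (\<lambda>r \<psi>. L2_inner (w r) \<psi>) (\<lambda>r. 1 * L2_norm (w r))"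
    proof (rule weak_derivative_transform[OF w, where B = "\<lambda>\<psi>. \<psi>"])
      show "L2_inner (v t) \<psi> - L2_inner (v s) \<psi> = L2_inner (\<eta> t) \<psi> - L2_inner (\<eta> s) \<psi>"
        if "0 \<le> s" "0 \<le> t" "\<psi> \<in> L2_torus" for s t \<psi>
        unfolding v_def using that L \<Phi> by (simp add: L2_inner_diff)
    qed (use vL in auto)
    define y where "y t = L2_inner (v t) (v t)" for t
    have cont: "continuous_on {0..T} y" if "T > 0" for T
      unfolding y_def by (rule continuous_norm[OF wd that])
    have "\<forall>\<^sub>F t in at_top. y t \<le> 2 * K + 1"
    proof (rule absorbing_ball[OF cont _ K])
      show "0 \<le> y t" for t by (simp add: y_def L2_inner_self_ge)
      fix a b :: real assume ab: "0 \<le> a" "a \<le> b"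
      define T where "T = b + 1"
      have T: "T > 0" "b \<le> T" using ab by (simp_all add: T_def)
      have gi: "integrable (lebesgue_on {0..T}) (\<lambda>r. K - 1/2 * y r)"
        by (intro continuous_imp_integrable_real continuous_intros cont T)
      have "AE r in lebesgue_on {0..T}. r \<in> {0..T}" by (rule AE_I2) simp
      with pde[OF T(1)] have "AE r in lebesgue_on {0..T}. 2 * L2_inner (w r) (v r) \<le> K - 1/2 * y r"
      proof eventually_elim
        case (elim r)
        then obtain ux Au where *: "fourier_mult sym_dx (\<eta> r) ux"
          "fourier_mult (\<lambda>\<xi>. of_real (symbol \<beta> \<delta> \<epsilon> \<xi>)) (\<eta> r) Au"
          "AE p in lebesgue_on cell. w r p + \<eta> r p * ux p + Au p = 0" by blast
        have "fourier_coeff (\<eta> r) (- k, l) = - fourier_coeff (\<eta> r) (k, l)" for k l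
          using solution_odd[OF \<epsilon> \<eta>0 sol] elim by simp
        then show ?case
          unfolding v_def y_def using elim by (intro est[rule_format, OF _ _ *(1,2) _ *(3)]) auto
      qed
      from energy_inequality[OF wd T(1) ab T(2) gi this]
      show "y b - y a \<le> (LINT r|lebesgue_on {a..b}. K - 1/2 * y r)" by (simp add: y_def)
    qed
    then have "\<forall>\<^sub>F t in at_top. ereal (L2_norm (\<eta> t)) \<le> ereal R"
      using eventually_ge_at_top[of 0]
    proof eventually_elim
      case (elim t)
      have "L2_norm (\<eta> t) \<le> L2_norm (v t) + L2_norm \<Phi>"
        using L2_norm_triangle[OF vL[OF elim(2)] \<Phi>] by (simp add: v_def)
      also have "L2_norm (v t) \<le> sqrt (2 * K + 1)"
        using elim(1) by (simp add: L2_norm_sqrt y_def)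
      finally show ?case by (simp add: R_def)
    qed
    then show ?thesis by (rule Limsup_bounded)
  qed
  then show ?thesis by blast
qed

theorem theorem2:
  "\<exists>R :: real \<Rightarrow> real \<Rightarrow> real \<Rightarrow> real.
     \<forall>\<beta> \<gamma> L lam \<delta> \<epsilon> :: real.
       0 < \<beta> \<and> 0 \<le> \<gamma> \<and> \<gamma> \<le> 2 \<and> 0 < L \<and>
       lam = 2 * pi / L \<and> \<delta> = \<gamma> * lam \<and> \<epsilon> = lam\<^sup>2 \<longrightarrow>
       (\<forall>\<eta>\<^sub>0 \<in> H2_odd. \<forall>\<eta>. global_solution \<beta> \<delta> \<epsilon> \<eta>\<^sub>0 \<eta> \<longrightarrow>
          Limsup at_top (\<lambda>t. ereal (L2_norm (\<eta> t))) \<le> ereal (R \<epsilon> \<delta> \<beta>))"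
proof -
  define P where "P \<epsilon> \<delta> \<beta> R \<longleftrightarrow> (\<forall>\<eta>\<^sub>0\<in>H2_odd. \<forall>\<eta>. global_solution \<beta> \<delta> \<epsilon> \<eta>\<^sub>0 \<eta> \<longrightarrow>
    Limsup at_top (\<lambda>t. ereal (L2_norm (\<eta> t))) \<le> ereal R)" for \<epsilon> \<delta> \<beta> R :: real
  \<comment> \<open>A choice made from \<epsilon>, \<delta> and \<beta> alone is what makes the
    radius a function of these three parameters.\<close>
  have "P \<epsilon> \<delta> \<beta> (SOME R. P \<epsilon> \<delta> \<beta> R)" if "\<epsilon> > 0" for \<epsilon> \<delta> \<beta>
    using absorbing_radius[OF that, of \<beta> \<delta>] unfolding P_def[symmetric] by (rule someI_ex)
  moreover have "0 < lam\<^sup>2" if "0 < L" "lam = 2 * pi / L" for L lam :: real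
    using that by simp
  ultimately have "\<forall>\<beta> \<gamma> L lam \<delta> \<epsilon> :: real.
       0 < \<beta> \<and> 0 \<le> \<gamma> \<and> \<gamma> \<le> 2 \<and> 0 < L \<and>
       lam = 2 * pi / L \<and> \<delta> = \<gamma> * lam \<and> \<epsilon> = lam\<^sup>2 \<longrightarrow> P \<epsilon> \<delta> \<beta> (SOME R. P \<epsilon> \<delta> \<beta> R)"
    by simp
  then show ?thesis
    unfolding P_def by (rule exI[of _ "\<lambda>\<epsilon> \<delta> \<beta>. SOME R. P \<epsilon> \<delta> \<beta> R", unfolded P_def])
qed

end
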